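(* Let $f:\mathbb{A}\to\mathbb{A}$ be a $C^1$ symplectic twist diffeomorphism that is $C^0$-integrable, and let $u:\mathbb{A}\to\mathbb{R}$ be the generating function of its invariant foliation. Then $u$ is $C^1$. Moreover, for every $c\in\mathbb{R}$: (i) the graph of $\theta\mapsto c+\frac{\partial u}{\partial\theta}(\theta,c)$ is a leaf of the invariant foliation; (ii) the map $h_c:\mathbb{T}\to\mathbb{T}$, $h_c(\theta)=\theta+\frac{\partial u}{\partial c}(\theta,c)$, is a semi-conjugacy between the projected dynamics $g_c:\theta\mapsto \pi_1\circ f\big(\theta,c+\frac{\partial u}{\partial\theta}(\theta,c)\big)$ and a rotation $R$ of $\mathbb{T}$ (depending on $c$), i.e. $h_c\circ g_c=R\circ h_c$.
   Context: $\mathbb{T}=\mathbb{R}/\mathbb{Z}$, $\mathbb{A}=\mathbb{T}\times\mathbb{R}$ with coordinates $(\theta,r)$, $\pi_1(\theta,r)=\theta$, $\pi_2(\theta,r)=r$. $\mathbb{A}$ carries the symplectic form $\omega=-d\lambda$ with $\lambda=r\,d\theta$. A symplectic twist diffeomorphism is a $C^1$ diffeomorphism $f:\mathbb{A}\to\mathbb{A}$ isotopic to the identity, with $f^*\omega=\omega$, and with the twist property: for any lift $F=(F_1,F_2):\mathbb{R}^2\to\mathbb{R}^2$ of $f$ and any $\tilde\theta\in\mathbb{R}$, the map $r\mapsto F_1(\tilde\theta,r)$ is an increasing $C^1$ diffeomorphism from $\mathbb{R}$ onto $\mathbb{R}$. A continuous ($C^0$) foliation of $\mathbb{A}$ into graphs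 is a partition of $\mathbb{A}$ into graphs of continuous functions $\eta_c:\mathbb{T}\to\mathbb{R}$, $c\in\mathbb{R}$, normalized by $\int_{\mathbb{T}}\eta_c=c$, such that $(\theta,c)\mapsto(\theta,\eta_c(\theta))$ is a homeomorphism of $\mathbb{A}$. A foliation is invariant under $f$ if every leaf is mapped onto itself by $f$. $f$ is $C^0$-integrable if it has an invariant $C^0$-foliation into graphs. The generating function of such a foliation is the unique continuous $u:\mathbb{A}\to\mathbb{R}$ that is $C^1$ in the $\mathbb{T}$ variable with $u(0,c)=0$ for all $c$ and such that, for all $c$, the graph of $c+\frac{\partial u}{\partial\theta}(\cdot,c)$ is a leaf; thus $\eta_c(\theta)=c+\frac{\partial u}{\partial\theta}(\theta,c)$. *)

theory Defs
  imports "HOL-Analysis.Analysis" "HOL-Library.Disjoint_Sets"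
begin

quotient_type circle = real / "\<lambda>x y :: real. x - y \<in> \<int>"
  morphisms rep_circle to_circle
proof (rule equivpI)
  show "reflp (\<lambda>x y :: real. x - y \<in> \<int>)"
    by (simp add: reflp_def)
  show "symp (\<lambda>x y :: real. x - y \<in> \<int>)"
    by (metis (mono_tags, lifting) Ints_minus minus_diff_eq sympI)
  show "transp (\<lambda>x y :: real. x - y \<in> \<int>)"
  proof (rule transpI)
    fix x y z :: real
    assume "x - y \<in> \<int>" "y - z \<in> \<int>"
    then have "(x - y) + (y - z) \<in> \<int>" by (rule Ints_add)
    then show "x - z \<in> \<int>" by simp
  qed
qed

instantiation circle :: ab_group_add
begin

lift_definition zero_circle :: circle is "0 :: real" .

lift_definition plus_circle :: "circle \<Rightarrow> circle \<Rightarrow> circle" is "(+) :: real \<Rightarrow> real \<Rightarrow> real"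
  by (metis Ints_add add_diff_add)

lift_definition uminus_circle :: "circle \<Rightarrow> circle" is "uminus :: real \<Rightarrow> real"
  by (metis Ints_minus minus_diff_minus)

lift_definition minus_circle :: "circle \<Rightarrow> circle \<Rightarrow> circle" is "(-) :: real \<Rightarrow> real \<Rightarrow> real"
proof -
  fix a b c d :: real
  assume "a - b \<in> \<int>" "c - d \<in> \<int>"
  then have "(a - b) - (c - d) \<in> \<int>" by (rule Ints_diff)
  then show "(a - c) - (b - d) \<in> \<int>" by (simp add: algebra_simps)
qed

instance
  by standard (transfer; simp add: algebra_simps)+

end

text \<open>The quotient topology.\<close>

instantiation circle :: topological_space
begin

definition open_circle :: "circle set \<Rightarrow> bool" where
  "open_circle U \<longleftrightarrow> open (to_circle -` U)"

instance
proof
  show "open (UNIV :: circle set)"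
    by (simp add: open_circle_def)
  show "open (S \<inter> T)" if "open S" "open T" for S T :: "circle set"
    using that by (simp add: open_circle_def open_Int)
  show "open (\<Union>K)" if "\<forall>S\<in>K. open S" for K :: "circle set set"
    using that by (auto simp: open_circle_def vimage_Union)
qed

end

lemma to_circle_eq_iff: "to_circle x = to_circle y \<longleftrightarrow> x - y \<in> \<int>"
  by (rule circle.abs_eq_iff)

lemma continuous_on_to_circle: "continuous_on UNIV to_circle"
  by (simp add: continuous_on_open_vimage open_circle_def)

type_synonym annulus = "circle \<times> real"

definition cover :: "real \<times> real \<Rightarrow> annulus" where
  "cover x = (to_circle (fst x), snd x)"

definition circle_integral :: "(circle \<Rightarrow> real) \<Rightarrow> real" where
  "circle_integral \<phi> = integral {0..1} (\<lambda>t. \<phi> (to_circle t))"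

definition rotation :: "circle \<Rightarrow> circle \<Rightarrow> circle" where
  "rotation \<alpha> \<theta> = \<theta> + \<alpha>"

definition C1_map :: "('a::real_normed_vector \<Rightarrow> 'b::real_normed_vector) \<Rightarrow> bool" where
  "C1_map g \<longleftrightarrow> (\<exists>g' :: 'a \<Rightarrow> 'a \<Rightarrow>\<^sub>L 'b.
     (\<forall>x. (g has_derivative blinfun_apply (g' x)) (at x)) \<and> continuous_on UNIV g')"

definition is_lift :: "(real \<times> real \<Rightarrow> real \<times> real) \<Rightarrow> (annulus \<Rightarrow> annulus) \<Rightarrow> bool" where
  "is_lift F f \<longleftrightarrow> continuous_on UNIV F \<and> (\<forall>x. cover (F x) = f (cover x))"

text \<open>Every continuous self-map of the annulus has a lift to the plane, any two lifts differ by
  an integer translation, and \<^const>\<open>cover\<close> is a local diffeomorphism for the standard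
  smooth structure of the annulus. So differentiability on the annulus can be read off in the
  universal cover.\<close>

definition C1_annulus_map :: "(annulus \<Rightarrow> annulus) \<Rightarrow> bool" where
  "C1_annulus_map f \<longleftrightarrow> (\<exists>F. is_lift F f \<and> C1_map F)"

definition C1_annulus_fun :: "(annulus \<Rightarrow> real) \<Rightarrow> bool" where
  "C1_annulus_fun u \<longleftrightarrow> C1_map (\<lambda>x. u (cover x))"

definition C1_annulus_diffeo :: "(annulus \<Rightarrow> annulus) \<Rightarrow> bool" where
  "C1_annulus_diffeo f \<longleftrightarrow> bij f \<and> C1_annulus_map f \<and> C1_annulus_map (inv f)"

definition increasing_C1_diffeo :: "(real \<Rightarrow> real) \<Rightarrow> bool" where
  "increasing_C1_diffeo g \<longleftrightarrow> strict_mono g \<and> bij g \<and> C1_map g \<and> C1_map (inv g)"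

text \<open>The map \<open>s \<mapsto> \<theta> + to_circle s\<close> is a local parametrization of the circle at
  \<open>\<theta>\<close>, with \<open>s = 0\<close> sent to \<open>\<theta>\<close>.\<close>

definition partial_theta :: "(annulus \<Rightarrow> real) \<Rightarrow> circle \<Rightarrow> real \<Rightarrow> real" where
  "partial_theta u \<theta> c = deriv (\<lambda>s. u (\<theta> + to_circle s, c)) 0"

definition partial_c :: "(annulus \<Rightarrow> real) \<Rightarrow> circle \<Rightarrow> real \<Rightarrow> real" where
  "partial_c u \<theta> c = deriv (\<lambda>s. u (\<theta>, s)) c"

text \<open>Differential forms on the annulus are written on its universal cover, in the coordinates
  \<open>(\<theta>, r)\<close>. The exterior derivative is given by the usual formula for constant vector
  fields \<open>v\<close>, \<open>w\<close>.\<close>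

definition liouville_form :: "real \<times> real \<Rightarrow> real \<times> real \<Rightarrow> real" where
  "liouville_form x v = snd x * fst v"

definition ext_deriv ::
    "(real \<times> real \<Rightarrow> real \<times> real \<Rightarrow> real) \<Rightarrow> real \<times> real \<Rightarrow> real \<times> real \<Rightarrow> real \<times> real \<Rightarrow> real" where
  "ext_deriv a x v w =
     frechet_derivative (\<lambda>y. a y w) (at x) v - frechet_derivative (\<lambda>y. a y v) (at x) w"

definition symplectic_form :: "real \<times> real \<Rightarrow> real \<times> real \<Rightarrow> real \<times> real \<Rightarrow> real" where
  "symplectic_form x v w = - ext_deriv liouville_form x v w"

lemma symplectic_form_eq: "symplectic_form x v w = fst v * snd w - snd v * fst w"
proof -
  have "((\<lambda>y. liouville_form y v) has_derivative (\<lambda>h. snd h * fst v)) (at x)" for v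
    unfolding liouville_form_def by (auto intro!: derivative_eq_intros)
  then have "frechet_derivative (\<lambda>y. liouville_form y v) (at x) = (\<lambda>h. snd h * fst v)" for v
    by (metis frechet_derivative_at)
  then show ?thesis
    by (simp add: symplectic_form_def ext_deriv_def algebra_simps)
qed

definition symplectic :: "(annulus \<Rightarrow> annulus) \<Rightarrow> bool" where
  "symplectic f \<longleftrightarrow> (\<forall>F. is_lift F f \<longrightarrow> (\<forall>x v w.
     symplectic_form (F x) (frechet_derivative F (at x) v) (frechet_derivative F (at x) w)
       = symplectic_form x v w))"

text \<open>An isotopy through homeomorphisms, jointly continuous: the weakest of the usual notions.\<close>

definition isotopic_to_id :: "(annulus \<Rightarrow> annulus) \<Rightarrow> bool" where
  "isotopic_to_id f \<longleftrightarrow>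
     homotopic_with_canon (\<lambda>h. \<exists>k. homeomorphism UNIV UNIV h k) UNIV UNIV id f"

definition twist :: "(annulus \<Rightarrow> annulus) \<Rightarrow> bool" where
  "twist f \<longleftrightarrow>
     (\<forall>F. is_lift F f \<longrightarrow> (\<forall>\<theta>. increasing_C1_diffeo (\<lambda>r. fst (F (\<theta>, r)))))"

definition symplectic_twist_diffeo :: "(annulus \<Rightarrow> annulus) \<Rightarrow> bool" where
  "symplectic_twist_diffeo f \<longleftrightarrow>
     C1_annulus_diffeo f \<and> isotopic_to_id f \<and> symplectic f \<and> twist f"

definition graph_of :: "(circle \<Rightarrow> real) \<Rightarrow> annulus set" where
  "graph_of \<eta> = {(\<theta>, r). r = \<eta> \<theta>}"

text \<open>A foliation is given as its set of leaves; the normalization makes the family \<open>\<eta>\<close>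
  of graph functions unique.\<close>

definition C0_foliation :: "annulus set set \<Rightarrow> bool" where
  "C0_foliation L \<longleftrightarrow> partition_on UNIV L \<and>
     (\<exists>\<eta> :: real \<Rightarrow> circle \<Rightarrow> real.
        L = range (\<lambda>c. graph_of (\<eta> c)) \<and>
        (\<forall>c. continuous_on UNIV (\<eta> c) \<and> circle_integral (\<eta> c) = c) \<and>
        (\<exists>k. homeomorphism UNIV UNIV (\<lambda>(\<theta>, c). (\<theta>, \<eta> c \<theta>)) k))"

definition invariant_foliation :: "(annulus \<Rightarrow> annulus) \<Rightarrow> annulus set set \<Rightarrow> bool" where
  "invariant_foliation f L \<longleftrightarrow> (\<forall>l\<in>L. f ` l = l)"

definition C0_integrable :: "(annulus \<Rightarrow> annulus) \<Rightarrow> bool" where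
  "C0_integrable f \<longleftrightarrow> (\<exists>L. C0_foliation L \<and> invariant_foliation f L)"

definition generating_function :: "annulus set set \<Rightarrow> (annulus \<Rightarrow> real) \<Rightarrow> bool" where
  "generating_function L u \<longleftrightarrow>
     continuous_on UNIV u \<and>
     (\<forall>c. C1_map (\<lambda>t. u (to_circle t, c))) \<and>
     (\<forall>c. u (0, c) = 0) \<and>
     (\<forall>c. graph_of (\<lambda>\<theta>. c + partial_theta u \<theta> c) \<in> L)"

definition projected_dynamics ::
    "(annulus \<Rightarrow> annulus) \<Rightarrow> (annulus \<Rightarrow> real) \<Rightarrow> real \<Rightarrow> circle \<Rightarrow> circle" where
  "projected_dynamics f u c \<theta> = fst (f (\<theta>, c + partial_theta u \<theta> c))"

definition conj_map :: "(annulus \<Rightarrow> real) \<Rightarrow> real \<Rightarrow> circle \<Rightarrow> circle" where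
  "conj_map u c \<theta> = \<theta> + to_circle (partial_c u \<theta> c)"

definition semiconjugacy ::
    "(circle \<Rightarrow> circle) \<Rightarrow> (circle \<Rightarrow> circle) \<Rightarrow> (circle \<Rightarrow> circle) \<Rightarrow> bool" where
  "semiconjugacy h g R \<longleftrightarrow> continuous_on UNIV h \<and> surj h \<and> h \<circ> g = R \<circ> h"

end

theory Submission
  imports Defs
begin

text \<open>
  All arguments take place in the universal cover. The leaf of parameter \<open>c\<close> is the graph of \<open>\<eta> c\<close>,
  the function \<open>U c x = c * x + u (x, c)\<close> is its primitive, and \<open>G c\<close> is the lift of the projected
  dynamics. The task is to differentiate \<open>U\<close> in \<open>c\<close>.

  \<^emph>\<open>Action.\<close> The lifted map has a generating function \<open>S\<close>. By the twist property and because points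
  below a leaf stay below it, the function \<open>U c y - U c x - S x y\<close> is maximal in \<open>y\<close> exactly at
  \<open>y = G c x\<close>, and its maximum does not depend on \<open>x\<close>; call it \<open>\<alpha> c\<close> (\<open>\<phi>_max\<close>,
  \<open>action_constant\<close>). Comparing the maxima for two leaves \<open>c < d\<close> gives, with \<open>V = U d - U c\<close>,
  \<open>V (G c x) - V x \<le> \<alpha> d - \<alpha> c \<le> V (G d x) - V x\<close>. The rest of the proof relies on these inequalities
  and on the shear of the map along leaves of periodic points. They say that \<open>V / (d - c)\<close>, an
  increasing map of degree one, is nearly a conjugacy of the dynamics on the two leaves to a translation.
  In particular the rotation number \<open>rho\<close> exists and is the derivative of \<open>\<alpha>\<close>.

  \<^emph>\<open>Irrational leaves.\<close> The orbits on such a leaf are ordered like those of the rotation. So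
  \<open>V / (d - c)\<close> is squeezed between positions \<open>n * rho c + m\<close>, which are dense, and it converges when
  both leaves tend to the given one (\<open>irrational_strict_param_deriv\<close>).

  \<^emph>\<open>Rational leaves.\<close> If \<open>rho c0 = p / q\<close>, the rotation number crosses \<open>p / q\<close> strictly at \<open>c0\<close>,
  and the leaf consists of points of period \<open>q\<close> (\<open>rational_leaf_periodic\<close>). Let \<open>\<delta>\<close> be the
  height of a nearby leaf \<open>c\<close> over this one. The \<open>q\<close>-th iterate moves the points of the nearby leaf
  slowly, by about \<open>\<tau> * \<delta>\<close>, where \<open>\<tau> > 0\<close> is the shear. The region between the two leaves, a vertical
  segment and the image of that segment is nearly a triangle of area \<open>\<tau> * \<delta>\<^sup>2 / 2\<close>. By the action
  inequalities its area is the same everywhere along the leaf (\<open>fundamental_area\<close>). Therefore \<open>\<delta>\<close>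
  is nearly proportional to \<open>\<tau>\<close> to the power \<open>-1/2\<close>; as its integral is \<open>c - c0\<close>, it has a derivative in
  \<open>c\<close> at \<open>c0\<close>, and so has \<open>U\<close> (\<open>density_right\<close>). This derivative and the derivatives of \<open>U\<close> on nearby
  leaves both count the steps of the same slow motion. Hence they are close to each other, which gives the
  continuity of the derivative at \<open>c0\<close> (\<open>conjugacies_converge\<close>).

  \<^emph>\<open>Conjugacy.\<close> In the limit the action inequalities from the two sides of a leaf become the equation
  \<open>D c (G c x) = D c x + rho c\<close> for the derivative \<open>D c\<close> of \<open>U\<close> in the parameter
  (\<open>param_deriv_properties\<close>), and \<open>D c\<close> is the lift of the map \<open>conj_map u c\<close>.
\<close>

section \<open>Lifts of monotone circle maps of degree one, and periodic functions\<close>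

definition degree_one :: "(real \<Rightarrow> real) \<Rightarrow> bool" where
  "degree_one h \<longleftrightarrow> mono h \<and> (\<forall>x. h (x + 1) = h x + 1)"

lemma shift_int:
  fixes h :: "real \<Rightarrow> real"
  assumes "\<And>x. h (x + 1) = h x + a"
  shows "h (x + of_int k) = h x + of_int k * a"
proof (induction k arbitrary: x rule: int_induct[where k = 0])
  case (step1 i)
  then show ?case using assms[of "x + of_int i"] by (simp add: algebra_simps)
next
  case (step2 i)
  then show ?case using assms[of "x + of_int i - 1"] by (simp add: algebra_simps)
qed simp

lemma degree_one_shift_int: "degree_one h \<Longrightarrow> h (x + of_int k) = h x + of_int k"
  using shift_int[of h 1] by (simp add: degree_one_def)

text \<open>A map of degree one commutes with integer translations, so it distorts the distance between two points
  by less than the distance to the next integer.\<close>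

lemma degree_one_bound:
  assumes "degree_one h"
  shows "\<bar>h x - h y - (x - y)\<bar> \<le> 1"
proof -
  define k where "k = \<lfloor>x - y\<rfloor>"
  have k: "of_int k \<le> x - y" "x - y < of_int k + 1"
    unfolding k_def by linarith+
  have "h (y + of_int k) \<le> h x" "h x \<le> h (y + of_int (k + 1))"
    using assms k by (auto simp: degree_one_def intro!: monoD[of h])
  then show ?thesis
    using k degree_one_shift_int[OF assms, of y k] degree_one_shift_int[OF assms, of y "k + 1"]
    by (simp add: abs_le_iff)
qed

lemma degree_one_funpow:
  assumes "degree_one h"
  shows "degree_one (h ^^ n)"
proof -
  have "(h ^^ n) (x + 1) = (h ^^ n) x + 1" for x
    using assms by (induction n) (auto simp: degree_one_def)
  then show ?thesis
    using assms by (auto simp: degree_one_def funpow_mono intro!: monoI)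
qed

lemma le_of_linear_bound:
  fixes a b C :: real
  assumes "\<And>n :: nat. n * a \<le> n * b + C"
  shows "a \<le> b"
proof (rule ccontr)
  assume "\<not> a \<le> b"
  moreover obtain n :: nat where "C / (a - b) < n" using reals_Archimedean2 by blast
  ultimately have "C < n * (a - b)" by (simp add: field_simps)
  then show False using assms[of n] by (simp add: algebra_simps)
qed

lemma periodic_frac:
  fixes g :: "real \<Rightarrow> 'a"
  assumes "\<And>x. g (x + 1) = g x"
  shows "g x = g (frac x)"
proof -
  have "g (x + of_int k) = g x" for x k
  proof (induction k arbitrary: x rule: int_induct[where k = 0])
    case (step1 i)
    then show ?case using assms[of "x + of_int i"] by (simp add: algebra_simps)
  next
    case (step2 i)
    then show ?case using assms[of "x + of_int i - 1"] by (simp add: algebra_simps)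
  qed simp
  from this[of "frac x" "\<lfloor>x\<rfloor>"] show ?thesis by (simp add: frac_def)
qed

lemma frac_mem: "frac x \<in> {0..1 :: real}"
  using frac_lt_1[of x] by (simp add: less_imp_le)

lemma periodic_continuous_pos_min:
  fixes g :: "real \<Rightarrow> real"
  assumes "continuous_on UNIV g" "\<And>x. g (x + 1) = g x" "\<And>x. 0 < g x"
  obtains m where "0 < m" "\<And>x. m \<le> g x"
proof -
  have "continuous_on {0..1} g" using assms(1) continuous_on_subset by blast
  then obtain z where "z \<in> {0..1}" "\<forall>y\<in>{0..1}. g z \<le> g y"
    using continuous_attains_inf[of "{0..1}" g] by auto
  then have "g z \<le> g x" for x
    using periodic_frac[of g x] assms(2) frac_mem by metis
  then show ?thesis using that assms(3) by blast
qed

lemma periodic_continuous_bound: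
  fixes g :: "real \<Rightarrow> real"
  assumes "continuous_on UNIV g" "\<And>x. g (x + 1) = g x"
  obtains M where "0 < M" "\<And>x. \<bar>g x\<bar> \<le> M"
proof -
  have "compact (g ` {0..1})"
    by (intro compact_continuous_image) (use assms(1) continuous_on_subset in blast, simp)
  then obtain M where M: "\<forall>y\<in>g ` {0..1}. norm y \<le> M"
    using compact_imp_bounded bounded_iff by blast
  have "\<bar>g x\<bar> \<le> max M 1" for x
    using periodic_frac[of g x, OF assms(2)] M frac_mem[of x] by (metis imageI max.coboundedI1 real_norm_def)
  then show ?thesis using that[of "max M 1"] by simp
qed

text \<open>Continuity of a family of periodic functions in its parameter is automatically uniform,
  since one period is compact.\<close>

lemma periodic_family_uniform:
  fixes g :: "real \<Rightarrow> real \<Rightarrow> real"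
  assumes cont: "continuous_on UNIV (\<lambda>(c, x). g c x)" and per: "\<And>c x. g c (x + 1) = g c x"
    and "0 < e"
  obtains d where "0 < d"
    "\<And>c x y. \<bar>c - c0\<bar> < d \<Longrightarrow> \<bar>x - y\<bar> < d \<Longrightarrow> \<bar>g c x - g c0 y\<bar> < e"
proof -
  let ?K = "{c0 - 1..c0 + 1} \<times> {-1..2 :: real}"
  have "uniformly_continuous_on ?K (\<lambda>(c, x). g c x)"
    by (intro compact_uniformly_continuous compact_Times continuous_on_subset[OF cont]) auto
  then obtain d where d: "0 < d"
    "\<And>p p'. p \<in> ?K \<Longrightarrow> p' \<in> ?K \<Longrightarrow> dist p' p < d \<Longrightarrow>
       dist ((\<lambda>(c, x). g c x) p') ((\<lambda>(c, x). g c x) p) < e"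
    using \<open>0 < e\<close> unfolding uniformly_continuous_on_def by metis
  define d' where "d' = min (d / 2) 1"
  have "\<bar>g c x - g c0 y\<bar> < e" if c: "\<bar>c - c0\<bar> < d'" and xy: "\<bar>x - y\<bar> < d'" for c x y
  proof -
    have 1: "g c x = g c (x - of_int \<lfloor>y\<rfloor>)"
      using periodic_frac[of "g c" x] periodic_frac[of "g c" "x - of_int \<lfloor>y\<rfloor>"] per
      by (simp add: frac_def)
    have 2: "g c0 y = g c0 (y - of_int \<lfloor>y\<rfloor>)"
      using periodic_frac[of "g c0" y] per by (simp add: frac_def)
    have y: "0 \<le> y - of_int \<lfloor>y\<rfloor>" "y - of_int \<lfloor>y\<rfloor> \<le> 1" by linarith+
    have "dist (c, x - of_int \<lfloor>y\<rfloor>) (c0, y - of_int \<lfloor>y\<rfloor>)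
        \<le> dist c c0 + dist (x - of_int \<lfloor>y\<rfloor>) (y - of_int \<lfloor>y\<rfloor>)"
      unfolding dist_Pair_Pair by (rule sqrt_sum_squares_le_sum) auto
    also have "\<dots> < d" using c xy by (auto simp: dist_real_def d'_def)
    finally have *: "dist (c, x - of_int \<lfloor>y\<rfloor>) (c0, y - of_int \<lfloor>y\<rfloor>) < d" .
    have "\<bar>c - c0\<bar> < 1" "\<bar>x - y\<bar> < 1" using c xy by (auto simp: d'_def)
    then have "(c, x - of_int \<lfloor>y\<rfloor>) \<in> ?K" "(c0, y - of_int \<lfloor>y\<rfloor>) \<in> ?K"
      using y by (auto, linarith+)
    then have "dist (g c (x - of_int \<lfloor>y\<rfloor>)) (g c0 (y - of_int \<lfloor>y\<rfloor>)) < e"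
      using d(2)[OF _ _ *] by auto
    then show ?thesis using 1 2 by (simp add: dist_real_def)
  qed
  moreover have "0 < d'" using d(1) by (simp add: d'_def)
  ultimately show ?thesis using that by blast
qed

lemma periodic_uniform:
  fixes g :: "real \<Rightarrow> real"
  assumes "continuous_on UNIV g" "\<And>x. g (x + 1) = g x" "0 < e"
  obtains d where "0 < d" "\<And>x y. \<bar>x - y\<bar> < d \<Longrightarrow> \<bar>g x - g y\<bar> < e"
proof -
  have "continuous_on UNIV (\<lambda>(c :: real, x). g x)"
    unfolding case_prod_unfold by (rule continuous_on_compose2[OF assms(1)]) (auto intro!: continuous_intros)
  then obtain d where "0 < d" "\<And>c x y. \<bar>c - 0\<bar> < d \<Longrightarrow> \<bar>x - y\<bar> < d \<Longrightarrow> \<bar>g x - g y\<bar> < e"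
    using periodic_family_uniform[of "\<lambda>_. g" e 0] assms(2,3) by metis
  then show ?thesis using that by (metis abs_zero diff_self)
qed

text \<open>The difference of the two integrals is the oriented integral from \<open>a\<close> to \<open>x\<close>: for each
  \<open>x\<close> one of the intervals is empty or a point.\<close>

lemma continuous_antiderivative:
  fixes f :: "real \<Rightarrow> real"
  assumes cont: "continuous_on UNIV f"
  shows "((\<lambda>x. integral {a..x} f - integral {x..a} f) has_real_derivative f x) (at x)"
proof -
  define b where "b = min a x - 1"
  have eq: "integral {a..y} f - integral {y..a} f = integral {b..y} f - integral {b..a} f"
    if "b < y" for y
  proof -
    have i: "f integrable_on {u..v}" for u v
      using cont continuous_on_subset integrable_continuous_real by blast
    have ba: "b < a" by (simp add: b_def)
    show ?thesis
    proof (cases "a \<le> y")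
      case True
      then have "integral {b..a} f + integral {a..y} f = integral {b..y} f"
        using ba by (intro Henstock_Kurzweil_Integration.integral_combine i) auto
      moreover have "integral {y..a} f = 0"
        using True by (cases "y = a") auto
      ultimately show ?thesis by simp
    next
      case False
      then have "integral {b..y} f + integral {y..a} f = integral {b..a} f"
        using that by (intro Henstock_Kurzweil_Integration.integral_combine i) auto
      then show ?thesis using False by simp
    qed
  qed
  have "((\<lambda>y. integral {b..y} f) has_real_derivative f x) (at x within {b..x + 1})"
    by (rule integral_has_real_derivative) (use cont continuous_on_subset in blast, simp add: b_def)
  then have "((\<lambda>y. integral {b..y} f) has_real_derivative f x) (at x)"
    by (simp add: at_within_Icc_at b_def)
  then have "((\<lambda>y. integral {b..y} f - integral {b..a} f) has_real_derivative f x) (at x)"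
    by (auto intro!: derivative_eq_intros)
  then show ?thesis
    by (rule has_field_derivative_transform_within_open[where S = "{b<..}"])
      (auto simp: eq b_def)
qed

section \<open>Monotone families of invariant leaves: rotation numbers\<close>

text \<open>The leaves are the graphs of the functions \<open>\<eta> c\<close>, with primitives \<open>U c\<close>, and \<open>G c\<close> is the
  projected dynamics of the leaf of parameter \<open>c\<close>, all lifted to the line. What is retained of the
  symplectic structure are the two action inequalities. For leaves \<open>c < d\<close> put \<open>V = U d - U c\<close>, an
  increasing function because its derivative is the gap between the leaves; then one step of the lower
  dynamics increases \<open>V\<close> by at most, and one step of the upper dynamics by at least, the same constant.\<close>

locale monotone_leaves =
  fixes U \<eta> G :: "real \<Rightarrow> real \<Rightarrow> real" and \<alpha> :: "real \<Rightarrow> real"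
  assumes \<eta>_cont: "continuous_on UNIV (\<lambda>(c, x). \<eta> c x)"
    and \<eta>_periodic: "\<And>c x. \<eta> c (x + 1) = \<eta> c x"
    and \<eta>_less: "\<And>c d x. c < d \<Longrightarrow> \<eta> c x < \<eta> d x"
    and U_deriv: "\<And>c x. (U c has_real_derivative \<eta> c x) (at x)"
    and U_0: "\<And>c. U c 0 = 0"
    and U_1: "\<And>c. U c 1 = c"
    and G_cont: "continuous_on UNIV (\<lambda>(c, x). G c x)"
    and G_degree_one: "\<And>c. degree_one (G c)"
    and G_less: "\<And>c d x. c < d \<Longrightarrow> G c x < G d x"
    and action_upper: "\<And>c d x. c < d \<Longrightarrow>
      U d (G c x) - U c (G c x) - (U d x - U c x) \<le> \<alpha> d - \<alpha> c"
    and action_lower: "\<And>c d x. c < d \<Longrightarrow>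
      \<alpha> d - \<alpha> c \<le> U d (G d x) - U c (G d x) - (U d x - U c x)"
begin

definition quot :: "real \<Rightarrow> real \<Rightarrow> real \<Rightarrow> real" where
  "quot c d x = (U d x - U c x) / (d - c)"

definition slope :: "real \<Rightarrow> real \<Rightarrow> real" where
  "slope c d = (\<alpha> d - \<alpha> c) / (d - c)"

lemma U_shift: "U c (x + 1) = U c x + c"
proof -
  have "((\<lambda>x. U c (x + 1) - U c x) has_real_derivative 0) (at x)" for x
    using DERIV_shift[of "U c" "\<eta> c (x + 1)" x 1] U_deriv[of c "x + 1"] U_deriv[of c x]
    by (auto intro!: derivative_eq_intros simp: \<eta>_periodic)
  then have "U c (x + 1) - U c x = U c (0 + 1) - U c 0"
    using DERIV_isconst_all[of "\<lambda>x. U c (x + 1) - U c x"] by blast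
  then show ?thesis by (simp add: U_0 U_1)
qed

lemma U_mono_diff:
  assumes "c < d" "x < y"
  shows "U d x - U c x < U d y - U c y"
  by (rule DERIV_pos_imp_increasing[OF \<open>x < y\<close>])
    (use \<eta>_less[OF \<open>c < d\<close>] in \<open>auto intro!: exI derivative_eq_intros U_deriv\<close>)

lemma quot_0: "quot c d 0 = 0"
  by (simp add: quot_def U_0)

lemma quot_less: "c < d \<Longrightarrow> x < y \<Longrightarrow> quot c d x < quot c d y"
  using U_mono_diff by (simp add: quot_def divide_strict_right_mono)

lemma quot_less_iff: "c < d \<Longrightarrow> quot c d x < quot c d y \<longleftrightarrow> x < y"
  using quot_less by (metis less_asym linorder_neqE)

lemma quot_le: "c < d \<Longrightarrow> x \<le> y \<Longrightarrow> quot c d x \<le> quot c d y"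
  using quot_less[of c d x y] by (cases "x = y") auto

text \<open>Normalized, the area between two leaves is a map of degree one. By the action inequalities it is
  almost a conjugacy of either dynamics to the translation by \<open>slope c d\<close>.\<close>

lemma quot_degree_one: "c < d \<Longrightarrow> degree_one (quot c d)"
  unfolding degree_one_def by (auto intro!: monoI quot_le) (simp add: quot_def U_shift field_simps)

lemma G_mono: "x \<le> y \<Longrightarrow> G c x \<le> G c y"
  using G_degree_one by (auto simp: degree_one_def dest: monoD)

lemma iter_degree_one: "degree_one (G c ^^ n)"
  by (rule degree_one_funpow[OF G_degree_one])

lemma iter_mono: "x \<le> y \<Longrightarrow> (G c ^^ n) x \<le> (G c ^^ n) y"
  using iter_degree_one by (auto simp: degree_one_def dest: monoD)

lemma iter_less:
  assumes "c < d" "0 < n"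
  shows "(G c ^^ n) x < (G d ^^ n) x"
  using assms(2)
proof (induction n rule: nat_induct_non_zero)
  case (Suc n)
  have "G c ((G c ^^ n) x) \<le> G c ((G d ^^ n) x)" using Suc by (intro G_mono) auto
  also have "\<dots> < G d ((G d ^^ n) x)" using G_less assms(1) .
  finally show ?case by simp
qed (use G_less assms in auto)

lemma iter_le: "c \<le> d \<Longrightarrow> (G c ^^ n) x \<le> (G d ^^ n) x"
  using iter_less[of c d n x] by (cases "n = 0"; cases "c = d") auto

lemma iter_cont: "continuous_on UNIV (\<lambda>(c, x). (G c ^^ n) x)"
proof (induction n)
  case (Suc n)
  have "continuous_on UNIV (\<lambda>p. (fst p, (G (fst p) ^^ n) (snd p)))"
    using Suc by (auto intro!: continuous_intros simp: case_prod_unfold)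
  then have "continuous_on UNIV ((\<lambda>(c, x). G c x) \<circ> (\<lambda>p. (fst p, (G (fst p) ^^ n) (snd p))))"
    by (intro continuous_on_compose continuous_on_subset[OF G_cont]) auto
  then show ?case by (simp add: case_prod_unfold o_def)
qed (auto intro!: continuous_intros simp: case_prod_unfold)

lemma iter_tendsto: "((\<lambda>c. (G c ^^ n) x) \<longlongrightarrow> (G c0 ^^ n) x) (at c0)"
proof -
  have "isCont (\<lambda>(c, x). (G c ^^ n) x) (c0, x)"
    using iter_cont continuous_on_eq_continuous_at open_UNIV by blast
  then have "((\<lambda>c. (\<lambda>(c, x). (G c ^^ n) x) (c, x)) \<longlongrightarrow> (\<lambda>(c, x). (G c ^^ n) x) (c0, x)) (at c0)"
    by (rule isCont_tendsto_compose) (auto intro!: tendsto_intros)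
  then show ?thesis by simp
qed

lemma iter_near:
  assumes "0 < e"
  obtains d where "0 < d" "\<And>a. \<bar>a - c\<bar> < d \<Longrightarrow> \<bar>(G a ^^ n) x - (G c ^^ n) x\<bar> < e"
proof -
  have "\<forall>\<^sub>F a in at c. dist ((G a ^^ n) x) ((G c ^^ n) x) < e"
    using iter_tendsto assms by (rule tendstoD)
  then obtain d where d: "0 < d"
    "\<And>a. a \<noteq> c \<Longrightarrow> dist a c < d \<Longrightarrow> dist ((G a ^^ n) x) ((G c ^^ n) x) < e"
    unfolding eventually_at by blast
  show ?thesis
    by (rule that[OF d(1)]) (metis assms cancel_comm_monoid_add_class.diff_cancel d(2) abs_zero dist_real_def)
qed

lemma quot_iter_upper:
  assumes "c < d"
  shows "quot c d ((G c ^^ n) x) \<le> quot c d x + n * slope c d"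
proof (induction n)
  case (Suc n)
  have "quot c d (G c y) - quot c d y \<le> slope c d" for y
    using divide_right_mono[OF action_upper[OF assms, of y], of "d - c"] assms
    by (simp add: quot_def slope_def diff_divide_distrib)
  from this[of "(G c ^^ n) x"] Suc show ?case by (simp add: algebra_simps)
qed simp

lemma quot_iter_lower:
  assumes "c < d"
  shows "quot c d x + n * slope c d \<le> quot c d ((G d ^^ n) x)"
proof (induction n)
  case (Suc n)
  have "slope c d \<le> quot c d (G d y) - quot c d y" for y
    using divide_right_mono[OF action_lower[OF assms, of y], of "d - c"] assms
    by (simp add: quot_def slope_def diff_divide_distrib)
  from this[of "(G d ^^ n) x"] Suc show ?case by (simp add: algebra_simps)
qed simp

text \<open>A map of degree one moves distances by at most one, whatever the number of iterates. So slopes of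
  \<open>\<alpha>\<close> control mean displacements along orbits, and the other way round.\<close>

lemma slope_iter_bounds:
  assumes "c < d"
  shows "(G c ^^ n) x - x - 1 \<le> n * slope c d" "n * slope c d \<le> (G d ^^ n) x - x + 1"
  using quot_iter_upper[OF assms, of n x] quot_iter_lower[OF assms, of x n]
    degree_one_bound[OF quot_degree_one[OF assms], of "(G c ^^ n) x" x]
    degree_one_bound[OF quot_degree_one[OF assms], of "(G d ^^ n) x" x]
  by linarith+

definition rho :: "real \<Rightarrow> real" where
  "rho c = lim (\<lambda>n. (G c ^^ n) 0 / n)"

text \<open>Letting both leaves tend to \<open>c\<close> with \<open>n\<close> fixed turns the two one-sided bounds into a two-sided
  one, since the \<open>n\<close>-th iterates depend continuously on the leaf. Comparing two values of \<open>n\<close>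
  then shows that mean displacements form a Cauchy sequence: the rotation number comes out as the
  derivative of \<open>\<alpha>\<close>.\<close>

lemma slope_near_iter:
  assumes "0 < n"
  obtains d where "0 < d" "\<And>a b. a < b \<Longrightarrow> \<bar>a - c\<bar> < d \<Longrightarrow> \<bar>b - c\<bar> < d \<Longrightarrow>
    \<bar>slope a b - (G c ^^ n) 0 / n\<bar> \<le> 2 / n"
proof -
  obtain d where d: "0 < d" "\<And>a. \<bar>a - c\<bar> < d \<Longrightarrow> \<bar>(G a ^^ n) 0 - (G c ^^ n) 0\<bar> < 1"
    using iter_near[of 1 c n 0] by (metis zero_less_one)
  show ?thesis
  proof (rule that[OF d(1)])
    fix a b assume ab: "a < b" "\<bar>a - c\<bar> < d" "\<bar>b - c\<bar> < d"
    have "\<bar>n * slope a b - (G c ^^ n) 0\<bar> \<le> 2"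
      using slope_iter_bounds[OF ab(1), where n = n and x = 0] d(2)[OF ab(2)] d(2)[OF ab(3)] by linarith
    then have "\<bar>n * slope a b - (G c ^^ n) 0\<bar> / n \<le> 2 / n"
      using assms by (intro divide_right_mono) auto
    also have "\<bar>n * slope a b - (G c ^^ n) 0\<bar> / n = \<bar>(n * slope a b - (G c ^^ n) 0) / n\<bar>"
      by simp
    also have "(n * slope a b - (G c ^^ n) 0) / n = slope a b - (G c ^^ n) 0 / n"
      using assms by (simp add: diff_divide_distrib)
    finally show "\<bar>slope a b - (G c ^^ n) 0 / n\<bar> \<le> 2 / n" .
  qed
qed

lemma iter_quotients_close:
  assumes "0 < n" "0 < m"
  shows "\<bar>(G c ^^ n) 0 / n - (G c ^^ m) 0 / m\<bar> \<le> 2 / n + 2 / m"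
proof -
  obtain d where d: "0 < d" "\<And>a b. a < b \<Longrightarrow> \<bar>a - c\<bar> < d \<Longrightarrow> \<bar>b - c\<bar> < d \<Longrightarrow>
    \<bar>slope a b - (G c ^^ n) 0 / n\<bar> \<le> 2 / n" using slope_near_iter[OF assms(1)] by metis
  obtain d' where d': "0 < d'" "\<And>a b. a < b \<Longrightarrow> \<bar>a - c\<bar> < d' \<Longrightarrow> \<bar>b - c\<bar> < d' \<Longrightarrow>
    \<bar>slope a b - (G c ^^ m) 0 / m\<bar> \<le> 2 / m" using slope_near_iter[OF assms(2)] by metis
  define b where "b = c + min d d' / 2"
  have b: "c < b" "\<bar>b - c\<bar> < d" "\<bar>b - c\<bar> < d'" using d(1) d'(1) by (auto simp: b_def min_def)
  show ?thesis
    using d(2)[OF b(1) _ b(2)] d'(2)[OF b(1) _ b(3)] d(1) d'(1) by simp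
qed

lemma rho_limit: "(\<lambda>n. (G c ^^ n) 0 / n) \<longlonglongrightarrow> rho c"
proof -
  have "Cauchy (\<lambda>n. (G c ^^ n) 0 / n)"
  proof (rule metric_CauchyI)
    fix e :: real assume "0 < e"
    obtain M :: nat where M: "4 / e < M" using reals_Archimedean2 by blast
    then have M0: "0 < M" using \<open>0 < e\<close> by (metis divide_pos_pos of_nat_0_less_iff order_less_trans zero_less_numeral)
    show "\<exists>M. \<forall>m\<ge>M. \<forall>n\<ge>M. dist ((G c ^^ m) 0 / m) ((G c ^^ n) 0 / n) < e"
    proof (intro exI allI impI)
      fix m n assume mn: "M \<le> m" "M \<le> n"
      have "2 / real m \<le> 2 / M" "2 / real n \<le> 2 / M" using mn M0 by (auto intro!: divide_left_mono)
      moreover have "2 / M + 2 / M < e" using M M0 \<open>0 < e\<close> by (simp add: field_simps)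
      ultimately show "dist ((G c ^^ m) 0 / m) ((G c ^^ n) 0 / n) < e"
        using iter_quotients_close[of m n c] mn M0 by (simp add: dist_real_def)
    qed
  qed
  then show ?thesis
    unfolding rho_def using Cauchy_convergent convergent_LIMSEQ_iff by blast
qed

lemma iter_quotient_rho:
  assumes "0 < n" shows "\<bar>(G c ^^ n) 0 / n - rho c\<bar> \<le> 2 / n"
proof (rule tendsto_le)
  show "(\<lambda>m. \<bar>(G c ^^ n) 0 / n - (G c ^^ m) 0 / m\<bar>) \<longlonglongrightarrow> \<bar>(G c ^^ n) 0 / n - rho c\<bar>"
    by (intro tendsto_intros rho_limit)
  have "(\<lambda>m. 2 / n + 2 / real m) \<longlonglongrightarrow> 2 / n + 0"
    by (intro tendsto_intros tendsto_divide_0[OF tendsto_const] filterlim_at_top_imp_at_infinity filterlim_real_sequentially)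
  then show "(\<lambda>m. 2 / n + 2 / real m) \<longlonglongrightarrow> 2 / n" by simp
  show "\<forall>\<^sub>F m in sequentially. \<bar>(G c ^^ n) 0 / n - (G c ^^ m) 0 / m\<bar> \<le> 2 / n + 2 / real m"
    using eventually_gt_at_top[of 0] by eventually_elim (use iter_quotients_close assms in auto)
qed auto

lemma iter_rho: "\<bar>(G c ^^ n) x - x - n * rho c\<bar> \<le> 3"
proof (cases "n = 0")
  case False
  have "\<bar>(G c ^^ n) 0 / n - rho c\<bar> * n \<le> 2 / n * n"
    using iter_quotient_rho[of n c] False by (intro mult_right_mono) auto
  then have "\<bar>((G c ^^ n) 0 / n - rho c) * n\<bar> \<le> 2" using False by (simp add: abs_mult)
  then have "\<bar>(G c ^^ n) 0 - n * rho c\<bar> \<le> 2" using False by (simp add: algebra_simps)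
  then show ?thesis using degree_one_bound[OF iter_degree_one, of n c x 0] by linarith
qed simp

lemma slope_near_rho:
  assumes "0 < e"
  obtains d where "0 < d" "\<And>a b. a < b \<Longrightarrow> \<bar>a - c\<bar> < d \<Longrightarrow> \<bar>b - c\<bar> < d \<Longrightarrow> \<bar>slope a b - rho c\<bar> < e"
proof -
  obtain n :: nat where n: "4 / e < n" using reals_Archimedean2 by blast
  then have n0: "0 < n" using assms by (metis divide_pos_pos of_nat_0_less_iff order_less_trans zero_less_numeral)
  obtain d where d: "0 < d" "\<And>a b. a < b \<Longrightarrow> \<bar>a - c\<bar> < d \<Longrightarrow> \<bar>b - c\<bar> < d \<Longrightarrow>
    \<bar>slope a b - (G c ^^ n) 0 / n\<bar> \<le> 2 / n" using slope_near_iter[OF n0] by metis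
  have "2 / n + 2 / n < e" using n n0 assms by (simp add: field_simps)
  moreover have "\<bar>slope a b - rho c\<bar> \<le> \<bar>slope a b - (G c ^^ n) 0 / n\<bar> + \<bar>(G c ^^ n) 0 / n - rho c\<bar>" for a b
    by linarith
  ultimately show ?thesis
    using that[OF d(1)] d(2) iter_quotient_rho[OF n0, of c] by (meson add_mono le_less_trans order_trans)
qed

lemma rho_le_slope:
  assumes "c < d" shows "rho c \<le> slope c d" "slope c d \<le> rho d"
proof -
  have "real n * rho c \<le> n * slope c d + 4" "real n * slope c d \<le> n * rho d + 4" for n
    using slope_iter_bounds[OF assms, of n 0] iter_rho[of n c 0] iter_rho[of n d 0] by linarith+
  then show "rho c \<le> slope c d" "slope c d \<le> rho d"
    using le_of_linear_bound by blast+
qed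

lemma rho_mono: "c \<le> d \<Longrightarrow> rho c \<le> rho d"
  using rho_le_slope[of c d] by (cases "c = d") auto

end

context monotone_leaves
begin

lemma iter_displacement_periodic:
  "(G c ^^ q) (x + 1) - (x + 1) = (G c ^^ q) x - x"
  using iter_degree_one[where c = c and n = q] by (simp add: degree_one_def)

lemma iter_displacement_cont: "continuous_on UNIV (\<lambda>x. (G c ^^ q) x - x)"
proof -
  have "continuous_on UNIV ((\<lambda>(c, x). (G c ^^ q) x) \<circ> (\<lambda>x. (c, x)))"
    by (intro continuous_on_compose continuous_on_subset[OF iter_cont] continuous_intros) auto
  then show ?thesis by (intro continuous_intros) (simp add: o_def)
qed

lemma le_rho_of_displacement:
  assumes "\<And>x. x + a \<le> (G c ^^ q) x"
  shows "a \<le> q * rho c"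
proof -
  have "n * a \<le> (G c ^^ (q * n)) 0" for n
  proof (induction n)
    case (Suc n)
    then show ?case using assms[of "(G c ^^ (q * n)) 0"] by (simp add: funpow_add algebra_simps)
  qed simp
  moreover have "\<bar>(G c ^^ (q * n)) 0 - real n * (q * rho c)\<bar> \<le> 3" for n
    using iter_rho[of "q * n" c 0] by (simp add: mult_ac)
  ultimately have "real n * a \<le> n * (q * rho c) + 3" for n by (smt (verit))
  then show ?thesis by (rule le_of_linear_bound)
qed

lemma rho_le_of_displacement:
  assumes "\<And>x. (G c ^^ q) x \<le> x + a"
  shows "q * rho c \<le> a"
proof -
  have "(G c ^^ (q * n)) 0 \<le> n * a" for n
  proof (induction n)
    case (Suc n)
    then show ?case using assms[of "(G c ^^ (q * n)) 0"] by (simp add: funpow_add algebra_simps)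
  qed simp
  moreover have "\<bar>(G c ^^ (q * n)) 0 - real n * (q * rho c)\<bar> \<le> 3" for n
    using iter_rho[of "q * n" c 0] by (simp add: mult_ac)
  ultimately have "real n * (q * rho c) \<le> n * a + 3" for n by (smt (verit))
  then show ?thesis by (rule le_of_linear_bound)
qed

text \<open>If an iterate never moves a point by exactly \<open>a\<close>, then by connectedness it moves all points by
  more or all points by less, and with a uniform margin because the displacement is periodic.\<close>

lemma displacement_gap:
  assumes "\<And>x. (G c ^^ q) x - x \<noteq> a"
  obtains g where "0 < g" "(\<forall>x. x + (a + g) \<le> (G c ^^ q) x) \<or> (\<forall>x. (G c ^^ q) x \<le> x + (a - g))"
proof -
  define f where "f x = (G c ^^ q) x - x - a" for x
  have cont: "continuous_on UNIV f" unfolding f_def by (intro continuous_intros iter_displacement_cont)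
  have per: "f (x + 1) = f x" for x unfolding f_def by (simp only: iter_displacement_periodic)
  have ne: "f x \<noteq> 0" for x using assms[of x] by (simp add: f_def)
  obtain g where g: "0 < g" "\<And>x. g \<le> \<bar>f x\<bar>"
    using periodic_continuous_pos_min[of "\<lambda>x. \<bar>f x\<bar>"] cont per ne
    by (metis continuous_on_rabs zero_less_abs_iff)
  have "(\<forall>x. 0 < f x) \<or> (\<forall>x. f x < 0)"
  proof (rule ccontr)
    assume "\<not> ?thesis"
    then obtain x y where "f x \<le> 0" "0 \<le> f y" by (meson not_less)
    moreover have "connected (range f)" by (intro connected_continuous_image cont connected_UNIV)
    ultimately have "0 \<in> range f" using connectedD_interval by blast
    then show False using ne by (metis rangeE)
  qed
  then have "(\<forall>x. g \<le> f x) \<or> (\<forall>x. f x \<le> - g)" using g(2) by (smt (verit))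
  then have "(\<forall>x. x + (a + g) \<le> (G c ^^ q) x) \<or> (\<forall>x. (G c ^^ q) x \<le> x + (a - g))"
    unfolding f_def by (smt (verit))
  then show ?thesis using that g(1) by blast
qed

lemma rho_eq:
  assumes "0 < q" "(G c ^^ q) x = x + of_int p"
  shows "q * rho c = of_int p"
proof -
  have it: "(G c ^^ (q * n)) x = x + n * of_int p" for n
  proof (induction n)
    case (Suc n)
    have "(G c ^^ q) (x + of_int (int n * p)) = (G c ^^ q) x + of_int (int n * p)"
      by (rule degree_one_shift_int[OF iter_degree_one])
    then show ?case using Suc assms(2) by (simp add: funpow_add algebra_simps)
  qed simp
  have *: "\<bar>real n * of_int p - real n * (q * rho c)\<bar> \<le> 3" for n
    using iter_rho[of "q * n" c x] it[of n] by (simp add: mult_ac)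
  have "of_int p \<le> q * rho c"
    by (rule le_of_linear_bound[where C = 3]) (use * in \<open>smt (verit)\<close>)
  moreover have "q * rho c \<le> of_int p"
    by (rule le_of_linear_bound[where C = 3]) (use * in \<open>smt (verit)\<close>)
  ultimately show ?thesis by simp
qed

lemma iter_gt_of_rho:
  assumes "0 < q" "of_int p < q * rho c"
  shows "x + of_int p < (G c ^^ q) x"
proof -
  have "(G c ^^ q) y - y \<noteq> of_int p" for y using rho_eq[OF assms(1), of c y p] assms(2) by force
  then obtain g where "0 < g"
    "(\<forall>x. x + (of_int p + g) \<le> (G c ^^ q) x) \<or> (\<forall>x. (G c ^^ q) x \<le> x + (of_int p - g))"
    by (rule displacement_gap)
  then show ?thesis using rho_le_of_displacement[of q c "of_int p - g"] assms(2) by (smt (verit))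
qed

lemma iter_lt_of_rho:
  assumes "0 < q" "q * rho c < of_int p"
  shows "(G c ^^ q) x < x + of_int p"
proof -
  have "(G c ^^ q) y - y \<noteq> of_int p" for y using rho_eq[OF assms(1), of c y p] assms(2) by force
  then obtain g where "0 < g"
    "(\<forall>x. x + (of_int p + g) \<le> (G c ^^ q) x) \<or> (\<forall>x. (G c ^^ q) x \<le> x + (of_int p - g))"
    by (rule displacement_gap)
  then show ?thesis using le_rho_of_displacement[of "of_int p + g" q c] assms(2) by (smt (verit))
qed

text \<open>On a plateau of the rotation number at a rational value the action inequalities would be
  equalities in between, so that all leaves inside it would consist of periodic points of the same
  type; but the dynamics on them is strictly increasing in the parameter.\<close>

lemma rho_no_rational_plateau:
  assumes "0 < (q :: nat)" "q * rho c = of_int p" "q * rho d = of_int p" "c < d"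
  shows False
proof -
  have mid: "(G e ^^ q) 0 = of_int p" if e: "c < e" "e < d" for e
  proof -
    have re: "rho c = rho e" "rho e = rho d"
    proof -
      have "rho c = rho d"
        using assms(1-3) by (metis mult_cancel_left of_nat_0_less_iff less_irrefl)
      then show "rho c = rho e" "rho e = rho d" using rho_mono[of c e] rho_mono[of e d] e by auto
    qed
    have s: "q * slope c e = of_int p" "q * slope e d = of_int p"
      using rho_le_slope[of c e] rho_le_slope[of e d] e re assms by (metis antisym)+
    have "quot c e (0 + of_int p) \<le> quot c e ((G e ^^ q) 0)"
      using quot_iter_lower[OF e(1), of 0 q] s(1) degree_one_shift_int[OF quot_degree_one[OF e(1)], of 0 p]
      by simp
    moreover have "quot e d ((G e ^^ q) 0) \<le> quot e d (0 + of_int p)"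
      using quot_iter_upper[OF e(2), of q 0] s(2) degree_one_shift_int[OF quot_degree_one[OF e(2)], of 0 p]
      by simp
    ultimately show ?thesis
      using quot_less_iff[OF e(1), of "(G e ^^ q) 0" "of_int p"]
        quot_less_iff[OF e(2), of "of_int p" "(G e ^^ q) 0"] by auto
  qed
  obtain e1 e2 where e: "c < e1" "e1 < e2" "e2 < d" using assms(4) dense by metis
  then show False
    using mid[of e1] mid[of e2] iter_less[OF e(2) assms(1), of 0] by simp
qed

lemma rho_strict_at_rational:
  assumes "0 < (q :: nat)" "q * rho c = of_int p"
  shows "c < d \<Longrightarrow> of_int p < q * rho d" and "d < c \<Longrightarrow> q * rho d < of_int p"
proof -
  show "of_int p < q * rho d" if "c < d"
  proof -
    have "q * rho d \<noteq> of_int p"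
      using rho_no_rational_plateau[OF assms(1,2) _ that] by blast
    moreover have "q * rho c \<le> q * rho d" using rho_mono[of c d] that by (simp add: mult_left_mono)
    ultimately show ?thesis using assms by simp
  qed
  show "q * rho d < of_int p" if "d < c"
  proof -
    have "q * rho d \<noteq> of_int p"
      using rho_no_rational_plateau[OF assms(1) _ assms(2) that] by blast
    moreover have "q * rho d \<le> q * rho c" using rho_mono[of d c] that by (simp add: mult_left_mono)
    ultimately show ?thesis using assms by simp
  qed
qed

text \<open>Leaves on the two sides have rotation numbers strictly on the two sides of \<open>p / q\<close>, so that their
  \<open>q\<close>-th iterates move all points by more, respectively by less, than \<open>p\<close>. On the leaf in between
  both bounds hold in the limit.\<close>

lemma rational_leaf_periodic:
  assumes "0 < (q :: nat)" "q * rho c = of_int p"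
  shows "(G c ^^ q) x = x + of_int p"
proof (rule antisym)
  show "x + of_int p \<le> (G c ^^ q) x"
  proof (rule tendsto_lowerbound)
    show "((\<lambda>d. (G d ^^ q) x) \<longlongrightarrow> (G c ^^ q) x) (at_right c)"
      using iter_tendsto filterlim_at_split by blast
    show "\<forall>\<^sub>F d in at_right c. x + of_int p \<le> (G d ^^ q) x"
      using eventually_at_right_less[of c] rho_strict_at_rational(1)[OF assms]
      by (auto elim!: eventually_mono intro!: less_imp_le iter_gt_of_rho[OF assms(1)])
  qed simp
  show "(G c ^^ q) x \<le> x + of_int p"
  proof (rule tendsto_upperbound)
    show "((\<lambda>d. (G d ^^ q) x) \<longlongrightarrow> (G c ^^ q) x) (at_left c)"
      using iter_tendsto filterlim_at_split by blast
    show "\<forall>\<^sub>F d in at_left c. (G d ^^ q) x \<le> x + of_int p"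
      using eventually_at_left_real[of "c - 1" c] rho_strict_at_rational(2)[OF assms]
      by (auto elim!: eventually_mono intro!: less_imp_le iter_lt_of_rho[OF assms(1)])
  qed simp
qed

lemma irrational_orbit_order:
  assumes "rho c \<notin> \<rat>" "k * rho c + of_int l < n * rho c + of_int m"
  shows "(G c ^^ k) x + of_int l < (G c ^^ n) x + of_int m"
proof (cases "k \<le> n")
  case True
  have *: "(G c ^^ n) x = (G c ^^ (n - k)) ((G c ^^ k) x)"
    using True by (metis comp_apply funpow_add le_add_diff_inverse2)
  show ?thesis
  proof (cases "n = k")
    case False
    then have "(G c ^^ k) x + of_int (l - m) < (G c ^^ (n - k)) ((G c ^^ k) x)"
      using True assms(2) by (intro iter_gt_of_rho) (auto simp: of_nat_diff algebra_simps)
    then show ?thesis using * by simp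
  qed (use assms in auto)
next
  case False
  have *: "(G c ^^ k) x = (G c ^^ (k - n)) ((G c ^^ n) x)"
    using False by (metis comp_apply funpow_add le_add_diff_inverse2 nle_le)
  have "(G c ^^ (k - n)) ((G c ^^ n) x) < (G c ^^ n) x + of_int (m - l)"
    using False assms(2) by (intro iter_lt_of_rho) (auto simp: of_nat_diff algebra_simps)
  then show ?thesis using * by simp
qed

lemma irrational_dense:
  fixes r x :: real
  assumes "r \<notin> \<rat>" "0 < e"
  obtains n :: nat and m :: int where "x < n * r + of_int m" "n * r + of_int m < x + e"
proof -
  obtain h k where hk: "k > 0" "\<bar>of_int k * r - of_int h - (x + e / 2)\<bar> < e / 2"
    using sequence_of_fractional_parts_is_dense[OF assms(1) half_gt_zero[OF assms(2)], of "x + e / 2"] by metis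
  have k: "real (nat k) = of_int k" using hk(1) by simp
  have "x < real (nat k) * r + of_int (- h)" "real (nat k) * r + of_int (- h) < x + e"
    unfolding k using hk(2) by (simp_all only: of_int_minus)
  then show ?thesis by (rule that)
qed

text \<open>Strict differentiability: the two leaves may both move. It yields existence and continuity of the
  derivative at once.\<close>

definition strict_param_deriv :: "real \<Rightarrow> real \<Rightarrow> real \<Rightarrow> bool" where
  "strict_param_deriv c x h \<longleftrightarrow> (\<forall>e>0. \<exists>d>0. \<forall>a b y. a < b \<longrightarrow> \<bar>a - c\<bar> < d \<longrightarrow> \<bar>b - c\<bar> < d \<longrightarrow>
     \<bar>y - x\<bar> < d \<longrightarrow> \<bar>quot a b y - h\<bar> < e)"

lemma strict_param_derivD:
  assumes "strict_param_deriv c x h" "0 < e"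
  obtains d where "0 < d" "\<And>a b y. a < b \<Longrightarrow> \<bar>a - c\<bar> < d \<Longrightarrow> \<bar>b - c\<bar> < d \<Longrightarrow> \<bar>y - x\<bar> < d \<Longrightarrow>
    \<bar>quot a b y - h\<bar> < e"
  using assms unfolding strict_param_deriv_def by blast

lemma quot_sym: "quot c d x = quot d c x"
  using minus_divide_divide[of "U d x - U c x" "d - c"] by (simp add: quot_def)

lemma slope_sym: "slope c d = slope d c"
  using minus_divide_divide[of "\<alpha> d - \<alpha> c" "d - c"] by (simp add: slope_def)

lemma strict_param_deriv_imp_deriv:
  assumes "strict_param_deriv c x h"
  shows "((\<lambda>c. U c x) has_real_derivative h) (at c)"
proof -
  have "((\<lambda>d. quot c d x) \<longlongrightarrow> h) (at c)"
  proof (rule tendstoI)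
    fix e :: real assume "0 < e"
    then obtain r where r: "0 < r" "\<And>a b y. a < b \<Longrightarrow> \<bar>a - c\<bar> < r \<Longrightarrow> \<bar>b - c\<bar> < r \<Longrightarrow>
      \<bar>y - x\<bar> < r \<Longrightarrow> \<bar>quot a b y - h\<bar> < e" using strict_param_derivD[OF assms] by metis
    have "dist (quot c d x) h < e" if "d \<noteq> c" "dist d c < r" for d
      using r(2)[of c d x] r(2)[of d c x] that r(1) quot_sym[of d c x]
      by (cases "c < d") (simp_all add: dist_real_def)
    then show "\<forall>\<^sub>F d in at c. dist (quot c d x) h < e"
      unfolding eventually_at using r(1) by blast
  qed
  then show ?thesis by (simp add: has_field_derivative_iff quot_def)
qed

lemma strict_param_deriv_imp_continuous:
  assumes strict: "strict_param_deriv c0 x0 h" and D: "\<And>c x. ((\<lambda>c. U c x) has_real_derivative D c x) (at c)"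
    and e: "0 < e"
  obtains d where "0 < d" "\<And>c x. \<bar>c - c0\<bar> < d \<Longrightarrow> \<bar>x - x0\<bar> < d \<Longrightarrow> \<bar>D c x - D c0 x0\<bar> < e"
proof -
  obtain d where d: "0 < d" "\<And>a b y. a < b \<Longrightarrow> \<bar>a - c0\<bar> < d \<Longrightarrow> \<bar>b - c0\<bar> < d \<Longrightarrow>
    \<bar>y - x0\<bar> < d \<Longrightarrow> \<bar>quot a b y - h\<bar> < e / 2" using strict_param_derivD[OF strict half_gt_zero[OF e]] by metis
  have "\<bar>D c x - h\<bar> \<le> e / 2" if "\<bar>c - c0\<bar> < d" "\<bar>x - x0\<bar> < d" for c x
  proof (rule tendsto_upperbound)
    have "((\<lambda>b. quot c b x) \<longlongrightarrow> D c x) (at c)"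
      using D[of x c] by (simp add: has_field_derivative_iff quot_def)
    then have "((\<lambda>b. quot c b x) \<longlongrightarrow> D c x) (at_right c)" by (simp add: filterlim_at_split)
    then show "((\<lambda>b. \<bar>quot c b x - h\<bar>) \<longlongrightarrow> \<bar>D c x - h\<bar>) (at_right c)" by (intro tendsto_intros)
    have "\<forall>\<^sub>F b in at_right c. b \<in> {c<..<c0 + d}"
      using that by (intro eventually_at_right_real) auto
    then show "\<forall>\<^sub>F b in at_right c. \<bar>quot c b x - h\<bar> \<le> e / 2"
    proof eventually_elim
      case (elim b)
      then have "\<bar>b - c0\<bar> < d" using that by auto
      then show ?case using d(2)[of c b x] elim that by auto
    qed
  qed simp
  moreover have "D c0 x0 = h" using DERIV_unique[OF D strict_param_deriv_imp_deriv[OF strict]] .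
  ultimately have "\<bar>D c x - D c0 x0\<bar> < e" if "\<bar>c - c0\<bar> < d" "\<bar>x - x0\<bar> < d" for c x
    using that e by (metis field_sum_of_halves less_add_same_cancel1 half_gt_zero le_less_trans)
  then show ?thesis using that d(1) by blast
qed

text \<open>At an irrational leaf the orbits are ordered like those of the rotation. The inequalities for
  \<open>quot\<close> sandwich the difference quotient between the positions of these orbits, and a dense set of
  them is available.\<close>

lemma irrational_strict_param_deriv:
  assumes irr: "rho c \<notin> \<rat>"
  obtains h where "strict_param_deriv c x h"
proof -
  \<comment> \<open>positions under the rotation of those points of the lifted orbit of 0 that lie to the left of x\<close>
  define A where "A = {n * rho c + of_int m | n m. (G c ^^ n) 0 + of_int m < x}"
  have "0 * rho c + of_int (\<lfloor>x\<rfloor> - 1) \<in> A"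
    unfolding A_def by (rule CollectI, rule exI[of _ 0], rule exI[of _ "\<lfloor>x\<rfloor> - 1"]) (auto, linarith)
  then have ne: "A \<noteq> {}" by auto
  have up: "v \<le> k * rho c + of_int l" if "v \<in> A" "x \<le> (G c ^^ k) 0 + of_int l" for v k l
  proof (rule ccontr)
    assume n: "\<not> v \<le> k * rho c + of_int l"
    obtain n m where v: "v = n * rho c + of_int m" "(G c ^^ n) 0 + of_int m < x"
      using \<open>v \<in> A\<close> by (auto simp: A_def)
    have "(G c ^^ k) 0 + of_int l < (G c ^^ n) 0 + of_int m"
      using n v by (intro irrational_orbit_order[OF irr]) auto
    then show False using v that by simp
  qed
  have "x \<le> (G c ^^ 0) 0 + of_int \<lceil>x\<rceil>" by simp
  then have bdd: "bdd_above A" using up by (intro bdd_aboveI) blast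
  define h where "h = Sup A"
  show ?thesis
  proof (rule that[of h], unfold strict_param_deriv_def, intro allI impI)
    fix e :: real assume e: "0 < e"
    obtain v where "v \<in> A" "h - e / 2 < v"
      using less_cSup_iff[OF ne bdd, of "h - e / 2"] e by (auto simp: h_def)
    then obtain n m where nm: "h - e / 2 < n * rho c + of_int m" "(G c ^^ n) 0 + of_int m < x"
      by (auto simp: A_def)
    obtain k1 :: nat and l1 :: int where kl1: "h < k1 * rho c + of_int l1" "k1 * rho c + of_int l1 < h + e / 2"
      using irrational_dense[OF irr, of "e / 2" h] e by auto
    have 1: "x \<le> (G c ^^ k1) 0 + of_int l1"
    proof (rule ccontr)
      assume "\<not> ?thesis"
      then have "k1 * rho c + of_int l1 \<in> A" unfolding A_def not_le by blast
      then show False using kl1 cSup_upper[OF _ bdd] by (force simp: h_def)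
    qed 
    \<comment> \<open>a second orbit point, to be strictly to the right of x\<close>
    obtain k :: nat and l :: int where kl: "k1 * rho c + of_int l1 < k * rho c + of_int l" "k * rho c + of_int l < h + e / 2"
      using irrational_dense[OF irr, of "h + e / 2 - (k1 * rho c + of_int l1)" "k1 * rho c + of_int l1"] kl1(2)
      by auto
    have xkl: "x < (G c ^^ k) 0 + of_int l"
      using irrational_orbit_order[OF irr kl(1), of 0] 1 by simp
    \<comment> \<open>half of g is left for the motion of y, the other half for the motion of the two orbit points\<close>
    define g where "g = min (x - ((G c ^^ n) 0 + of_int m)) ((G c ^^ k) 0 + of_int l - x)"
    have g: "0 < g" using nm xkl by (simp add: g_def)
    obtain d1 where d1: "0 < d1" "\<And>a. \<bar>a - c\<bar> < d1 \<Longrightarrow> \<bar>(G a ^^ n) 0 - (G c ^^ n) 0\<bar> < g / 2"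
      using iter_near[of "g / 2" c n 0] g by (metis half_gt_zero)
    obtain d2 where d2: "0 < d2" "\<And>a. \<bar>a - c\<bar> < d2 \<Longrightarrow> \<bar>(G a ^^ k) 0 - (G c ^^ k) 0\<bar> < g / 2"
      using iter_near[of "g / 2" c k 0] g by (metis half_gt_zero)
    obtain d3 where d3: "0 < d3" "\<And>a b. a < b \<Longrightarrow> \<bar>a - c\<bar> < d3 \<Longrightarrow> \<bar>b - c\<bar> < d3 \<Longrightarrow>
        \<bar>slope a b - rho c\<bar> < e / (2 * (n + k + 1))"
    proof -
      have "0 < e / real (2 * (n + k + 1))" using e by simp
      then show ?thesis using that slope_near_rho by blast
    qed
    define d where "d = min (min d1 d2) (min d3 (g / 2))"
    show "\<exists>d>0. \<forall>a b y. a < b \<longrightarrow> \<bar>a - c\<bar> < d \<longrightarrow> \<bar>b - c\<bar> < d \<longrightarrow>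
      \<bar>y - x\<bar> < d \<longrightarrow> \<bar>quot a b y - h\<bar> < e"
    proof (intro exI conjI allI impI)
      show "0 < d" using d1(1) d2(1) d3(1) g by (simp add: d_def)
      fix a b y assume ab: "a < b" "\<bar>a - c\<bar> < d" "\<bar>b - c\<bar> < d" and y: "\<bar>y - x\<bar> < d"
      have s: "\<bar>slope a b - rho c\<bar> * (n + k + 1) < e / 2"
        using d3(2)[OF ab(1)] ab by (simp add: d_def field_simps)
      have sn: "\<bar>n * slope a b - n * rho c\<bar> < e / 2" and sk: "\<bar>k * slope a b - k * rho c\<bar> < e / 2"
      proof -
        have "\<bar>n * slope a b - n * rho c\<bar> = \<bar>slope a b - rho c\<bar> * n"
          by (simp add: abs_mult flip: right_diff_distrib)
        also have "\<dots> \<le> \<bar>slope a b - rho c\<bar> * (n + k + 1)" by (intro mult_left_mono) auto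
        finally show "\<bar>n * slope a b - n * rho c\<bar> < e / 2" using s by linarith
        have "\<bar>k * slope a b - k * rho c\<bar> = \<bar>slope a b - rho c\<bar> * k"
          by (simp add: abs_mult flip: right_diff_distrib)
        also have "\<dots> \<le> \<bar>slope a b - rho c\<bar> * (n + k + 1)" by (intro mult_left_mono) auto
        finally show "\<bar>k * slope a b - k * rho c\<bar> < e / 2" using s by linarith
      qed
      have "(G b ^^ n) 0 + of_int m \<le> y"
      proof -
        have "\<bar>(G b ^^ n) 0 - (G c ^^ n) 0\<bar> < g / 2" "\<bar>y - x\<bar> < g / 2"
          using d1(2)[of b] ab y by (auto simp: d_def)
        moreover have "g \<le> x - ((G c ^^ n) 0 + of_int m)" by (simp add: g_def)
        ultimately show ?thesis by linarith
      qed
      then have "quot a b ((G b ^^ n) 0 + of_int m) \<le> quot a b y" by (rule quot_le[OF ab(1)])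
      then have lo: "n * slope a b + of_int m \<le> quot a b y"
        using quot_iter_lower[OF ab(1), of 0 n] degree_one_shift_int[OF quot_degree_one[OF ab(1)]]
        by (simp add: quot_0)
      have "y \<le> (G a ^^ k) 0 + of_int l"
      proof -
        have "\<bar>(G a ^^ k) 0 - (G c ^^ k) 0\<bar> < g / 2" "\<bar>y - x\<bar> < g / 2"
          using d2(2)[of a] ab y by (auto simp: d_def)
        moreover have "g \<le> (G c ^^ k) 0 + of_int l - x" by (simp add: g_def)
        ultimately show ?thesis by linarith
      qed
      then have "quot a b y \<le> quot a b ((G a ^^ k) 0 + of_int l)" by (rule quot_le[OF ab(1)])
      then have hi: "quot a b y \<le> k * slope a b + of_int l"
        using quot_iter_upper[OF ab(1), of k 0] degree_one_shift_int[OF quot_degree_one[OF ab(1)]]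
        by (simp add: quot_0)
      show "\<bar>quot a b y - h\<bar> < e" using lo hi sn sk nm(1) kl(2) by linarith
    qed
  qed
qed

end

section \<open>The transversal derivative at a leaf of periodic points\<close>

text \<open>Here \<open>J / (\<kappa> x)\<^sup>2\<close> is the shear of the \<open>q\<close>-th iterate along the leaf: a point at small height
  \<open>\<eta> c x - \<eta> c0 x\<close> over the leaf advances by the shear times its height. The shear is written in terms
  of a density \<open>\<kappa>\<close> of integral one over a period, with primitive \<open>\<Phi>\<close>, because \<open>\<kappa>\<close> turns out to be
  the derivative of the height in the parameter, and \<open>\<Phi>\<close> that of \<open>U\<close>. The shear assumption
  covers all multiples \<open>N * q\<close>: it contains the information that shears add up along the leaf, that
  is, that the differential of the \<open>q\<close>-th iterate is unipotent there.\<close>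

locale periodic_leaf = monotone_leaves +
  fixes c0 :: real and q :: nat and p :: int and \<kappa> \<Phi> :: "real \<Rightarrow> real" and J :: real
  assumes q_pos: "0 < q"
    and periodic: "\<And>x. (G c0 ^^ q) x = x + of_int p"
    and \<kappa>_cont: "continuous_on UNIV \<kappa>"
    and \<kappa>_pos: "\<And>x. 0 < \<kappa> x"
    and \<kappa>_periodic: "\<And>x. \<kappa> (x + 1) = \<kappa> x"
    and \<Phi>_deriv: "\<And>x. (\<Phi> has_real_derivative \<kappa> x) (at x)"
    and \<Phi>_0: "\<Phi> 0 = 0" and \<Phi>_1: "\<Phi> 1 = 1"
    and J_pos: "0 < J"
    and shear: "\<And>N e. 0 < e \<Longrightarrow> \<forall>\<^sub>F c in at c0. \<forall>x.
      \<bar>(G c ^^ (N * q)) x - x - of_int (N * p) - N * (J / (\<kappa> x)\<^sup>2) * (\<eta> c x - \<eta> c0 x)\<bar>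
        \<le> e * \<bar>\<eta> c x - \<eta> c0 x\<bar>"
begin

definition \<tau> :: "real \<Rightarrow> real" where "\<tau> x = J / (\<kappa> x)\<^sup>2"

definition \<delta> :: "real \<Rightarrow> real \<Rightarrow> real" where "\<delta> c x = \<eta> c x - \<eta> c0 x"

text \<open>A power of the return map, which is the identity on the leaf \<open>c0\<close>.\<close>

definition Q :: "nat \<Rightarrow> real \<Rightarrow> real \<Rightarrow> real" where
  "Q N c x = (G c ^^ (N * q)) x - of_int (N * p)"

text \<open>The area of a fundamental domain of the \<open>q\<close>-th iterate in the strip between the leaves
  \<open>c0\<close> and \<open>c\<close>.\<close>

definition A :: "real \<Rightarrow> real" where
  "A c = q * (\<alpha> c - \<alpha> c0) - of_int p * (c - c0)"

lemma Q_mono: "x \<le> y \<Longrightarrow> Q N c x \<le> Q N c y"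
  unfolding Q_def using iter_mono by simp

lemma Q_add: "Q (M + N) c x = Q M c (Q N c x)"
proof -
  have "(G c ^^ (M * q)) ((G c ^^ (N * q)) x - of_int (N * p)) = (G c ^^ (M * q)) ((G c ^^ (N * q)) x) - of_int (N * p)"
    using degree_one_shift_int[OF iter_degree_one, of _ c "(G c ^^ (N * q)) x" "- (int N * p)"] by simp
  then show ?thesis
    unfolding Q_def by (simp add: add_mult_distrib funpow_add distrib_right)
qed

lemma Q_c0: "Q 1 c0 x = x"
  using periodic by (simp add: Q_def)

lemma shear_right:
  assumes "0 < e"
  shows "\<forall>\<^sub>F c in at_right c0. \<forall>x. \<bar>Q N c x - x - N * \<tau> x * \<delta> c x\<bar> \<le> e * \<delta> c x"
proof -
  have "\<forall>\<^sub>F c in at_right c0. \<forall>x.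
      \<bar>(G c ^^ (N * q)) x - x - of_int (N * p) - N * (J / (\<kappa> x)\<^sup>2) * (\<eta> c x - \<eta> c0 x)\<bar>
        \<le> e * \<bar>\<eta> c x - \<eta> c0 x\<bar>"
    using shear[OF assms, of N] by (simp add: eventually_at_split)
  then show ?thesis using eventually_at_right_less[of c0]
  proof eventually_elim
    case (elim c)
    have abs: "\<bar>\<eta> c x - \<eta> c0 x\<bar> = \<delta> c x" for x
      using \<eta>_less[OF elim(2), of x] by (simp add: \<delta>_def)
    have "Q N c x - x - N * \<tau> x * \<delta> c x
      = (G c ^^ (N * q)) x - x - of_int (N * p) - N * (J / (\<kappa> x)\<^sup>2) * (\<eta> c x - \<eta> c0 x)" for x
      by (simp add: Q_def \<tau>_def \<delta>_def)
    then show ?case using elim(1) abs by metis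
  qed
qed

lemma \<delta>_pos: "c0 < c \<Longrightarrow> 0 < \<delta> c x"
  using \<eta>_less by (simp add: \<delta>_def)

lemma \<delta>_c0: "\<delta> c0 x = 0" by (simp add: \<delta>_def)

lemma \<delta>_less: "c < d \<Longrightarrow> \<delta> c x < \<delta> d x"
  using \<eta>_less by (simp add: \<delta>_def)

lemma \<delta>_small:
  assumes "0 < e"
  shows "\<forall>\<^sub>F c in at_right c0. \<forall>x. \<delta> c x < e"
proof -
  obtain d where d: "0 < d"
    "\<And>c x y. \<bar>c - c0\<bar> < d \<Longrightarrow> \<bar>x - y\<bar> < d \<Longrightarrow> \<bar>\<eta> c x - \<eta> c0 y\<bar> < e"
    using periodic_family_uniform[OF \<eta>_cont \<eta>_periodic assms, of c0] by metis
  have "\<forall>\<^sub>F c in at_right c0. c \<in> {c0<..<c0 + d}"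
    using d(1) by (intro eventually_at_right_real) auto
  then show ?thesis
  proof eventually_elim
    case (elim c)
    then show ?case using d(2)[of c] d(1) by (force simp: \<delta>_def abs_less_iff)
  qed
qed

lemma \<tau>_cont: "continuous_on UNIV \<tau>"
  unfolding \<tau>_def using \<kappa>_pos by (intro continuous_intros \<kappa>_cont) (auto simp: less_imp_neq[symmetric])

lemma \<tau>_pos: "0 < \<tau> x"
  using \<kappa>_pos[of x] J_pos by (simp add: \<tau>_def)

lemma \<tau>_periodic: "\<tau> (x + 1) = \<tau> x"
  by (simp add: \<tau>_def \<kappa>_periodic)

lemma \<tau>_bounds:
  obtains t0 t1 where "0 < t0" "t0 \<le> t1" "\<And>x. t0 \<le> \<tau> x" "\<And>x. \<tau> x \<le> t1"
proof -
  obtain t0 where t0: "0 < t0" "\<And>x. t0 \<le> \<tau> x"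
    using periodic_continuous_pos_min[OF \<tau>_cont \<tau>_periodic \<tau>_pos] by blast
  obtain t1 where "\<And>x. \<bar>\<tau> x\<bar> \<le> t1"
    using periodic_continuous_bound[OF \<tau>_cont \<tau>_periodic] by blast
  then have t1: "\<tau> x \<le> t1" for x by (meson abs_le_D1)
  show ?thesis using that[OF t0(1) _ t0(2) t1] t0(2)[of 0] t1[of 0] by simp
qed

text \<open>At the scale of its own height over the periodic leaf, a neighbouring leaf is flat. Orbits on it do
  not overtake each other: two points at a distance of order \<open>\<delta> c x\<close> stay in order, and within a few
  iterates of each other, for any number \<open>N\<close> of returns, during which they travel about
  \<open>N * \<tau> * \<delta>\<close>. For large \<open>N\<close> this forces their heights to be nearly equal.\<close>

lemma leaf_flat:
  assumes "0 < K" "0 < e" "e \<le> 1"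
  shows "\<forall>\<^sub>F c in at_right c0. \<forall>x y. x \<le> y \<longrightarrow> y \<le> x + K * \<delta> c x \<longrightarrow> \<bar>\<delta> c y - \<delta> c x\<bar> \<le> e * \<delta> c x"
proof -
  obtain t0 t1 where t: "0 < t0" "t0 \<le> t1" "\<And>x. t0 \<le> \<tau> x" "\<And>x. \<tau> x \<le> t1"
    using \<tau>_bounds by metis
  \<comment> \<open>k returns carry x beyond y; N returns make the relative error of the comparison less than e\<close>
  obtain k :: nat where k: "(K + 1) / t0 < k" using reals_Archimedean2 by blast
  define R where "R = k * t1"
  obtain N :: nat where N: "(12 + 4 * R + 4 * K) / (e * t0) < N" using reals_Archimedean2 by blast
  have kt: "K + 1 < k * t0" using k t by (simp add: field_simps)
  have Nt: "12 + 4 * R + 4 * K < N * (e * t0)" using N t assms by (simp add: field_simps)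
  define e2 where "e2 = e * t0 / 8"
  have e2: "0 < e2" using assms t by (simp add: e2_def)
  obtain d where d: "0 < d" "\<And>x y. \<bar>x - y\<bar> < d \<Longrightarrow> \<bar>\<tau> x - \<tau> y\<bar> < e2"
    using periodic_uniform[OF \<tau>_cont \<tau>_periodic e2] by metis
  have "0 < d / K" using d assms by simp
  from shear_right[of 1 N, OF zero_less_one] shear_right[of 1 "N + k", OF zero_less_one]
    shear_right[of 1 k, OF zero_less_one] \<delta>_small[OF this] eventually_at_right_less[of c0]
  show ?thesis
  proof eventually_elim
    case (elim c)
    show ?case
    proof (intro allI impI)
      fix x y assume xy: "x \<le> y" "y \<le> x + K * \<delta> c x"
      define u v T where "u = \<delta> c x" and "v = \<delta> c y" and "T = \<tau> x"
      have pos: "0 < u" "0 < v" using \<delta>_pos elim(5) by (auto simp: u_def v_def)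
      have "K * u < d" using elim(4) assms by (auto simp: u_def field_simps)
      then have ty: "\<bar>\<tau> y - T\<bar> < e2" using xy by (auto simp: T_def u_def intro!: d(2))
      have T: "t0 \<le> T" "T \<le> t1" using t by (auto simp: T_def)
      have Nx: "\<bar>Q N c x - x - N * T * u\<bar> \<le> u" "\<bar>Q N c y - y - N * \<tau> y * v\<bar> \<le> v"
        "\<bar>Q (N + k) c x - x - (N + k) * T * u\<bar> \<le> u" "\<bar>Q k c x - x - k * T * u\<bar> \<le> u"
        using elim(1)[rule_format, of x] elim(1)[rule_format, of y] elim(2)[rule_format, of x] elim(3)[rule_format, of x]
        by (simp_all add: u_def v_def T_def)
      have N0: "0 \<le> real N" by simp
      have eT: "e * t0 \<le> T" using mult_right_mono[OF assms(3), of t0] T t(1) by linarith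
      have Neb: "N * e2 = N * (e * t0) / 8" by (simp add: e2_def)
      have NeT: "N * (e * t0) \<le> N * (e * T)" using T assms by (intro mult_left_mono) auto
      have Nty: "N * \<tau> y \<le> N * T + N * e2" "N * T - N * e2 \<le> N * \<tau> y"
        using ty mult_left_mono[OF _ N0, of "\<tau> y" "T + e2"] mult_left_mono[OF _ N0, of "T - e2" "\<tau> y"]
        by (auto simp: algebra_simps)
      have kT: "k * T \<le> R" "0 \<le> k * T" using T t by (auto simp: R_def intro!: mult_left_mono)
      have K0: "0 \<le> N * (e * t0)" using assms t by simp
      \<comment> \<open>y starts ahead of x and stays ahead\<close>
      have "Q N c x \<le> Q N c y" using xy by (intro Q_mono)
      then have "N * T * u - u - K * u \<le> N * \<tau> y * v + v" using Nx xy by (simp add: u_def)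
      then have 1: "(N * T - 1 - K) * u \<le> (N * \<tau> y + 1) * v" by (simp add: algebra_simps)
      have lo: "(1 - e) * u \<le> v"
      proof (rule ccontr)
        assume n: "\<not> ?thesis"
        have p: "0 < N * \<tau> y + 1" using mult_nonneg_nonneg[OF N0 less_imp_le[OF \<tau>_pos[of y]]] by linarith
        have "(N * \<tau> y + 1) * v < (N * \<tau> y + 1) * ((1 - e) * u)"
          using n p by (intro mult_strict_left_mono) auto
        then have "(N * T - 1 - K) * u < ((N * \<tau> y + 1) * (1 - e)) * u" using 1 by (simp add: mult_ac)
        then have "N * T - 1 - K < (N * \<tau> y + 1) * (1 - e)" using pos mult_less_cancel_right_pos by blast
        also have "\<dots> \<le> (N * T + N * e2 + 1) * (1 - e)" using Nty assms by (intro mult_right_mono) auto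
        also have "\<dots> \<le> N * T + N * e2 + 1 - N * (e * T)"
        proof -
          have "0 \<le> (N * e2 + 1) * e" using e2 assms by simp
          then show ?thesis by (simp add: algebra_simps)
        qed
        finally have "N * (e * T) < N * e2 + 2 + K" by simp
        then show False using NeT Neb Nt kT assms(1) by linarith
      qed
      \<comment> \<open>y starts behind the k-th return of x and stays behind\<close>
      have "y \<le> Q k c x"
      proof -
        have "k * t0 \<le> k * T" using T by (intro mult_left_mono) auto
        then have "(K + 1) * u \<le> k * T * u" using kt pos by (intro mult_right_mono) auto
        then show ?thesis using Nx(4) xy by (simp add: u_def[symmetric] algebra_simps)
      qed
      then have "Q N c y \<le> Q (N + k) c x" unfolding Q_add by (rule Q_mono)
      then have "N * \<tau> y * v - v \<le> (N + k) * T * u + u" using Nx xy by simp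
      then have 2: "(N * \<tau> y - 1) * v \<le> ((N + k) * T + 1) * u" by (simp add: algebra_simps)
      have hi: "v \<le> (1 + e) * u"
      proof (rule ccontr)
        assume n: "\<not> ?thesis"
        have NT8: "N * e2 \<le> N * T / 8"
        proof -
          have "N * (e * t0) \<le> N * T" using eT by (intro mult_left_mono) auto
          then show ?thesis using Neb by linarith
        qed
        have NT: "12 < N * T"
        proof -
          have "N * (e * t0) \<le> N * T" using eT by (intro mult_left_mono) auto
          then show ?thesis using Nt kT assms by linarith
        qed
        have p: "0 < N * \<tau> y - 1" using Nty(2) NT8 NT by linarith
        have "(N * \<tau> y - 1) * ((1 + e) * u) < (N * \<tau> y - 1) * v"
          using n p by (intro mult_strict_left_mono) auto
        then have "((N * \<tau> y - 1) * (1 + e)) * u < ((N + k) * T + 1) * u" using 2 by (simp add: mult_ac)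
        then have "(N * \<tau> y - 1) * (1 + e) < (N + k) * T + 1" using pos mult_less_cancel_right_pos by blast
        moreover have "(N * T - N * e2 - 1) * (1 + e) \<le> (N * \<tau> y - 1) * (1 + e)"
          using Nty assms by (intro mult_right_mono) auto
        moreover have "(N * T - N * e2 - 1) * (1 + e) = N * T + N * (e * T) - (N * e2 + 1) * (1 + e)"
          by (simp add: algebra_simps)
        moreover have "(N * e2 + 1) * (1 + e) \<le> (N * e2 + 1) * 2"
          using assms e2 by (intro mult_left_mono) auto
        ultimately have "N * (e * T) < k * T + 2 * N * e2 + 3" by (simp add: algebra_simps)
        then show False using NeT Neb Nt kT assms K0 by linarith
      qed
      show "\<bar>\<delta> c y - \<delta> c x\<bar> \<le> e * \<delta> c x"
        using lo hi by (simp add: u_def v_def algebra_simps abs_le_iff)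
    qed
  qed
qed

end

context monotone_leaves
begin

lemma U_increment_bounds:
  assumes "x \<le> y" "\<And>z. x \<le> z \<Longrightarrow> z \<le> y \<Longrightarrow> m \<le> \<eta> d z - \<eta> c z \<and> \<eta> d z - \<eta> c z \<le> M"
  shows "(y - x) * m \<le> U d y - U c y - (U d x - U c x)"
    and "U d y - U c y - (U d x - U c x) \<le> (y - x) * M"
proof -
  have "(y - x) * m \<le> U d y - U c y - (U d x - U c x) \<and> U d y - U c y - (U d x - U c x) \<le> (y - x) * M"
  proof (cases "x = y")
    case False
    then have "x < y" using assms by simp
    then obtain z where z: "x < z" "z < y"
      "U d y - U c y - (U d x - U c x) = (y - x) * (\<eta> d z - \<eta> c z)"
      using MVT2[of x y "\<lambda>x. U d x - U c x" "\<lambda>x. \<eta> d x - \<eta> c x"] U_deriv by (metis DERIV_diff)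
    show ?thesis unfolding z(3) using z assms by (auto intro!: mult_left_mono)
  qed simp
  then show "(y - x) * m \<le> U d y - U c y - (U d x - U c x)"
    "U d y - U c y - (U d x - U c x) \<le> (y - x) * M" by auto
qed

end

context periodic_leaf
begin

lemma A_c0: "A c0 = 0" by (simp add: A_def)

lemma quot_Q:
  assumes "c < d"
  shows "quot c d (Q 1 e x) = quot c d ((G e ^^ q) x) - of_int p"
  using degree_one_shift_int[OF quot_degree_one[OF assms], of "(G e ^^ q) x" "- p"] by (simp add: Q_def)

lemma A_increment:
  assumes "c < d"
  shows "U d (Q 1 c x) - U c (Q 1 c x) - (U d x - U c x) \<le> A d - A c"
    and "A d - A c \<le> U d (Q 1 d x) - U c (Q 1 d x) - (U d x - U c x)"
proof -
  have U: "U d y - U c y = quot c d y * (d - c)" for y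
    using assms by (simp add: quot_def)
  have A: "A d - A c = (q * slope c d - of_int p) * (d - c)"
    using assms by (simp add: A_def slope_def field_simps)
  show "U d (Q 1 c x) - U c (Q 1 c x) - (U d x - U c x) \<le> A d - A c"
    unfolding U A left_diff_distrib[symmetric] quot_Q[OF assms]
    using quot_iter_upper[OF assms, of q x] assms by (intro mult_right_mono) auto
  show "A d - A c \<le> U d (Q 1 d x) - U c (Q 1 d x) - (U d x - U c x)"
    unfolding U A left_diff_distrib[symmetric] quot_Q[OF assms]
    using quot_iter_lower[OF assms, of x q] assms by (intro mult_right_mono) auto
qed

lemma \<delta>_IVT:
  assumes "c0 < c" "0 \<le> s" "s \<le> \<delta> c x"
  obtains a where "c0 \<le> a" "a \<le> c" "\<delta> a x = s"
proof -
  have "continuous_on UNIV ((\<lambda>(c, x). \<eta> c x) \<circ> (\<lambda>c. (c, x)))"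
    by (intro continuous_on_compose continuous_on_subset[OF \<eta>_cont] continuous_intros) auto
  then have "continuous_on {c0..c} (\<lambda>a. \<delta> a x)"
    unfolding \<delta>_def by (intro continuous_intros) (auto simp: o_def intro: continuous_on_subset)
  then show ?thesis
    using IVT'[of "\<lambda>a. \<delta> a x" c0 s c] assms that by (auto simp: \<delta>_c0)
qed

text \<open>The region of the strip between a vertical segment over \<open>x\<close> and its image under the return map is
  nearly a triangle of height \<open>\<delta> c x\<close> and top side \<open>\<tau> x * \<delta> c x\<close>, while its area \<open>A c\<close> does not
  depend on \<open>x\<close>. The area is computed as a Riemann sum: intermediate leaves \<open>a i\<close> cut the segment into
  \<open>M\<close> equal pieces, \<open>A_increment\<close> bounds the area of each slice by its thickness times the advance on its
  lower or upper leaf, and flatness makes the thickness nearly constant.\<close>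

lemma fundamental_area:
  assumes "0 < e"
  shows "\<forall>\<^sub>F c in at_right c0. \<forall>x. \<bar>2 * A c - \<tau> x * (\<delta> c x)\<^sup>2\<bar> \<le> e * (\<delta> c x)\<^sup>2"
proof -
  obtain t0 t1 where t: "0 < t0" "t0 \<le> t1" "\<And>x. t0 \<le> \<tau> x" "\<And>x. \<tau> x \<le> t1"
    using \<tau>_bounds by metis
  obtain M :: nat where M: "max 1 (max (1 / t0) ((3 * t1 + 4) / e)) < M" using reals_Archimedean2 by blast
  \<comment> \<open>r is both the relative width of a slice and the tolerance for the advance; its square is the tolerance for flatness\<close>
  define r where "r = 1 / real M"
  have M1: "1 < real M" using M by simp
  have r: "0 < r" "r < 1" "r < t0" "(3 * t1 + 4) * r < e" "r * M = 1"
    using M M1 assms t by (auto simp: r_def field_simps)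
  \<comment> \<open>flatness is needed up to the distance (t1 + 1) * D, which is at most K times the height of any leaf a i with i > 0\<close>
  define K where "K = (t1 + 1) * M"
  have K: "0 < K" using t M1 by (simp add: K_def)
  have r2: "0 < r\<^sup>2 / 2" "r\<^sup>2 / 2 \<le> 1" 
    using r power_le_one[of r 2] by auto
  have "\<forall>\<^sub>F c in at_right c0.
      (\<forall>x y. x \<le> y \<longrightarrow> y \<le> x + K * \<delta> c x \<longrightarrow> \<bar>\<delta> c y - \<delta> c x\<bar> \<le> r\<^sup>2 / 2 * \<delta> c x) \<and>
      (\<forall>x. \<bar>Q 1 c x - x - real 1 * \<tau> x * \<delta> c x\<bar> \<le> r * \<delta> c x)"
    using leaf_flat[OF K r2] shear_right[OF r(1), of 1] by (rule eventually_conj)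
  then obtain b where b: "c0 < b" "\<And>c. c0 < c \<Longrightarrow> c < b \<Longrightarrow>
      (\<forall>x y. x \<le> y \<longrightarrow> y \<le> x + K * \<delta> c x \<longrightarrow> \<bar>\<delta> c y - \<delta> c x\<bar> \<le> r\<^sup>2 / 2 * \<delta> c x) \<and>
      (\<forall>x. \<bar>Q 1 c x - x - real 1 * \<tau> x * \<delta> c x\<bar> \<le> r * \<delta> c x)"
    unfolding eventually_at_right_field by blast
  have "\<bar>2 * A c - \<tau> x * (\<delta> c x)\<^sup>2\<bar> \<le> e * (\<delta> c x)\<^sup>2" if c: "c0 < c" "c < b" for c x
  proof -
    define D T where "D = \<delta> c x" and "T = \<tau> x"
    have D: "0 < D" using \<delta>_pos c by (simp add: D_def)
    have T: "t0 \<le> T" "T \<le> t1" using t by (auto simp: T_def)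
    have "\<exists>a. c0 \<le> a \<and> a \<le> c \<and> \<delta> a x = i * r * D" if "i \<le> M" for i
    proof -
      have "i * r \<le> 1" using that M1 by (simp add: r_def)
      then have "i * r * D \<le> \<delta> c x" using mult_right_mono[of "i * r" 1 D] D by (simp add: D_def)
      moreover have "0 \<le> i * r * D" using r D by simp
      ultimately show ?thesis using \<delta>_IVT[OF c(1)] by metis
    qed
    then obtain a where a: "\<And>i. i \<le> M \<Longrightarrow> c0 \<le> a i \<and> a i \<le> c \<and> \<delta> (a i) x = i * r * D"
      by metis
    have \<delta>_inj: "u = v" if "\<delta> u x = \<delta> v x" for u v
    proof (rule ccontr)
      assume "u \<noteq> v"
      then have "u < v \<or> v < u" by linarith
      then have "\<delta> u x < \<delta> v x \<or> \<delta> v x < \<delta> u x" using \<delta>_less by blast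
      then show False using that by linarith
    qed
    have a0: "a 0 = c0" by (rule \<delta>_inj) (simp add: \<delta>_c0 a)
    have "real M * r * D = D" using r(5) by (simp add: mult.commute)
    then have "\<delta> (a M) x = \<delta> c x" using a[of M] unfolding D_def by linarith
    then have aM: "a M = c" by (rule \<delta>_inj)
    have a_less: "a i < a j" if "i < j" "j \<le> M" for i j
    proof (rule ccontr)
      assume "\<not> a i < a j"
      then have "\<delta> (a j) x \<le> \<delta> (a i) x" using \<delta>_less[of "a j" "a i" x] by (cases "a i = a j") auto
      then have "j * (r * D) \<le> i * (r * D)" using a[of i] a[of j] that by (simp add: mult.assoc)
      then show False using that r D by simp
    qed
    have Qa: "(T - r) * (i * r * D) \<le> Q 1 (a i) x - x" "Q 1 (a i) x - x \<le> (T + r) * (i * r * D)" if "i \<le> M" for i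
    proof -
      have "\<bar>Q 1 (a i) x - x - T * (i * r * D)\<bar> \<le> r * (i * r * D)"
      proof (cases "i = 0")
        case True
        then show ?thesis using a0 Q_c0 by simp
      next
        case False
        then have "c0 < a i" using a_less[of 0 i] that a0 by simp
        then show ?thesis
          using conjunct2[OF b(2)[of "a i"], rule_format, of x] a[OF that] c by (simp add: T_def)
      qed
      then show "(T - r) * (i * r * D) \<le> Q 1 (a i) x - x" "Q 1 (a i) x - x \<le> (T + r) * (i * r * D)"
        by (simp_all add: abs_le_iff algebra_simps)
    qed
    have Qx: "x \<le> Q 1 (a i) x" if "i \<le> M" for i
    proof -
      have "0 \<le> (T - r) * (i * r * D)" using T r D by simp
      then show ?thesis using Qa[OF that] by linarith
    qed
    have QM: "Q 1 (a i) x \<le> x + (t1 + 1) * D" if "i \<le> M" for i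
    proof -
      have "i * r \<le> M * r" using that r by (intro mult_right_mono) auto
      then have "i * r \<le> 1" using r(5) by (simp add: mult.commute)
      moreover have "0 \<le> (T + r) * D" using T t(1) r D by simp
      ultimately have "((T + r) * D) * (i * r) \<le> ((T + r) * D) * 1" by (intro mult_left_mono)
      moreover have "(T + r) * D \<le> (t1 + 1) * D" using T r D by (intro mult_right_mono) auto
      moreover have "(T + r) * (i * r * D) = ((T + r) * D) * (i * r)" by (simp add: mult_ac)
      ultimately have "(T + r) * (i * r * D) \<le> (t1 + 1) * D" by linarith
      then show ?thesis using Qa[OF that] by simp
    qed
    have flat: "\<bar>\<delta> (a j) y - j * r * D\<bar> \<le> r\<^sup>2 / 2 * D"
      if "j \<le> M" "x \<le> y" "y \<le> x + (t1 + 1) * D" for j y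
    proof (cases "j = 0")
      case True
      then show ?thesis using a0 \<delta>_c0 D by simp
    next
      case False
      then have *: "c0 < a j" "a j < b" using a_less[of 0 j] that a0 a[of j] c by auto
      have "(t1 + 1) * D * 1 \<le> (t1 + 1) * D * j" using False D t by (intro mult_left_mono) auto
      also have "\<dots> = K * (j * r * D)" using r(5) by (simp add: K_def mult_ac)
      finally have "y \<le> x + K * \<delta> (a j) x" using that a[OF that(1)] by simp
      then have "\<bar>\<delta> (a j) y - j * r * D\<bar> \<le> r\<^sup>2 / 2 * (j * r * D)"
        using conjunct1[OF b(2)[OF *], rule_format, of x y] that a[OF that(1)] by simp
      also have "\<dots> \<le> r\<^sup>2 / 2 * (1 * D)"
        using D that M1 by (intro mult_left_mono mult_right_mono) (auto simp: r_def)
      finally show ?thesis by simp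
    qed
    have thick: "(r - r\<^sup>2) * D \<le> \<eta> (a (Suc i)) y - \<eta> (a i) y \<and> \<eta> (a (Suc i)) y - \<eta> (a i) y \<le> (r + r\<^sup>2) * D"
      if "Suc i \<le> M" "x \<le> y" "y \<le> x + (t1 + 1) * D" for i y
    proof -
      define W P R where "W = i * r * D" and "P = r * D" and "R = r\<^sup>2 / 2 * D"
      have 1: "\<eta> (a (Suc i)) y - \<eta> (a i) y = \<delta> (a (Suc i)) y - \<delta> (a i) y" by (simp add: \<delta>_def)
      have 2: "(r - r\<^sup>2) * D = P - R - R" "(r + r\<^sup>2) * D = P + R + R"
        by (simp_all add: P_def R_def algebra_simps)
      have 3: "real (Suc i) * r * D = W + P" by (simp add: W_def P_def algebra_simps)
      have "\<bar>\<delta> (a (Suc i)) y - (W + P)\<bar> \<le> R" "\<bar>\<delta> (a i) y - W\<bar> \<le> R"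
        using flat[OF that, unfolded 3] flat[of i y] that by (auto simp: W_def R_def)
      then show ?thesis unfolding 1 2 by linarith
    qed
    define B C where "B = (T + r) * r * (r + r\<^sup>2) * D\<^sup>2" and "C = (T - r) * r * (r - r\<^sup>2) * D\<^sup>2"
    have up: "A (a (Suc i)) - A (a i) \<le> B * (real i + 1)" if "Suc i \<le> M" for i
    proof -
      have "A (a (Suc i)) - A (a i) \<le> U (a (Suc i)) (Q 1 (a (Suc i)) x) - U (a i) (Q 1 (a (Suc i)) x) - (U (a (Suc i)) x - U (a i) x)"
        using A_increment(2) a_less that by simp
      also have "\<dots> \<le> (Q 1 (a (Suc i)) x - x) * ((r + r\<^sup>2) * D)"
        using that QM[of "Suc i"] by (intro U_increment_bounds(2)[where m = "(r - r\<^sup>2) * D"] Qx thick) auto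
      also have "\<dots> \<le> ((T + r) * (Suc i * r * D)) * ((r + r\<^sup>2) * D)"
        using Qa[OF that] r D by (intro mult_right_mono) auto
      also have "\<dots> = B * (real i + 1)" by (simp add: B_def power2_eq_square algebra_simps)
      finally show ?thesis .
    qed
    have rr: "0 \<le> r - r\<^sup>2" using r by (simp add: power2_eq_square mult_left_le_one_le)
    have lo: "C * real i \<le> A (a (Suc i)) - A (a i)" if "Suc i \<le> M" for i
    proof -
      have "C * real i = ((T - r) * (i * r * D)) * ((r - r\<^sup>2) * D)" by (simp add: C_def power2_eq_square algebra_simps)
      also have "\<dots> \<le> (Q 1 (a i) x - x) * ((r - r\<^sup>2) * D)"
        using Qa[of i] rr D that by (intro mult_right_mono) auto
      also have "\<dots> \<le> U (a (Suc i)) (Q 1 (a i) x) - U (a i) (Q 1 (a i) x) - (U (a (Suc i)) x - U (a i) x)"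
        using that QM[of i] by (intro U_increment_bounds(1)[where M = "(r + r\<^sup>2) * D"] Qx thick) auto
      also have "\<dots> \<le> A (a (Suc i)) - A (a i)"
        using A_increment(1) a_less that by simp
      finally show ?thesis .
    qed
    have "C * (real j * (real j - 1)) \<le> 2 * A (a j) \<and> 2 * A (a j) \<le> B * (real j * (real j + 1))" if "j \<le> M" for j
      using that
    proof (induction j)
      case 0
      then show ?case using a0 A_c0 by simp
    next
      case (Suc j)
      have "B * (real (Suc j) * (real (Suc j) + 1)) = B * (real j * (real j + 1)) + 2 * (B * (real j + 1))"
        "C * (real (Suc j) * (real (Suc j) - 1)) = C * (real j * (real j - 1)) + 2 * (C * real j)"
        by (simp_all add: algebra_simps)
      then show ?case using Suc up[OF Suc.prems] lo[OF Suc.prems] by simp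
    qed
    from this[of M] aM have AM: "C * (real M * (real M - 1)) \<le> 2 * A c" "2 * A c \<le> B * (real M * (real M + 1))"
      by auto
    have "B * (real M * (real M + 1)) = (T + r) * (r * M) * ((1 + r) * (r * M + r)) * D\<^sup>2"
      by (simp add: B_def power2_eq_square algebra_simps)
    then have B: "B * (real M * (real M + 1)) = (T + r) * (1 + r)\<^sup>2 * D\<^sup>2"
      using r(5) by (simp add: power2_eq_square)
    have "C * (real M * (real M - 1)) = (T - r) * (r * M) * ((1 - r) * (r * M - r)) * D\<^sup>2"
      by (simp add: C_def power2_eq_square algebra_simps)
    then have C: "C * (real M * (real M - 1)) = (T - r) * (1 - r)\<^sup>2 * D\<^sup>2"
      using r(5) by (simp add: power2_eq_square)
    have "r * r \<le> r" using r by (simp add: mult_left_le_one_le)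
    then have "(1 + r)\<^sup>2 \<le> 1 + 3 * r" "1 - 2 * r \<le> (1 - r)\<^sup>2" by (auto simp: power2_eq_square algebra_simps)
    then have "(T + r) * (1 + r)\<^sup>2 \<le> (T + r) * (1 + 3 * r)" "(T - r) * (1 - 2 * r) \<le> (T - r) * (1 - r)\<^sup>2"
      using T t r by (auto intro!: mult_left_mono)
    moreover have "(T + r) * (1 + 3 * r) \<le> T + (3 * T + 4) * r"
      using \<open>r * r \<le> r\<close> by (simp add: algebra_simps)
    moreover have "T - (3 * T + 4) * r \<le> (T - r) * (1 - 2 * r)"
    proof -
      have "0 \<le> T * r" using T t r by simp
      moreover have "0 \<le> r * r" by simp
      ultimately show ?thesis using r by (simp add: algebra_simps)
    qed
    moreover have "(3 * T + 4) * r \<le> (3 * t1 + 4) * r" using T r by (intro mult_right_mono) auto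
    ultimately have "(T + r) * (1 + r)\<^sup>2 \<le> T + e" "T - e \<le> (T - r) * (1 - r)\<^sup>2" using r(4) by linarith+
    then have "(T + r) * (1 + r)\<^sup>2 * D\<^sup>2 \<le> (T + e) * D\<^sup>2" "(T - e) * D\<^sup>2 \<le> (T - r) * (1 - r)\<^sup>2 * D\<^sup>2"
      by (auto intro!: mult_right_mono)
    then have "2 * A c \<le> (T + e) * D\<^sup>2" "(T - e) * D\<^sup>2 \<le> 2 * A c" using AM B C by auto
    then show ?thesis by (simp add: T_def D_def abs_le_iff algebra_simps)
  qed
  then show ?thesis unfolding eventually_at_right_field using b(1) by blast
qed

end

text \<open>A map that grows by nearly a fixed amount at each step of a slow monotone map counts its steps. Two
  such counters of degree one are close to each other. They count the same steps, and in the long run their steps have the same mean size.\<close>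

lemma step_counters_close:
  fixes H F P :: "real \<Rightarrow> real"
  assumes H: "degree_one H" "H 0 = 0" and F: "degree_one F" "F 0 = 0"
    and HP: "\<And>x. H (P x) = H x + s"
    and FP: "\<And>x. b \<le> F (P x) - F x" "\<And>x. F (P x) - F x \<le> B"
    and b: "0 < b"
  shows "\<bar>H x - F x\<bar> \<le> (B - b) / b + B"
proof -
  have mono: "mono H" "mono F" using H F by (auto simp: degree_one_def)
  have it: "n * b \<le> F ((P ^^ n) 0) \<and> F ((P ^^ n) 0) \<le> n * B \<and> H ((P ^^ n) 0) = n * s" for n
  proof (induction n)
    case (Suc n)
    then show ?case using FP[of "(P ^^ n) 0"] HP[of "(P ^^ n) 0"] by (simp add: algebra_simps)
  qed (use H F in simp)
  have "\<bar>H y - F y\<bar> \<le> 2" for y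
    using degree_one_bound[OF H(1), of y 0] degree_one_bound[OF F(1), of y 0] H(2) F(2) by linarith
  then have "real n * b \<le> n * s + 2" "real n * s \<le> n * B + 2" for n
    using it[of n] by (smt (verit))+
  then have s: "b \<le> s" "s \<le> B" using le_of_linear_bound by blast+
  have close: "\<bar>H y - F y\<bar> \<le> (B - b) / b + B" if y: "0 \<le> y" "y \<le> 1" for y
  proof -
    obtain n :: nat where "F y / b < n" using reals_Archimedean2 by blast
    then have "F y < F ((P ^^ n) 0)" using it[of n] b by (simp add: field_simps)
    then have ex: "\<exists>n. y < (P ^^ n) 0" using monoD[OF mono(2)] by (meson not_le)
    define m where "m = (LEAST n. y < (P ^^ n) 0)"
    have m: "y < (P ^^ m) 0" unfolding m_def using ex by (rule LeastI_ex)
    then have "m \<noteq> 0" using y by (cases m) auto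
    then obtain k where k: "m = Suc k" using not0_implies_Suc by blast
    then have "(P ^^ k) 0 \<le> y" using not_less_Least[of k "\<lambda>n. y < (P ^^ n) 0"] m_def by simp
    then have lo: "k * b \<le> F y" "k * s \<le> H y"
      using it[of k] monoD[OF mono(1), of "(P ^^ k) 0" y] monoD[OF mono(2), of "(P ^^ k) 0" y] by auto
    have "y \<le> (P ^^ Suc k) 0" using m k by simp
    then have hi: "F y \<le> Suc k * B" "H y \<le> Suc k * s"
      using it[of "Suc k"] monoD[OF mono(1), of y "(P ^^ Suc k) 0"] monoD[OF mono(2), of y "(P ^^ Suc k) 0"] by auto
    have "F 1 = 1" using F unfolding degree_one_def by (metis add_0)
    then have "k * b \<le> 1" using lo(1) monoD[OF mono(2) y(2)] by linarith
    then have "k \<le> 1 / b" using b by (simp add: field_simps)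
    then have "k * (B - b) \<le> 1 / b * (B - b)" using s by (intro mult_right_mono) auto
    then have "k * (B - b) + B \<le> (B - b) / b + B" by simp
    moreover have "Suc k * B - k * b = k * (B - b) + B" by (simp add: algebra_simps)
    moreover have "\<bar>H y - F y\<bar> \<le> Suc k * B - k * b"
    proof -
      have "k * b \<le> k * s" "Suc k * s \<le> Suc k * B" using s by (auto intro!: mult_left_mono)
      then show ?thesis using lo hi unfolding abs_le_iff by (intro conjI) linarith+
    qed
    ultimately show ?thesis by (simp only:)
  qed
  have "H x = H (frac x) + \<lfloor>x\<rfloor>" "F x = F (frac x) + \<lfloor>x\<rfloor>"
    using degree_one_shift_int[OF H(1), of "frac x" "\<lfloor>x\<rfloor>"]
      degree_one_shift_int[OF F(1), of "frac x" "\<lfloor>x\<rfloor>"] by (simp_all add: frac_def)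
  then show ?thesis using close[of "frac x"] frac_mem[of x] by simp
qed

context periodic_leaf
begin

lemma \<Phi>_shift: "\<Phi> (x + 1) = \<Phi> x + 1"
proof -
  have "((\<lambda>x. \<Phi> (x + 1) - \<Phi> x) has_real_derivative 0) (at x)" for x
    using DERIV_shift[of \<Phi> "\<kappa> (x + 1)" x 1] \<Phi>_deriv[of "x + 1"] \<Phi>_deriv[of x]
    by (auto intro!: derivative_eq_intros simp: \<kappa>_periodic)
  then have "\<Phi> (x + 1) - \<Phi> x = \<Phi> (0 + 1) - \<Phi> 0"
    using DERIV_isconst_all[of "\<lambda>x. \<Phi> (x + 1) - \<Phi> x"] by blast
  then show ?thesis by (simp add: \<Phi>_0 \<Phi>_1)
qed

lemma \<Phi>_degree_one: "degree_one \<Phi>"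
  unfolding degree_one_def
proof (intro conjI monoI allI \<Phi>_shift)
  fix x y :: real assume "x \<le> y"
  then show "\<Phi> x \<le> \<Phi> y"
    by (rule DERIV_nonneg_imp_nondecreasing) (use \<Phi>_deriv \<kappa>_pos less_imp_le in blast)
qed

lemma U_increment_vs_\<Phi>:
  assumes "x \<le> y" "\<And>z. a * \<kappa> z \<le> \<eta> d z - \<eta> c z" "\<And>z. \<eta> d z - \<eta> c z \<le> b * \<kappa> z"
  shows "a * (\<Phi> y - \<Phi> x) \<le> U d y - U c y - (U d x - U c x)"
    and "U d y - U c y - (U d x - U c x) \<le> b * (\<Phi> y - \<Phi> x)"
proof -
  have "(\<lambda>z. U d z - U c z - a * \<Phi> z) x \<le> (\<lambda>z. U d z - U c z - a * \<Phi> z) y"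
  proof (rule DERIV_nonneg_imp_nondecreasing[OF assms(1)])
    fix z
    have "((\<lambda>z. U d z - U c z - a * \<Phi> z) has_real_derivative (\<eta> d z - \<eta> c z - a * \<kappa> z)) (at z)"
      by (auto intro!: derivative_eq_intros U_deriv \<Phi>_deriv)
    then show "\<exists>w. ((\<lambda>z. U d z - U c z - a * \<Phi> z) has_real_derivative w) (at z) \<and> 0 \<le> w"
      using assms(2)[of z] by fastforce
  qed
  then show "a * (\<Phi> y - \<Phi> x) \<le> U d y - U c y - (U d x - U c x)" by (simp add: algebra_simps)
  have "(\<lambda>z. b * \<Phi> z - (U d z - U c z)) x \<le> (\<lambda>z. b * \<Phi> z - (U d z - U c z)) y"
  proof (rule DERIV_nonneg_imp_nondecreasing[OF assms(1)])
    fix z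
    have "((\<lambda>z. b * \<Phi> z - (U d z - U c z)) has_real_derivative (b * \<kappa> z - (\<eta> d z - \<eta> c z))) (at z)"
      by (auto intro!: derivative_eq_intros U_deriv \<Phi>_deriv)
    then show "\<exists>w. ((\<lambda>z. b * \<Phi> z - (U d z - U c z)) has_real_derivative w) (at z) \<and> 0 \<le> w"
      using assms(3)[of z] by fastforce
  qed
  then show "U d y - U c y - (U d x - U c x) \<le> b * (\<Phi> y - \<Phi> x)" by (simp add: algebra_simps)
qed

lemma \<kappa>_bounds:
  obtains k0 k1 where "0 < k0" "\<And>x. k0 \<le> \<kappa> x" "0 < k1" "\<And>x. \<kappa> x \<le> k1"
proof -
  obtain k0 where k0: "0 < k0" "\<And>x. k0 \<le> \<kappa> x"
    using periodic_continuous_pos_min[OF \<kappa>_cont \<kappa>_periodic \<kappa>_pos] by blast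
  obtain k1 where "0 < k1" "\<And>x. \<bar>\<kappa> x\<bar> \<le> k1"
    using periodic_continuous_bound[OF \<kappa>_cont \<kappa>_periodic] by blast
  then show ?thesis using that[OF k0] by (meson abs_le_D1)
qed

text \<open>By \<open>fundamental_area\<close> the ratio of \<open>(\<delta> c x)\<^sup>2\<close> to \<open>2 * A c * (\<kappa> x)\<^sup>2 / J\<close> tends to 1 uniformly in
  \<open>x\<close>, so \<open>\<delta> c\<close> is nearly \<open>r * \<kappa>\<close> with \<open>r\<close> independent of \<open>x\<close>. The integrals over one period
  are \<open>c - c0\<close> and \<open>r\<close>, hence \<open>r\<close> is nearly \<open>c - c0\<close>.\<close>

lemma density_right:
  assumes "0 < e"
  shows "\<forall>\<^sub>F c in at_right c0. \<forall>x. \<bar>\<delta> c x - \<kappa> x * (c - c0)\<bar> \<le> e * (\<kappa> x * (c - c0))"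
proof -
  obtain k0 k1 where k: "0 < k0" "\<And>x. k0 \<le> \<kappa> x" "0 < k1" "\<And>x. \<kappa> x \<le> k1"
    using \<kappa>_bounds by metis
  define e1 where "e1 = min (1 / 4) (e / 8)"
  have e1: "0 < e1" "e1 \<le> 1 / 4" "8 * e1 \<le> e" using assms by (auto simp: e1_def)
  have "0 < e1 * J / k1\<^sup>2" using e1 J_pos k by simp
  from fundamental_area[OF this] eventually_at_right_less[of c0]
  show ?thesis
  proof eventually_elim
    case (elim c)
    define r where "r = sqrt (2 * A c / J)"
    have d: "0 < \<delta> c x" for x using \<delta>_pos elim by simp
    have sq: "\<bar>(\<kappa> x)\<^sup>2 * (2 * A c / J) - (\<delta> c x)\<^sup>2\<bar> \<le> e1 * (\<delta> c x)\<^sup>2" for x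
    proof -
      have "\<bar>2 * A c - \<tau> x * (\<delta> c x)\<^sup>2\<bar> * ((\<kappa> x)\<^sup>2 / J) \<le> e1 * J / k1\<^sup>2 * (\<delta> c x)\<^sup>2 * ((\<kappa> x)\<^sup>2 / J)"
        using elim J_pos by (intro mult_right_mono) auto
      also have "\<dots> = e1 * (\<delta> c x)\<^sup>2 * ((\<kappa> x)\<^sup>2 / k1\<^sup>2)" using J_pos by simp
      also have "\<dots> \<le> e1 * (\<delta> c x)\<^sup>2 * 1"
        using e1 k \<kappa>_pos[of x] by (intro mult_left_mono) (auto simp: less_imp_le intro!: power_mono)
      also have "\<bar>2 * A c - \<tau> x * (\<delta> c x)\<^sup>2\<bar> * ((\<kappa> x)\<^sup>2 / J) = \<bar>(2 * A c - \<tau> x * (\<delta> c x)\<^sup>2) * ((\<kappa> x)\<^sup>2 / J)\<bar>"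
        using J_pos by (simp add: abs_mult)
      also have "(2 * A c - \<tau> x * (\<delta> c x)\<^sup>2) * ((\<kappa> x)\<^sup>2 / J) = (\<kappa> x)\<^sup>2 * (2 * A c / J) - (\<delta> c x)\<^sup>2"
        using J_pos \<kappa>_pos[of x] by (simp add: \<tau>_def field_simps)
      finally show ?thesis by simp
    qed
    have "0 \<le> (1 - e1) * (\<delta> c 0)\<^sup>2" using e1 by simp
    then have "0 \<le> (\<kappa> 0)\<^sup>2 * (2 * A c / J)" using sq[of 0] by (simp add: algebra_simps abs_le_iff)
    then have "0 \<le> 2 * A c / J" using \<kappa>_pos[of 0] by (metis zero_le_mult_iff zero_less_power not_le)
    then have r: "0 \<le> r" "r\<^sup>2 = 2 * A c / J" by (auto simp: r_def)
    have rel: "\<bar>\<delta> c x - \<kappa> x * r\<bar> \<le> 2 * e1 * (\<kappa> x * r)" for x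
    proof -
      have kr: "0 \<le> \<kappa> x * r" using r \<kappa>_pos[of x] by simp
      have "\<bar>\<kappa> x * r - \<delta> c x\<bar> * \<delta> c x \<le> \<bar>\<kappa> x * r - \<delta> c x\<bar> * (\<kappa> x * r + \<delta> c x)"
        using kr by (intro mult_left_mono) auto
      also have "\<dots> = \<bar>(\<kappa> x * r - \<delta> c x) * (\<kappa> x * r + \<delta> c x)\<bar>"
        using kr d[of x] by (simp add: abs_mult)
      also have "(\<kappa> x * r - \<delta> c x) * (\<kappa> x * r + \<delta> c x) = (\<kappa> x)\<^sup>2 * r\<^sup>2 - (\<delta> c x)\<^sup>2"
        by (simp add: power2_eq_square algebra_simps)
      also have "\<bar>\<dots>\<bar> \<le> e1 * (\<delta> c x)\<^sup>2" using sq[of x] by (simp add: r)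
      also have "\<dots> = e1 * \<delta> c x * \<delta> c x" by (simp add: power2_eq_square)
      finally have 1: "\<bar>\<kappa> x * r - \<delta> c x\<bar> \<le> e1 * \<delta> c x" using d[of x] by simp
      have "e1 * \<delta> c x \<le> 1 / 4 * \<delta> c x" using e1 d[of x] by (intro mult_right_mono) auto
      then have "\<delta> c x \<le> 2 * (\<kappa> x * r)" using 1 d[of x] by linarith
      then have "e1 * \<delta> c x \<le> e1 * (2 * (\<kappa> x * r))" using e1 by (intro mult_left_mono) auto
      then show ?thesis using 1 by (simp add: abs_minus_commute)
    qed
    have b: "(1 - 2 * e1) * r * \<kappa> z \<le> \<eta> c z - \<eta> c0 z" "\<eta> c z - \<eta> c0 z \<le> (1 + 2 * e1) * r * \<kappa> z" for z
      using rel[of z] by (auto simp: \<delta>_def abs_le_iff algebra_simps)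
    have "(1 - 2 * e1) * r * (\<Phi> 1 - \<Phi> 0) \<le> U c 1 - U c0 1 - (U c 0 - U c0 0)"
      "U c 1 - U c0 1 - (U c 0 - U c0 0) \<le> (1 + 2 * e1) * r * (\<Phi> 1 - \<Phi> 0)"
      using U_increment_vs_\<Phi>[OF zero_le_one b] by auto
    then have h: "\<bar>(c - c0) - r\<bar> \<le> 2 * e1 * r"
      by (simp add: U_0 U_1 \<Phi>_0 \<Phi>_1 abs_le_iff algebra_simps)
    also have "2 * e1 * r \<le> 1 / 2 * r" using e1 r by (intro mult_right_mono) auto
    finally have "r / 2 \<le> c - c0" by linarith
    then have r_le: "r \<le> 2 * (c - c0)" by simp
    show ?case
    proof
      fix x
      have "\<bar>\<kappa> x * r - \<kappa> x * (c - c0)\<bar> = \<kappa> x * \<bar>(c - c0) - r\<bar>"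
        using \<kappa>_pos[of x] by (simp add: abs_mult abs_minus_commute flip: right_diff_distrib)
      also have "\<dots> \<le> \<kappa> x * (2 * e1 * r)" using h \<kappa>_pos[of x] by (intro mult_left_mono) auto
      finally have "\<bar>\<delta> c x - \<kappa> x * (c - c0)\<bar> \<le> 4 * e1 * \<kappa> x * r" using rel[of x] by (simp add: algebra_simps)
      also have "\<dots> \<le> 4 * e1 * \<kappa> x * (2 * (c - c0))" using r_le e1 \<kappa>_pos[of x] by (intro mult_left_mono) auto
      also have "\<dots> = 8 * e1 * (\<kappa> x * (c - c0))" by simp
      also have "\<dots> \<le> e * (\<kappa> x * (c - c0))" using e1 \<kappa>_pos[of x] elim by (intro mult_right_mono) auto
      finally show "\<bar>\<delta> c x - \<kappa> x * (c - c0)\<bar> \<le> e * (\<kappa> x * (c - c0))" .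
    qed
  qed
qed

lemma quot_tendsto_right: "((\<lambda>c. quot c0 c x) \<longlongrightarrow> \<Phi> x) (at_right c0)"
proof (rule tendstoI)
  fix e :: real assume "0 < e"
  define e1 where "e1 = e / (2 * (\<bar>\<Phi> x\<bar> + 1))"
  have e1: "0 < e1" using \<open>0 < e\<close> by (simp add: e1_def)
  have "e1 * \<bar>\<Phi> x\<bar> \<le> e1 * (\<bar>\<Phi> x\<bar> + 1)" using e1 by simp
  also have "\<dots> = e / 2"
  proof -
    have "\<bar>\<Phi> x\<bar> + 1 \<noteq> 0" by linarith
    then show ?thesis by (simp add: e1_def field_simps)
  qed
  finally have e2: "e1 * \<bar>\<Phi> x\<bar> < e" using \<open>0 < e\<close> by simp
  from density_right[OF e1] eventually_at_right_less[of c0]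
  show "\<forall>\<^sub>F c in at_right c0. dist (quot c0 c x) (\<Phi> x) < e"
  proof eventually_elim
    case (elim c)
    define h where "h = c - c0"
    have h: "0 < h" using elim by (simp add: h_def)
    have b: "(1 - e1) * h * \<kappa> z \<le> \<eta> c z - \<eta> c0 z" "\<eta> c z - \<eta> c0 z \<le> (1 + e1) * h * \<kappa> z" for z
      using elim(1)[rule_format, of z] by (auto simp: \<delta>_def h_def abs_le_iff algebra_simps)
    have "\<bar>U c x - U c0 x - h * \<Phi> x\<bar> \<le> h * (e1 * \<bar>\<Phi> x\<bar>)"
    proof (cases "0 \<le> x")
      case True
      have "0 \<le> \<Phi> x" using True \<Phi>_degree_one \<Phi>_0 by (metis degree_one_def monoD)
      then show ?thesis
        using U_increment_vs_\<Phi>[OF True b] by (simp add: U_0 \<Phi>_0 abs_le_iff algebra_simps)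
    next
      case False
      then have F: "x \<le> 0" by simp
      have "\<Phi> x \<le> 0" using F \<Phi>_degree_one \<Phi>_0 by (metis degree_one_def monoD)
      then show ?thesis
        using U_increment_vs_\<Phi>[OF F b] by (simp add: U_0 \<Phi>_0 abs_le_iff algebra_simps)
    qed
    moreover have "h * quot c0 c x = U c x - U c0 x" using h by (simp add: quot_def h_def)
    ultimately have "\<bar>h * (quot c0 c x - \<Phi> x)\<bar> \<le> h * (e1 * \<bar>\<Phi> x\<bar>)" by (simp add: right_diff_distrib)
    then have "h * \<bar>quot c0 c x - \<Phi> x\<bar> \<le> h * (e1 * \<bar>\<Phi> x\<bar>)" using h by (simp add: abs_mult)
    then have "\<bar>quot c0 c x - \<Phi> x\<bar> \<le> e1 * \<bar>\<Phi> x\<bar>" using h by simp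
    then show ?case using e2 by (simp add: dist_real_def)
  qed
qed

end

context periodic_leaf
begin

text \<open>In the coordinate \<open>\<Phi>\<close> the return map on nearby leaves is nearly a translation: the advance is
  \<open>\<tau> * \<delta>\<close>, which is about \<open>J / \<kappa> * (c - c0)\<close>, and \<open>\<Phi>\<close> has derivative \<open>\<kappa>\<close>.\<close>

lemma speed_right:
  assumes "0 < e"
  shows "\<forall>\<^sub>F c in at_right c0. \<forall>x. \<bar>\<Phi> (Q 1 c x) - \<Phi> x - J * (c - c0)\<bar> \<le> e * (c - c0)"
proof -
  obtain k0 k1 where k: "0 < k0" "\<And>x. k0 \<le> \<kappa> x" "0 < k1" "\<And>x. \<kappa> x \<le> k1"
    using \<kappa>_bounds by metis
  \<comment> \<open>relative error constants: C1 for the advance of the return map, C2 for the advance in the coordinate Phi\<close>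
  define C1 where "C1 = 2 * k1 + J / k0"
  define C2 where "C2 = J / k0 + C1 + k1 * C1"
  have Jk: "0 < J / k0" using k J_pos by simp
  have C1: "0 < C1" using Jk k(3) unfolding C1_def by linarith
  have "0 < k1 * C1" using k(3) C1 by simp
  then have C2: "0 < C2" using Jk C1 unfolding C2_def by linarith
  note C = C1 C2
  have X: "0 < J / k0 + C1" using Jk C1 by linarith
  define e1 where "e1 = min 1 (e / C2)"
  have e1: "0 < e1" "e1 \<le> 1" "e1 * C2 \<le> e" 
  proof -
    have "e1 \<le> e / C2" by (simp add: e1_def)
    then show "e1 * C2 \<le> e" using C2 by (simp add: pos_le_divide_eq)
  qed (use assms C2 in \<open>auto simp: e1_def\<close>)
  obtain d where d: "0 < d" "\<And>x y. \<bar>x - y\<bar> < d \<Longrightarrow> \<bar>\<kappa> x - \<kappa> y\<bar> < e1"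
    using periodic_uniform[OF \<kappa>_cont \<kappa>_periodic e1(1)] by metis
  have "\<forall>\<^sub>F c in at_right c0. c \<in> {c0<..<c0 + d / (J / k0 + C1)}"
    using d(1) X by (intro eventually_at_right_real) simp
  with density_right[OF e1(1)] shear_right[OF e1(1), of 1]
  show ?thesis
  proof eventually_elim
    case (elim c)
    define h where "h = c - c0"
    have h: "0 < h" "h * (J / k0 + C1) < d"
    proof -
      have "h < d / (J / k0 + C1)" "0 < h" using elim(3) by (auto simp: h_def)
      then show "0 < h" "h * (J / k0 + C1) < d" using X by (simp_all only: pos_less_divide_eq)
    qed
    show ?case
    proof
      fix x
      have k0x: "0 < \<kappa> x" by (rule \<kappa>_pos)
      have 1: "\<bar>\<delta> c x - \<kappa> x * h\<bar> \<le> e1 * (\<kappa> x * h)" using elim(1) by (simp add: h_def)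
      have "e1 * (\<kappa> x * h) \<le> 1 * (\<kappa> x * h)" using e1 k0x h by (intro mult_right_mono) auto
      then have dl: "\<delta> c x \<le> 2 * (\<kappa> x * h)" using 1 by linarith
      also have "\<dots> \<le> 2 * (k1 * h)" using k(4)[of x] h by simp
      finally have dl: "\<delta> c x \<le> 2 * k1 * h" by simp
      have J0: "J / \<kappa> x \<le> J / k0" using k k0x J_pos by (intro divide_left_mono) auto
      have "\<bar>\<tau> x * \<delta> c x - J / \<kappa> x * h\<bar> = \<tau> x * \<bar>\<delta> c x - \<kappa> x * h\<bar>"
      proof -
        have "\<tau> x * \<delta> c x - J / \<kappa> x * h = \<tau> x * (\<delta> c x - \<kappa> x * h)"
          using k0x by (simp add: \<tau>_def power2_eq_square field_simps)
        then show ?thesis using \<tau>_pos[of x] by (simp add: abs_mult)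
      qed
      also have "\<dots> \<le> \<tau> x * (e1 * (\<kappa> x * h))" using 1 \<tau>_pos[of x] by (intro mult_left_mono) auto
      also have "\<dots> = e1 * h * (J / \<kappa> x)" using k0x by (simp add: \<tau>_def power2_eq_square)
      also have "\<dots> \<le> e1 * h * (J / k0)" using J0 e1 h by (intro mult_left_mono) auto
      finally have 2: "\<bar>\<tau> x * \<delta> c x - J / \<kappa> x * h\<bar> \<le> e1 * h * (J / k0)" .
      have "\<bar>Q 1 c x - x - \<tau> x * \<delta> c x\<bar> \<le> e1 * \<delta> c x" using elim(2) by simp
      also have "\<dots> \<le> e1 * (2 * k1 * h)" using dl e1 by (intro mult_left_mono) auto
      finally have 3: "\<bar>Q 1 c x - x - J / \<kappa> x * h\<bar> \<le> e1 * h * C1"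
        using 2 by (simp add: C1_def algebra_simps)
      have "e1 * (h * C1) \<le> 1 * (h * C1)" using e1 h C by (intro mult_right_mono) auto
      moreover have "J / \<kappa> x * h \<le> J / k0 * h" using J0 h by (intro mult_right_mono) auto
      moreover have Qx: "x < Q 1 c x"
        using iter_less[of c0 c q x] q_pos periodic[of x] h by (simp add: Q_def h_def)
      ultimately have 4: "Q 1 c x - x \<le> h * (J / k0 + C1)" using 3 by (simp add: algebra_simps)
      obtain z where z: "x < z" "z < Q 1 c x" "\<Phi> (Q 1 c x) - \<Phi> x = (Q 1 c x - x) * \<kappa> z"
        using MVT2[OF Qx, of \<Phi> \<kappa>] \<Phi>_deriv by metis
      have "\<bar>\<kappa> z - \<kappa> x\<bar> < e1" using z 4 h by (intro d(2)) auto
      then have "(Q 1 c x - x) * \<bar>\<kappa> z - \<kappa> x\<bar> \<le> h * (J / k0 + C1) * e1"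
        using 4 Qx e1 h C by (intro mult_mono) auto
      then have 5: "\<bar>(Q 1 c x - x) * \<kappa> z - (Q 1 c x - x) * \<kappa> x\<bar> \<le> h * (J / k0 + C1) * e1"
        using Qx by (simp add: abs_mult flip: right_diff_distrib)
      have "(Q 1 c x - x) * \<kappa> x - J * h = (Q 1 c x - x - J / \<kappa> x * h) * \<kappa> x"
        using k0x by (simp add: field_simps)
      then have "\<bar>(Q 1 c x - x) * \<kappa> x - J * h\<bar> = \<bar>Q 1 c x - x - J / \<kappa> x * h\<bar> * \<kappa> x"
        using k0x by (simp add: abs_mult)
      also have "\<dots> \<le> (e1 * h * C1) * k1" using 3 k(4)[of x] k0x e1 h C by (intro mult_mono) auto
      finally have "\<bar>\<Phi> (Q 1 c x) - \<Phi> x - J * h\<bar> \<le> h * (J / k0 + C1) * e1 + (e1 * h * C1) * k1"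
        using 5 unfolding z(3) by linarith
      also have "\<dots> = (e1 * C2) * h" by (simp add: C2_def algebra_simps)
      also have "\<dots> \<le> e * h" using e1 h by (intro mult_right_mono) auto
      finally show "\<bar>\<Phi> (Q 1 c x) - \<Phi> x - J * (c - c0)\<bar> \<le> e * (c - c0)" by (simp add: h_def)
    qed
  qed
qed

text \<open>The maps \<open>H c\<close> and \<open>\<Phi>\<close> are both step counters of the return map of the leaf \<open>c\<close>, the first
  exactly, by the conjugacy equation, the second approximately, by \<open>speed_right\<close>.\<close>

lemma conjugacies_converge_right:
  assumes H: "\<forall>\<^sub>F c in at_right c0. degree_one (H c) \<and> H c 0 = 0 \<and> (\<forall>x. H c (G c x) = H c x + rho c)"
    and "0 < e"
  shows "\<forall>\<^sub>F c in at_right c0. \<forall>x. \<bar>H c x - \<Phi> x\<bar> < e"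
proof -
  define t where "t = min (1 / 2) (e / 8)"
  have t: "0 < t" "t \<le> 1 / 2" "8 * t \<le> e" using assms by (auto simp: t_def)
  have Jt: "0 < J * t" using J_pos t by simp
  have "\<forall>\<^sub>F c in at_right c0. c \<in> {c0<..<c0 + e / (4 * J)}"
    using assms(2) J_pos by (intro eventually_at_right_real) simp
  with H speed_right[OF Jt]
  show ?thesis
  proof eventually_elim
    case (elim c)
    define h where "h = c - c0"
    have h: "0 < h" "h < e / (4 * J)" using elim(3) by (auto simp: h_def)
    have H1: "degree_one (H c)" "H c 0 = 0" using elim by auto
    have HG: "H c ((G c ^^ n) x) = H c x + n * rho c" for n x
      using elim(1) by (induction n) (auto simp: algebra_simps)
    have HQ: "H c (Q 1 c x) = H c x + (q * rho c - of_int p)" for x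
      using HG[of q x] degree_one_shift_int[OF H1(1), of "(G c ^^ q) x" "- p"] by (simp add: Q_def)
    have sp: "\<bar>\<Phi> (Q 1 c x) - \<Phi> x - J * h\<bar> \<le> J * t * h" for x
      using elim(2) by (simp add: h_def)
    have FQ: "(1 - t) * (J * h) \<le> \<Phi> (Q 1 c x) - \<Phi> x" "\<Phi> (Q 1 c x) - \<Phi> x \<le> (1 + t) * (J * h)" for x
      using sp[of x] by (auto simp: abs_le_iff algebra_simps)
    have Jh: "0 < J * h" using J_pos h by simp
    have b: "0 < (1 - t) * (J * h)" using Jh t by simp
    have "((1 + t) * (J * h) - (1 - t) * (J * h)) / ((1 - t) * (J * h)) = 2 * t * (J * h) / ((1 - t) * (J * h))"
      by (simp add: algebra_simps)
    also have "\<dots> = 2 * t / (1 - t)"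
      by (rule nonzero_mult_divide_mult_cancel_right) (use Jh in auto)
    also have "\<dots> \<le> 2 * t / (1 / 2)" using t by (intro divide_left_mono) auto
    also have "\<dots> \<le> e / 2" using t by simp
    finally have 1: "((1 + t) * (J * h) - (1 - t) * (J * h)) / ((1 - t) * (J * h)) \<le> e / 2" .
    have "(1 + t) * (J * h) \<le> 2 * (J * h)" using t Jh by (intro mult_right_mono) auto
    also have "\<dots> < e / 2" using h(2) J_pos by (simp add: field_simps)
    finally have 2: "(1 + t) * (J * h) < e / 2" .
    show ?case
    proof
      fix x
      have "\<bar>H c x - \<Phi> x\<bar> \<le> ((1 + t) * (J * h) - (1 - t) * (J * h)) / ((1 - t) * (J * h)) + (1 + t) * (J * h)"
        by (rule step_counters_close[where H = "H c" and F = \<Phi> and P = "Q 1 c", OF H1 \<Phi>_degree_one \<Phi>_0 HQ FQ b])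
      then show "\<bar>H c x - \<Phi> x\<bar> < e" using 1 2 by linarith
    qed
  qed
qed

end

text \<open>The rotation of the plane by a half turn is symplectic and preserves the twist, so the hypotheses are
  invariant under it. It exchanges the two sides of a leaf, which reduces limits from the left to
  limits from the right.\<close>

lemma (in monotone_leaves) reflected:
  "monotone_leaves (\<lambda>c x. U (- c) (- x)) (\<lambda>c x. - \<eta> (- c) (- x)) (\<lambda>c x. - G (- c) (- x)) (\<lambda>c. \<alpha> (- c))"
proof (rule monotone_leaves.intro)
  have "continuous_on UNIV ((\<lambda>(c, x). \<eta> c x) \<circ> (\<lambda>p. - p))"
    by (intro continuous_on_compose continuous_on_subset[OF \<eta>_cont] continuous_intros) auto
  then show "continuous_on UNIV (\<lambda>(c, x). - \<eta> (- c) (- x))"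
    by (auto intro!: continuous_intros simp: case_prod_unfold o_def)
  have "continuous_on UNIV ((\<lambda>(c, x). G c x) \<circ> (\<lambda>p. - p))"
    by (intro continuous_on_compose continuous_on_subset[OF G_cont] continuous_intros) auto
  then show "continuous_on UNIV (\<lambda>(c, x). - G (- c) (- x))"
    by (auto intro!: continuous_intros simp: case_prod_unfold o_def)
  fix c x :: real
  show "- \<eta> (- c) (- (x + 1)) = - \<eta> (- c) (- x)"
    using \<eta>_periodic[of "- c" "- x - 1"] by simp
  show "((\<lambda>x. U (- c) (- x)) has_real_derivative - \<eta> (- c) (- x)) (at x)"
  proof -
    have "((\<lambda>x. U (- c) (- x)) has_real_derivative \<eta> (- c) (- x) * - 1) (at x)"
      by (rule DERIV_chain2[OF U_deriv]) (auto intro!: derivative_eq_intros)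
    then show ?thesis by simp
  qed
  show "U (- c) (- 0) = 0" by (simp add: U_0)
  show "U (- c) (- 1) = c" using U_shift[of "- c" "- 1"] by (simp add: U_0)
  show "degree_one (\<lambda>x. - G (- c) (- x))"
    unfolding degree_one_def
  proof (intro conjI monoI allI)
    fix x y :: real
    show "x \<le> y \<Longrightarrow> - G (- c) (- x) \<le> - G (- c) (- y)" by (simp add: G_mono)
    show "- G (- c) (- (x + 1)) = - G (- c) (- x) + 1"
      using degree_one_shift_int[OF G_degree_one, of "- c" "- x" "- 1"] by simp
  qed
next
  fix c d x :: real assume cd: "c < d"
  then have dc: "- d < - c" by simp
  show "- \<eta> (- c) (- x) < - \<eta> (- d) (- x)" using \<eta>_less[OF dc] by simp
  show "- G (- c) (- x) < - G (- d) (- x)" using G_less[OF dc] by simp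
  show "U (- d) (- (- G (- c) (- x))) - U (- c) (- (- G (- c) (- x))) - (U (- d) (- x) - U (- c) (- x))
      \<le> \<alpha> (- d) - \<alpha> (- c)"
    using action_lower[OF dc, of "- x"] by simp
  show "\<alpha> (- d) - \<alpha> (- c)
      \<le> U (- d) (- (- G (- d) (- x))) - U (- c) (- (- G (- d) (- x))) - (U (- d) (- x) - U (- c) (- x))"
    using action_upper[OF dc, of "- x"] by simp
qed

lemma reflect_funpow:
  fixes g :: "real \<Rightarrow> real"
  shows "((\<lambda>x. - g (- x)) ^^ n) x = - (g ^^ n) (- x)"
  by (induction n) auto

lemma eventually_at_uminus:
  fixes c0 :: real
  shows "(\<forall>\<^sub>F c in at (- c0). P (- c)) \<longleftrightarrow> (\<forall>\<^sub>F c in at c0. P c)"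
  unfolding filtermap_at_minus[symmetric] eventually_filtermap by simp

lemma (in periodic_leaf) reflected_periodic:
  "periodic_leaf (\<lambda>c x. U (- c) (- x)) (\<lambda>c x. - \<eta> (- c) (- x)) (\<lambda>c x. - G (- c) (- x)) (\<lambda>c. \<alpha> (- c))
     (- c0) q (- p) (\<lambda>x. \<kappa> (- x)) (\<lambda>x. - \<Phi> (- x)) J"
proof (intro periodic_leaf.intro reflected periodic_leaf_axioms.intro)
  show "0 < q" "0 < J" using q_pos J_pos .
  show "((\<lambda>x. - G (- (- c0)) (- x)) ^^ q) x = x + of_int (- p)" for x
    by (simp add: reflect_funpow periodic)
  show "continuous_on UNIV (\<lambda>x. \<kappa> (- x))"
    by (rule continuous_on_compose2[OF \<kappa>_cont]) (auto intro!: continuous_intros)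
  show "0 < \<kappa> (- x)" for x by (rule \<kappa>_pos)
  show "\<kappa> (- (x + 1)) = \<kappa> (- x)" for x using \<kappa>_periodic[of "- x - 1"] by simp
  show "((\<lambda>x. - \<Phi> (- x)) has_real_derivative \<kappa> (- x)) (at x)" for x
  proof -
    have "((\<lambda>x. \<Phi> (- x)) has_real_derivative \<kappa> (- x) * - 1) (at x)"
      by (rule DERIV_chain2[OF \<Phi>_deriv]) (auto intro!: derivative_eq_intros)
    then show ?thesis by (auto intro!: derivative_eq_intros)
  qed
  show "- \<Phi> (- 0) = 0" by (simp add: \<Phi>_0)
  show "- \<Phi> (- 1) = 1" using \<Phi>_shift[of "- 1"] by (simp add: \<Phi>_0)
  fix N :: nat and e :: real assume "0 < e"
  then have "\<forall>\<^sub>F c in at (- c0). \<forall>x.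
      \<bar>(G (- c) ^^ (N * q)) x - x - of_int (N * p) - N * (J / (\<kappa> x)\<^sup>2) * (\<eta> (- c) x - \<eta> c0 x)\<bar>
        \<le> e * \<bar>\<eta> (- c) x - \<eta> c0 x\<bar>"
    by (rule iffD2[OF eventually_at_uminus shear])
  then show "\<forall>\<^sub>F c in at (- c0). \<forall>x.
      \<bar>((\<lambda>x. - G (- c) (- x)) ^^ (N * q)) x - x - of_int (N * - p)
         - N * (J / (\<kappa> (- x))\<^sup>2) * (- \<eta> (- c) (- x) - - \<eta> (- (- c0)) (- x))\<bar>
        \<le> e * \<bar>- \<eta> (- c) (- x) - - \<eta> (- (- c0)) (- x)\<bar>"
  proof eventually_elim
    case (elim c)
    show ?case
    proof
      fix x
      have 1: "((\<lambda>x. - G (- c) (- x)) ^^ (N * q)) x - x - of_int (N * - p)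
         - N * (J / (\<kappa> (- x))\<^sup>2) * (- \<eta> (- c) (- x) - - \<eta> (- (- c0)) (- x))
        = - ((G (- c) ^^ (N * q)) (- x) - - x - of_int (N * p)
           - N * (J / (\<kappa> (- x))\<^sup>2) * (\<eta> (- c) (- x) - \<eta> c0 (- x)))"
        unfolding reflect_funpow by (simp add: right_diff_distrib)
      have 2: "- \<eta> (- c) (- x) - - \<eta> (- (- c0)) (- x) = - (\<eta> (- c) (- x) - \<eta> c0 (- x))" by simp
      show "\<bar>((\<lambda>x. - G (- c) (- x)) ^^ (N * q)) x - x - of_int (N * - p)
         - N * (J / (\<kappa> (- x))\<^sup>2) * (- \<eta> (- c) (- x) - - \<eta> (- (- c0)) (- x))\<bar>
        \<le> e * \<bar>- \<eta> (- c) (- x) - - \<eta> (- (- c0)) (- x)\<bar>"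
        using elim[rule_format, of "- x"] unfolding 1 unfolding 2 abs_minus_cancel .
    qed
  qed
qed

section \<open>The family of conjugacies to the rotations\<close>

context periodic_leaf
begin

lemma U_param_deriv: "((\<lambda>c. U c x) has_real_derivative \<Phi> x) (at c0)"
proof -
  interpret R: periodic_leaf "\<lambda>c x. U (- c) (- x)" "\<lambda>c x. - \<eta> (- c) (- x)" "\<lambda>c x. - G (- c) (- x)"
    "\<lambda>c. \<alpha> (- c)" "- c0" q "- p" "\<lambda>x. \<kappa> (- x)" "\<lambda>x. - \<Phi> (- x)" J
    by (rule reflected_periodic)
  have "((\<lambda>c. (U c x - U c0 x) / (c - c0)) \<longlongrightarrow> \<Phi> x) (at_right c0)"
    using quot_tendsto_right by (simp add: quot_def)
  moreover have "((\<lambda>c. (U c x - U c0 x) / (c - c0)) \<longlongrightarrow> \<Phi> x) (at_left c0)"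
  proof -
    have "((\<lambda>c. R.quot (- c0) c (- x)) \<longlongrightarrow> - \<Phi> x) (at_right (- c0))"
      using R.quot_tendsto_right[of "- x"] by simp
    then have "((\<lambda>c. - R.quot (- c0) (- c) (- x)) \<longlongrightarrow> \<Phi> x) (at_left c0)"
      unfolding at_left_minus[of c0] filterlim_filtermap using tendsto_minus by fastforce
    moreover have "- R.quot (- c0) (- c) (- x) = (U c x - U c0 x) / (c - c0)" for c
      unfolding R.quot_def by (simp add: minus_divide_right)
    ultimately show ?thesis by simp
  qed
  ultimately show ?thesis
    by (simp add: has_field_derivative_iff filterlim_split_at)
qed

lemma conjugacies_converge:
  assumes H: "\<And>c. degree_one (H c)" "\<And>c. H c 0 = 0" "\<And>c x. H c (G c x) = H c x + rho c"
    and "0 < e"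
  shows "\<forall>\<^sub>F c in at c0. \<forall>x. \<bar>H c x - \<Phi> x\<bar> < e"
  unfolding eventually_at_split
proof
  interpret R: periodic_leaf "\<lambda>c x. U (- c) (- x)" "\<lambda>c x. - \<eta> (- c) (- x)" "\<lambda>c x. - G (- c) (- x)"
    "\<lambda>c. \<alpha> (- c)" "- c0" q "- p" "\<lambda>x. \<kappa> (- x)" "\<lambda>x. - \<Phi> (- x)" J
    by (rule reflected_periodic)
  show "\<forall>\<^sub>F c in at_right c0. \<forall>x. \<bar>H c x - \<Phi> x\<bar> < e"
    using H by (intro conjugacies_converge_right always_eventually allI conjI) (use assms in auto)
  have rho: "R.rho c = - rho (- c)" for c
  proof -
    have "(\<lambda>n. ((\<lambda>x. - G (- c) (- x)) ^^ n) 0 / n) \<longlonglongrightarrow> - rho (- c)"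
      using tendsto_minus[OF rho_limit[of "- c"]] by (simp add: reflect_funpow)
    then show ?thesis using R.rho_limit LIMSEQ_unique by blast
  qed
  have "\<forall>\<^sub>F c in at_right (- c0). \<forall>x. \<bar>- H (- c) (- x) - - \<Phi> (- x)\<bar> < e"
  proof (rule R.conjugacies_converge_right[OF _ \<open>0 < e\<close>], intro always_eventually allI conjI)
    fix c x
    show "degree_one (\<lambda>x. - H (- c) (- x))"
      unfolding degree_one_def
    proof (intro conjI monoI allI)
      fix x y :: real
      show "x \<le> y \<Longrightarrow> - H (- c) (- x) \<le> - H (- c) (- y)" 
        using monoD[of "H (- c)" "- y" "- x"] H(1)[of "- c"] by (simp add: degree_one_def)
      show "- H (- c) (- (x + 1)) = - H (- c) (- x) + 1"
        using degree_one_shift_int[OF H(1), of "- c" "- x" "- 1"] by simp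
    qed
    show "- H (- c) (- 0) = 0" by (simp add: H)
    show "- H (- c) (- (- G (- c) (- x))) = - H (- c) (- x) + R.rho c" by (simp add: H rho)
  qed
  then have ev: "\<forall>\<^sub>F c in at_left c0. \<forall>x. \<bar>- H c (- x) - - \<Phi> (- x)\<bar> < e"
    unfolding at_left_minus[of c0] eventually_filtermap by simp
  show "\<forall>\<^sub>F c in at_left c0. \<forall>x. \<bar>H c x - \<Phi> x\<bar> < e"
    using ev
  proof eventually_elim
    case (elim c)
    have "\<bar>H c x - \<Phi> x\<bar> < e" for x using elim[rule_format, of "- x"] by (simp add: abs_minus_commute)
    then show ?case by blast
  qed
qed

end

text \<open>The shear along a leaf of periodic points, uniformly over the leaf and for each number of returns.\<close>

definition (in monotone_leaves) shear_rate :: "real \<Rightarrow> nat \<Rightarrow> int \<Rightarrow> (real \<Rightarrow> real) \<Rightarrow> bool" where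
  "shear_rate c q p \<tau> \<longleftrightarrow>
     continuous_on UNIV \<tau> \<and> (\<forall>x. 0 < \<tau> x) \<and> (\<forall>x. \<tau> (x + 1) = \<tau> x) \<and>
     (\<forall>N e. 0 < e \<longrightarrow> (\<forall>\<^sub>F d in at c. \<forall>x.
        \<bar>(G d ^^ (N * q)) x - x - of_int (N * p) - N * \<tau> x * (\<eta> d x - \<eta> c x)\<bar>
          \<le> e * \<bar>\<eta> d x - \<eta> c x\<bar>))"

lemma (in monotone_leaves) periodic_leafI:
  assumes "0 < q" "\<And>x. (G c ^^ q) x = x + of_int p" and rate: "shear_rate c q p \<tau>"
  obtains \<kappa> \<Phi> J where "periodic_leaf U \<eta> G \<alpha> c q p \<kappa> \<Phi> J"
proof -
  have \<tau>: "continuous_on UNIV \<tau>" "\<And>x. 0 < \<tau> x" "\<And>x. \<tau> (x + 1) = \<tau> x"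
    using rate by (auto simp: shear_rate_def)
  have shear: "\<forall>\<^sub>F d in at c. \<forall>x.
      \<bar>(G d ^^ (N * q)) x - x - of_int (N * p) - N * \<tau> x * (\<eta> d x - \<eta> c x)\<bar> \<le> e * \<bar>\<eta> d x - \<eta> c x\<bar>"
    if "0 < e" for N e
    using rate that by (simp add: shear_rate_def)
  \<comment> \<open>the density is proportional to the inverse square root of the shear; W is its primitive\<close>
  define w where "w x = 1 / sqrt (\<tau> x)" for x
  have w: "continuous_on UNIV w" "\<And>x. 0 < w x" "\<And>x. w (x + 1) = w x"
    unfolding w_def using \<tau> by (auto intro!: continuous_intros simp: less_imp_neq[symmetric])
  define W where "W x = integral {0..x} w - integral {x..0} w" for x
  have W: "(W has_real_derivative w x) (at x)" for x
    unfolding W_def by (rule continuous_antiderivative[OF w(1)])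
  have W0: "W 0 = 0" by (simp add: W_def)
  have "W 0 < W 1" by (rule DERIV_pos_imp_increasing) (use W w(2) in auto)
  then have I: "0 < W 1" using W0 by simp
  define \<kappa> \<Phi> where "\<kappa> x = w x / W 1" and "\<Phi> x = W x / W 1" for x
  have "periodic_leaf U \<eta> G \<alpha> c q p \<kappa> \<Phi> (1 / (W 1)\<^sup>2)"
  proof (intro periodic_leaf.intro monotone_leaves_axioms periodic_leaf_axioms.intro)
    show "0 < q" "(G c ^^ q) x = x + of_int p" for x by fact+
    show "continuous_on UNIV \<kappa>" unfolding \<kappa>_def using w I by (auto intro!: continuous_intros)
    show "0 < \<kappa> x" "\<kappa> (x + 1) = \<kappa> x" for x using w I by (auto simp: \<kappa>_def)
    show "(\<Phi> has_real_derivative \<kappa> x) (at x)" for x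
      unfolding \<Phi>_def \<kappa>_def using W I by (auto intro!: derivative_eq_intros)
    show "\<Phi> 0 = 0" "\<Phi> 1 = 1" "0 < 1 / (W 1)\<^sup>2" using W0 I by (auto simp: \<Phi>_def)
    have \<tau>\<kappa>: "1 / (W 1)\<^sup>2 / (\<kappa> x)\<^sup>2 = \<tau> x" for x
      using I \<tau>(2)[of x] by (simp add: \<kappa>_def w_def power_divide power_mult_distrib)
    show "\<forall>\<^sub>F d in at c. \<forall>x. \<bar>(G d ^^ (N * q)) x - x - of_int (N * p)
        - N * (1 / (W 1)\<^sup>2 / (\<kappa> x)\<^sup>2) * (\<eta> d x - \<eta> c x)\<bar> \<le> e * \<bar>\<eta> d x - \<eta> c x\<bar>" if "0 < e" for N e
      unfolding \<tau>\<kappa> by (rule shear[OF that])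
  qed
  then show ?thesis by (rule that)
qed

text \<open>The derivative in the parameter conjugates: it is the limit of the action inequalities from
  both sides.\<close>

text \<open>On the difference quotients from the right the dynamics of the leaf \<open>c\<close> satisfies one of the action
  inequalities, on those from the left the other one. In the limit they combine to the conjugacy
  equation.\<close>

lemma (in monotone_leaves) param_deriv_properties:
  assumes D: "\<And>c x. ((\<lambda>c. U c x) has_real_derivative D c x) (at c)"
  shows "degree_one (D c)" "D c 0 = 0" "D c (G c x) = D c x + rho c"
proof -
  have q: "((\<lambda>d. quot c d x) \<longlongrightarrow> D c x) (at c)" for c x
    using D[of x c] by (simp add: has_field_derivative_iff quot_def)
  have qr: "((\<lambda>d. quot c d x) \<longlongrightarrow> D c x) (at_right c)" "((\<lambda>d. quot c d x) \<longlongrightarrow> D c x) (at_left c)" for c x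
    using q[of c x] by (simp_all add: filterlim_at_split)
  have "((\<lambda>d. slope c d) \<longlongrightarrow> rho c) (at c)"
  proof (rule tendstoI)
    fix e :: real assume "0 < e"
    then obtain r where r: "0 < r" "\<And>a b. a < b \<Longrightarrow> \<bar>a - c\<bar> < r \<Longrightarrow> \<bar>b - c\<bar> < r \<Longrightarrow> \<bar>slope a b - rho c\<bar> < e"
      using slope_near_rho by metis
    have "dist (slope c d) (rho c) < e" if "d \<noteq> c" "dist d c < r" for d
      using r(2)[of c d] r(2)[of d c] that r(1) slope_sym[of d c]
      by (cases "c < d") (simp_all add: dist_real_def)
    then show "\<forall>\<^sub>F d in at c. dist (slope c d) (rho c) < e"
      unfolding eventually_at using r(1) by blast
  qed
  then have sl: "((\<lambda>d. slope c d) \<longlongrightarrow> rho c) (at_right c)" "((\<lambda>d. slope c d) \<longlongrightarrow> rho c) (at_left c)"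
    by (simp_all add: filterlim_at_split)
  have right: "\<forall>\<^sub>F d in at_right c. c < d" by (rule eventually_at_right_less)
  have left: "\<forall>\<^sub>F d in at_left c. d < c" 
    using eventually_at_left_real[of "c - 1" c] by (auto elim!: eventually_mono)
  show "D c 0 = 0"
    by (rule tendsto_unique[OF trivial_limit_at_right_real qr(1)[of c 0, unfolded quot_0] tendsto_const])
  show "degree_one (D c)"
    unfolding degree_one_def
  proof (intro conjI monoI allI)
    fix x y :: real assume "x \<le> y"
    then show "D c x \<le> D c y"
      by (intro tendsto_le[OF trivial_limit_at_right_real qr(1) qr(1)] eventually_mono[OF right] quot_le)
  next
    fix x
    have "\<forall>\<^sub>F d in at_right c. quot c d (x + 1) = quot c d x + 1"
      using right
    proof eventually_elim
      case (elim d)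
      then show ?case using quot_degree_one[OF elim] by (simp add: degree_one_def)
    qed
    then have "((\<lambda>d. quot c d x + 1) \<longlongrightarrow> D c (x + 1)) (at_right c)"
      by (rule Lim_transform_eventually[OF qr(1)])
    moreover have "((\<lambda>d. quot c d x + 1) \<longlongrightarrow> D c x + 1) (at_right c)"
      by (intro tendsto_intros qr)
    ultimately show "D c (x + 1) = D c x + 1" by (rule tendsto_unique[OF trivial_limit_at_right_real])
  qed
  show "D c (G c x) = D c x + rho c"
  proof (rule antisym)
    show "D c (G c x) \<le> D c x + rho c"
    proof (rule tendsto_le)
      show "((\<lambda>d. quot c d (G c x)) \<longlongrightarrow> D c (G c x)) (at_right c)" by (rule qr)
      show "((\<lambda>d. quot c d x + slope c d) \<longlongrightarrow> D c x + rho c) (at_right c)" by (intro tendsto_intros qr sl)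
      show "\<forall>\<^sub>F d in at_right c. quot c d (G c x) \<le> quot c d x + slope c d"
        using right
      proof eventually_elim
        case (elim d)
        then show ?case using quot_iter_upper[OF elim, of 1 x] by simp
      qed
    qed simp
    show "D c x + rho c \<le> D c (G c x)"
    proof (rule tendsto_le)
      show "((\<lambda>d. quot c d (G c x)) \<longlongrightarrow> D c (G c x)) (at_left c)" by (rule qr)
      show "((\<lambda>d. quot c d x + slope c d) \<longlongrightarrow> D c x + rho c) (at_left c)" by (intro tendsto_intros qr sl)
      show "\<forall>\<^sub>F d in at_left c. quot c d x + slope c d \<le> quot c d (G c x)"
        using left
      proof eventually_elim
        case (elim d)
        have "quot d c y = quot c d y" for y by (rule quot_sym)
        moreover have "slope d c = slope c d" by (rule slope_sym)
        ultimately show ?case using quot_iter_lower[OF elim, of x 1] by simp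
      qed
    qed simp
  qed
qed

text \<open>At irrational leaves existence and continuity both come from strict differentiability. At rational
  leaves existence comes from the density of the neighbouring leaves, and continuity from the
  convergence of the conjugacies.\<close>

theorem (in monotone_leaves) leaf_conjugacies:
  assumes shear: "\<And>c q p. 0 < q \<Longrightarrow> (\<And>x. (G c ^^ q) x = x + of_int p) \<Longrightarrow>
    \<exists>\<tau>. shear_rate c q p \<tau>"
  obtains D where "\<And>c x. ((\<lambda>c. U c x) has_real_derivative D c x) (at c)"
    and "continuous_on UNIV (\<lambda>(c, x). D c x)"
    and "\<And>c. degree_one (D c)" and "\<And>c x. D c (G c x) = D c x + rho c"
proof -
  have leaf: "\<exists>q p \<kappa> \<Phi> J. periodic_leaf U \<eta> G \<alpha> c q p \<kappa> \<Phi> J" if "rho c \<in> \<rat>" for c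
  proof -
    have "rho c \<in> {of_int i / of_nat n | i n. n \<noteq> 0}"
      using that unfolding Rats_eq_int_div_nat .
    then obtain a :: int and b :: nat where ab: "b \<noteq> 0" "rho c = of_int a / of_nat b"
      by (elim CollectE exE conjE)
    then have q: "0 < b" "b * rho c = of_int a" by auto
    have per: "(G c ^^ b) x = x + of_int a" for x by (rule rational_leaf_periodic[OF q])
    obtain \<tau> where "shear_rate c b a \<tau>"
      by (rule exE[OF shear[where c = c and q = b and p = a, OF q(1) per]])
    then obtain \<kappa> \<Phi> J where "periodic_leaf U \<eta> G \<alpha> c b a \<kappa> \<Phi> J"
      by (rule periodic_leafI[OF q(1) per])
    then show ?thesis by blast
  qed
  have "\<exists>h. ((\<lambda>c. U c x) has_real_derivative h) (at c)" for c x
  proof (cases "rho c \<in> \<rat>")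
    case True
    then obtain q p \<kappa> \<Phi> J where "periodic_leaf U \<eta> G \<alpha> c q p \<kappa> \<Phi> J" using leaf by blast
    then show ?thesis using periodic_leaf.U_param_deriv by blast
  next
    case False
    then show ?thesis using irrational_strict_param_deriv strict_param_deriv_imp_deriv by metis
  qed
  then obtain D where D: "\<And>c x. ((\<lambda>c. U c x) has_real_derivative D c x) (at c)" by metis
  note D' = param_deriv_properties[OF D]
  have near: "\<exists>d>0. \<forall>c x. \<bar>c - c0\<bar> < d \<longrightarrow> \<bar>x - x0\<bar> < d \<longrightarrow> \<bar>D c x - D c0 x0\<bar> < e"
    if e: "0 < e" for c0 x0 e
  proof (cases "rho c0 \<in> \<rat>")
    case True
    then obtain q p \<kappa> \<Phi> J where pl: "periodic_leaf U \<eta> G \<alpha> c0 q p \<kappa> \<Phi> J" using leaf by blast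
    interpret periodic_leaf U \<eta> G \<alpha> c0 q p \<kappa> \<Phi> J by (rule pl)
    have D0: "D c0 x = \<Phi> x" for x using DERIV_unique[OF D U_param_deriv] .
    have "\<forall>\<^sub>F c in at c0. \<forall>x. \<bar>D c x - \<Phi> x\<bar> < e / 2"
      using e by (intro conjugacies_converge D') simp
    then obtain d1 where d1: "0 < d1" "\<And>c x. c \<noteq> c0 \<Longrightarrow> dist c c0 < d1 \<Longrightarrow> \<bar>D c x - \<Phi> x\<bar> < e / 2"
      unfolding eventually_at by blast
    have "isCont \<Phi> x0" using \<Phi>_deriv DERIV_isCont by blast
    then obtain d2 where d2: "0 < d2" "\<And>x. dist x x0 < d2 \<Longrightarrow> dist (\<Phi> x) (\<Phi> x0) < e / 2"
      unfolding continuous_at_eps_delta using e half_gt_zero by metis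
    have "\<bar>D c x - D c0 x0\<bar> < e" if "\<bar>c - c0\<bar> < min d1 d2" "\<bar>x - x0\<bar> < min d1 d2" for c x
    proof -
      have "\<bar>D c x - \<Phi> x\<bar> < e / 2" "\<bar>\<Phi> x - \<Phi> x0\<bar> < e / 2"
        using d1(2)[of c x] d2(2)[of x] that e D0 by (cases "c = c0"; simp add: dist_real_def)+
      then show ?thesis unfolding D0 by linarith
    qed
    then show ?thesis using d1(1) d2(1) by (intro exI[of _ "min d1 d2"]) simp
  next
    case False
    then obtain h where "strict_param_deriv c0 x0 h" using irrational_strict_param_deriv by blast
    from strict_param_deriv_imp_continuous[OF this D e] show ?thesis by metis
  qed
  have "isCont (\<lambda>(c, x). D c x) (c0, x0)" for c0 x0
    unfolding continuous_at_eps_delta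
  proof (intro allI impI)
    fix e :: real assume "0 < e"
    then obtain d where d: "0 < d" "\<And>c x. \<bar>c - c0\<bar> < d \<Longrightarrow> \<bar>x - x0\<bar> < d \<Longrightarrow> \<bar>D c x - D c0 x0\<bar> < e"
      using near by blast
    have "\<bar>D c x - D c0 x0\<bar> < e" if "dist (c, x) (c0, x0) < d" for c x
      using that dist_fst_le[of "(c, x)" "(c0, x0)"] dist_snd_le[of "(c, x)" "(c0, x0)"]
      by (intro d(2)) (auto simp: dist_real_def)
    then show "\<exists>d>0. \<forall>z. dist z (c0, x0) < d \<longrightarrow>
        dist (case z of (c, x) \<Rightarrow> D c x) (case (c0, x0) of (c, x) \<Rightarrow> D c x) < e"
      using d(1) by (intro exI[of _ d]) (auto simp: dist_real_def)
  qed
  then have "continuous_on UNIV (\<lambda>(c, x). D c x)"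
    by (simp add: continuous_on_eq_continuous_at split_paired_all)
  then show ?thesis using that D D' by blast
qed

section \<open>The action of a lifted twist map along its invariant graphs\<close>

definition wedge :: "real \<times> real \<Rightarrow> real \<times> real \<Rightarrow> real" where
  "wedge v w = fst v * snd w - snd v * fst w"

text \<open>The lift satisfies \<open>F (x + 1, r) = F (x, r) + (k, 0)\<close>, where \<open>k\<close> is the degree. The
  invariant leaves force \<open>k = 1\<close> (\<open>degree_eq_1\<close>).\<close>

locale lifted_twist =
  fixes F :: "real \<times> real \<Rightarrow> real \<times> real" and F' :: "real \<times> real \<Rightarrow> (real \<times> real) \<Rightarrow>\<^sub>L (real \<times> real)"
    and \<eta> U :: "real \<Rightarrow> real \<Rightarrow> real" and k :: real
  assumes F_deriv: "\<And>z. (F has_derivative blinfun_apply (F' z)) (at z)"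
    and F'_cont: "continuous_on UNIV F'"
    and wedge_F': "\<And>z v w. wedge (F' z v) (F' z w) = wedge v w"
    and twist_mono: "\<And>x. strict_mono (\<lambda>r. fst (F (x, r)))"
    and twist_surj: "\<And>x y. \<exists>r. fst (F (x, r)) = y"
    and twist_deriv: "\<And>z. 0 < fst (F' z (0, 1))"
    and F_shift: "\<And>x r. F (x + 1, r) = F (x, r) + (k, 0)"
    and degree: "k = 1 \<or> k = - 1"
    and F_inj: "inj F"
    and \<eta>_cont: "continuous_on UNIV (\<lambda>(c, x). \<eta> c x)"
    and \<eta>_periodic: "\<And>c x. \<eta> c (x + 1) = \<eta> c x"
    and \<eta>_less: "\<And>c d x. c < d \<Longrightarrow> \<eta> c x < \<eta> d x"
    and \<eta>_surj: "\<And>x r. \<exists>c. \<eta> c x = r"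
    and U_deriv: "\<And>c x. (U c has_real_derivative \<eta> c x) (at x)"
    and U_0: "\<And>c. U c 0 = 0"
    and U_1: "\<And>c. U c 1 = c"
    and leaf_invariant: "\<And>c x. snd (F (x, \<eta> c x)) = \<eta> c (fst (F (x, \<eta> c x)))"
begin

definition G :: "real \<Rightarrow> real \<Rightarrow> real" where "G c x = fst (F (x, \<eta> c x))"

lemma F_leaf: "F (x, \<eta> c x) = (G c x, \<eta> c (G c x))"
  using leaf_invariant[of x c] by (simp add: G_def prod_eq_iff)

lemma F_cont: "continuous_on UNIV F"
  by (intro continuous_at_imp_continuous_on ballI has_derivative_continuous[OF F_deriv])

lemma \<eta>_comp:
  assumes "continuous_on S f" "continuous_on S g"
  shows "continuous_on S (\<lambda>z. \<eta> (f z) (g z))"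
  using continuous_on_compose2[OF \<eta>_cont continuous_on_Pair[OF assms]] by simp

lemma F_comp:
  assumes "continuous_on S f"
  shows "continuous_on S (\<lambda>z. F (f z))"
  using continuous_on_compose2[OF F_cont assms] by simp

lemma G_comp:
  assumes "continuous_on S f" "continuous_on S g"
  shows "continuous_on S (\<lambda>z. G (f z) (g z))"
  unfolding G_def by (intro continuous_on_fst F_comp continuous_on_Pair \<eta>_comp assms)

lemma G_cont: "continuous_on UNIV (\<lambda>(c, x). G c x)"
  unfolding case_prod_unfold by (intro G_comp continuous_intros)

lemma G_less: "c < d \<Longrightarrow> G c x < G d x"
  unfolding G_def using strict_monoD[OF twist_mono] \<eta>_less by blast

lemma G_shift: "G c (x + 1) = G c x + k"
  by (simp add: G_def \<eta>_periodic F_shift)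

lemma \<eta>_le: "c \<le> d \<Longrightarrow> \<eta> c x \<le> \<eta> d x"
  using \<eta>_less[of c d x] by (cases "c = d") auto

lemma below_leaf:
  assumes "r < \<eta> c x" shows "snd (F (x, r)) < \<eta> c (fst (F (x, r)))"
proof -
  obtain d where d: "\<eta> d x = r" using \<eta>_surj by blast
  then have "d < c" using assms \<eta>_le[of c d x] by (meson not_le)
  then show ?thesis using leaf_invariant[of x d] \<eta>_less[of d c] by (simp add: d)
qed

lemma above_leaf:
  assumes "\<eta> c x < r" shows "\<eta> c (fst (F (x, r))) < snd (F (x, r))"
proof -
  obtain d where d: "\<eta> d x = r" using \<eta>_surj by blast
  then have "c < d" using assms \<eta>_le[of d c x] by (meson not_le)
  then show ?thesis using leaf_invariant[of x d] \<eta>_less[of c d] by (simp add: d)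
qed

text \<open>By the twist property the pairs of abscissas \<open>(x, y)\<close> of a point and of its image are coordinates of
  the plane. In these coordinates \<open>rad\<close> is the ordinate of the point and \<open>R\<close> that of its image.\<close>

definition rad :: "real \<Rightarrow> real \<Rightarrow> real" where
  "rad x y = (THE r. fst (F (x, r)) = y)"

definition R :: "real \<Rightarrow> real \<Rightarrow> real" where
  "R x y = snd (F (x, rad x y))"

definition slant :: "real \<times> real \<Rightarrow> real" where
  "slant z = fst (F' z (0, 1))"

lemma rad_eqI: "fst (F (x, r)) = y \<Longrightarrow> rad x y = r"
  unfolding rad_def using strict_mono_eq[OF twist_mono] by (intro the_equality) auto

lemma F_rad: "fst (F (x, rad x y)) = y"
  using twist_surj[of x y] rad_eqI by auto

lemma rad_less_iff: "rad x y < r \<longleftrightarrow> y < fst (F (x, r))"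
  using strict_mono_less[OF twist_mono[of x], of "rad x y" r] by (simp add: F_rad)

lemma less_rad_iff: "r < rad x y \<longleftrightarrow> fst (F (x, r)) < y"
  using strict_mono_less[OF twist_mono[of x], of r "rad x y"] by (simp add: F_rad)

lemma rad_cont: "continuous_on UNIV (\<lambda>(x, y). rad x y)"
proof -
  have "isCont (\<lambda>z. rad (fst z) (snd z)) z0" for z0
    unfolding isCont_def
  proof (rule order_tendstoI)
    fix r assume "r < rad (fst z0) (snd z0)"
    then have "0 < snd z0 - fst (F (fst z0, r))" by (simp add: less_rad_iff)
    moreover have "continuous_on UNIV (\<lambda>z. snd z - fst (F (fst z, r)))"
      by (intro continuous_intros F_comp)
    then have "((\<lambda>z. snd z - fst (F (fst z, r))) \<longlongrightarrow> snd z0 - fst (F (fst z0, r))) (at z0)"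
      using continuous_on_interior[of UNIV _ z0] by (simp add: isCont_def)
    ultimately have "\<forall>\<^sub>F z in at z0. 0 < snd z - fst (F (fst z, r))" by (rule order_tendstoD(1)[rotated])
    then show "\<forall>\<^sub>F z in at z0. r < rad (fst z) (snd z)"
      by (rule eventually_mono) (simp add: less_rad_iff)
  next
    fix r assume "rad (fst z0) (snd z0) < r"
    then have "0 < fst (F (fst z0, r)) - snd z0" by (simp add: rad_less_iff)
    moreover have "continuous_on UNIV (\<lambda>z. fst (F (fst z, r)) - snd z)"
      by (intro continuous_intros F_comp)
    then have "((\<lambda>z. fst (F (fst z, r)) - snd z) \<longlongrightarrow> fst (F (fst z0, r)) - snd z0) (at z0)"
      using continuous_on_interior[of UNIV _ z0] by (simp add: isCont_def)
    ultimately have "\<forall>\<^sub>F z in at z0. 0 < fst (F (fst z, r)) - snd z" by (rule order_tendstoD(1)[rotated])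
    then show "\<forall>\<^sub>F z in at z0. rad (fst z) (snd z) < r"
      by (rule eventually_mono) (simp add: rad_less_iff)
  qed
  then show ?thesis
    by (simp add: case_prod_unfold continuous_at_imp_continuous_on)
qed

lemma rad_comp:
  assumes "continuous_on S f" "continuous_on S g"
  shows "continuous_on S (\<lambda>z. rad (f z) (g z))"
  using continuous_on_compose2[OF rad_cont continuous_on_Pair[OF assms]] by simp

lemma R_comp:
  assumes "continuous_on S f" "continuous_on S g"
  shows "continuous_on S (\<lambda>z. R (f z) (g z))"
  unfolding R_def by (intro continuous_on_snd F_comp continuous_on_Pair rad_comp assms)

lemma slant_comp:
  assumes "continuous_on S f"
  shows "continuous_on S (\<lambda>z. slant (f z))"
  unfolding slant_def
  by (intro continuous_on_fst blinfun.continuous_on continuous_on_compose2[OF F'_cont assms] continuous_on_const) auto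

text \<open>The coordinate change \<open>(x, r) \<mapsto> (x, y)\<close> is triangular with diagonal entries 1 and \<open>slant\<close>; here
  \<open>a\<close> is the remaining entry.\<close>

lemma chart_inverse_deriv:
  defines "a \<equiv> \<lambda>z. fst (F' z (1, 0))"
  shows "((\<lambda>z. (fst z, rad (fst z) (snd z))) has_derivative
    (\<lambda>v. (fst v, (snd v - a (x, rad x y) * fst v) / slant (x, rad x y)))) (at (x, y))"
proof -
  let ?z = "(x, rad x y)"
  have split: "fst (F' z v) = a z * fst v + slant z * snd v" for z v
  proof -
    have "F' z v = F' z (fst v *\<^sub>R (1, 0) + snd v *\<^sub>R (0, 1))" by simp
    then have "F' z v = fst v *\<^sub>R F' z (1, 0) + snd v *\<^sub>R F' z (0, 1)"
      by (simp only: blinfun.add_right blinfun.scaleR_right)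
    then show ?thesis by (simp add: a_def slant_def)
  qed
  show ?thesis
  proof (rule has_derivative_inverse_basic[where f = "\<lambda>z. (fst z, fst (F z))" and T = UNIV])
    show "((\<lambda>z. (fst z, fst (F z))) has_derivative (\<lambda>v. (fst v, fst (F' ?z v))))
        (at (fst (x, y), rad (fst (x, y)) (snd (x, y))))"
      using F_deriv[of ?z] by (auto intro!: has_derivative_Pair has_derivative_fst has_derivative_ident)
    show "bounded_linear (\<lambda>v. (fst v, (snd v - a ?z * fst v) / slant ?z))"
      by (intro bounded_linear_Pair bounded_linear_fst bounded_linear_compose[OF bounded_linear_divide]
          bounded_linear_sub bounded_linear_snd bounded_linear_const_mult)
    show "(\<lambda>v. (fst v, (snd v - a ?z * fst v) / slant ?z)) \<circ> (\<lambda>v. (fst v, fst (F' ?z v))) = id"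
    proof -
      have "slant ?z \<noteq> 0" using twist_deriv[of ?z] by (simp add: slant_def)
      then show ?thesis by (simp add: fun_eq_iff split)
    qed
    have "continuous_on UNIV (\<lambda>z. (fst z, rad (fst z) (snd z)))"
      by (intro continuous_intros rad_comp)
    then show "isCont (\<lambda>z. (fst z, rad (fst z) (snd z))) (x, y)"
      by (rule continuous_on_interior) simp
    show "(fst (fst z, rad (fst z) (snd z)), fst (F (fst z, rad (fst z) (snd z)))) = z" for z
      by (simp add: F_rad)
  qed auto
qed

lemma rad_deriv: "((\<lambda>y. rad x y) has_real_derivative 1 / slant (x, rad x y)) (at y)"
proof -
  have "((\<lambda>y. (x, y)) has_derivative (\<lambda>h. (0, h))) (at y)"
    by (auto intro!: derivative_eq_intros)
  from has_derivative_compose[OF this chart_inverse_deriv]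
  have "((\<lambda>y. (x, rad x y)) has_derivative (\<lambda>h. (0, h / slant (x, rad x y)))) (at y)" by simp
  from has_derivative_snd[OF this]
  have "((\<lambda>y. rad x y) has_derivative (\<lambda>h. h / slant (x, rad x y))) (at y)" by simp
  then show ?thesis
    unfolding has_field_derivative_def by (rule has_derivative_eq_rhs) (simp add: fun_eq_iff)
qed

text \<open>Along \<open>y = const\<close> the image moves vertically, so preservation of area determines its velocity
  from \<open>slant\<close>. Compared with \<open>rad_deriv\<close> this says that the form \<open>R dy - rad dx\<close> is closed.\<close>

lemma R_deriv: "((\<lambda>x. R x y) has_real_derivative - (1 / slant (x, rad x y))) (at x)"
proof -
  define a where "a = fst (F' (x, rad x y) (1, 0))"
  let ?z = "(x, rad x y)"
  have "((\<lambda>x. (x, y)) has_derivative (\<lambda>h. (h, 0))) (at x)"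
    by (auto intro!: derivative_eq_intros)
  from has_derivative_compose[OF this chart_inverse_deriv]
  have "((\<lambda>x. (x, rad x y)) has_derivative (\<lambda>h. (h, - (a * h) / slant ?z))) (at x)" by (simp add: a_def)
  from has_derivative_compose[OF this F_deriv]
  have "((\<lambda>x. F (x, rad x y)) has_derivative (\<lambda>h. F' ?z (h, - (a * h) / slant ?z))) (at x)" .
  from has_derivative_snd[OF this]
  have 1: "((\<lambda>x. R x y) has_derivative (\<lambda>h. snd (F' ?z (h, - (a * h) / slant ?z)))) (at x)"
    by (simp add: R_def)
  have "snd (F' ?z (h, - (a * h) / slant ?z)) = h * (- (1 / slant ?z))" for h
  proof -
    define v where "v = (h, - (a * h) / slant ?z)"
    have s: "0 < slant ?z" using twist_deriv by (simp add: slant_def)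
    have "v = h *\<^sub>R (1, 0) + (- (a * h) / slant ?z) *\<^sub>R (0, 1)" by (simp add: v_def)
    then have "F' ?z v = h *\<^sub>R F' ?z (1, 0) + (- (a * h) / slant ?z) *\<^sub>R F' ?z (0, 1)"
      by (simp only: blinfun.add_right blinfun.scaleR_right)
    then have "fst (F' ?z v) = h * a + (- (a * h) / slant ?z) * slant ?z" by (simp add: a_def slant_def)
    then have "fst (F' ?z v) = 0" using s by simp
    moreover have "wedge (F' ?z (0, 1)) (F' ?z v) = - h" by (simp add: wedge_F') (simp add: wedge_def v_def)
    ultimately have "slant ?z * snd (F' ?z v) = - h" by (simp add: wedge_def slant_def)
    then show ?thesis using s by (simp add: v_def field_simps)
  qed
  then show ?thesis
    unfolding has_field_derivative_def
    by (intro has_derivative_eq_rhs[OF 1]) (simp add: fun_eq_iff mult.commute)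
qed

text \<open>The generating function of the lift: a primitive of \<open>R dy - rad dx\<close>, integrated from the origin
  along the horizontal axis and then vertically.\<close>

definition S :: "real \<Rightarrow> real \<Rightarrow> real" where
  "S x y = (integral {0..y} (R x) - integral {y..0} (R x))
     - (integral {0..x} (\<lambda>t. rad t 0) - integral {x..0} (\<lambda>t. rad t 0))"

lemma S_deriv_y: "((\<lambda>y. S x y) has_real_derivative R x y) (at y)"
proof -
  have "continuous_on UNIV (R x)" by (intro R_comp continuous_intros)
  from continuous_antiderivative[OF this, of 0 y] show ?thesis
    unfolding S_def by (rule DERIV_cong[OF DERIV_diff[OF _ DERIV_const]]) simp
qed

lemma integral_R_deriv:
  assumes "a \<le> b"
  shows "((\<lambda>x. integral {a..b} (R x)) has_real_derivative - (rad x b - rad x a)) (at x)"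
proof -
  have 1: "((\<lambda>x. integral (cbox a b) (R x)) has_field_derivative
      integral (cbox a b) (\<lambda>t. - (1 / slant (x, rad x t)))) (at x within UNIV)"
  proof (rule leibniz_rule_field_derivative)
    show "((\<lambda>x. R x t) has_real_derivative - (1 / slant (x, rad x t))) (at x within UNIV)" for x t
      using R_deriv by simp
    show "R x integrable_on cbox a b" for x
      by (intro integrable_continuous R_comp continuous_intros)
    have "slant z \<noteq> 0" for z using twist_deriv[of z] by (simp add: slant_def)
    then show "continuous_on (UNIV \<times> cbox a b) (\<lambda>(x, t). - (1 / slant (x, rad x t)))"
      unfolding case_prod_unfold by (intro continuous_intros slant_comp rad_comp) auto
  qed auto
  have 2: "((\<lambda>t. - (1 / slant (x, rad x t))) has_integral (- rad x b - - rad x a)) {a..b}"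
    by (intro fundamental_theorem_of_calculus[OF assms]
        has_field_derivative_at_within[OF DERIV_minus[OF rad_deriv],
          unfolded has_real_derivative_iff_has_vector_derivative])
  have "integral (cbox a b) (\<lambda>t. - (1 / slant (x, rad x t))) = - rad x b - - rad x a"
    unfolding cbox_interval by (rule integral_unique[OF 2])
  also have "\<dots> = - (rad x b - rad x a)" by simp
  finally show ?thesis using 1 by (simp only: cbox_interval)
qed

lemma S_deriv_x: "((\<lambda>x. S x y) has_real_derivative - rad x y) (at x)"
proof -
  have "((\<lambda>x. integral {0..y} (R x) - integral {y..0} (R x)) has_real_derivative - (rad x y - rad x 0)) (at x)"
  proof (cases "0 \<le> y")
    case True
    then have "integral {y..0} (R x) = 0" for x by (cases "y = 0") auto
    then show ?thesis using integral_R_deriv[OF True, of x] by simp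
  next
    case False
    then have "y \<le> 0" "integral {0..y} (R x) = 0" for x by auto
    then show ?thesis 
      using DERIV_diff[OF DERIV_const integral_R_deriv[of y 0 x], of 0] by simp
  qed
  moreover have "continuous_on UNIV (\<lambda>t. rad t 0)" by (intro rad_comp continuous_intros)
  from continuous_antiderivative[OF this, of 0 x]
  have "((\<lambda>x. integral {0..x} (\<lambda>t. rad t 0) - integral {x..0} (\<lambda>t. rad t 0)) has_real_derivative rad x 0) (at x)" .
  ultimately show ?thesis
    unfolding S_def by (rule DERIV_cong[OF DERIV_diff]) simp
qed

text \<open>The defect of \<open>U c\<close> as a subsolution of the discrete Hamilton-Jacobi equation. Its critical points
  are the pairs \<open>(x, G c x)\<close>.\<close>

definition \<phi> :: "real \<Rightarrow> real \<Rightarrow> real \<Rightarrow> real" where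
  "\<phi> c x y = U c y - U c x - S x y"

lemma \<phi>_deriv_y: "((\<lambda>y. \<phi> c x y) has_real_derivative \<eta> c y - R x y) (at y)"
  unfolding \<phi>_def by (rule DERIV_cong[OF DERIV_diff[OF DERIV_diff[OF U_deriv DERIV_const] S_deriv_y]]) simp

lemma \<phi>_deriv_x: "((\<lambda>x. \<phi> c x y) has_real_derivative rad x y - \<eta> c x) (at x)"
  unfolding \<phi>_def by (rule DERIV_cong[OF DERIV_diff[OF DERIV_diff[OF DERIV_const U_deriv] S_deriv_x]]) simp

text \<open>A point whose abscissa \<open>y\<close> is smaller than \<open>G c x\<close> comes from below the leaf, hence lies
  below the leaf, so \<open>R x y < \<eta> c y\<close> and \<open>\<phi>\<close> increases in \<open>y\<close>; beyond \<open>G c x\<close> it decreases.\<close>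

lemma \<phi>_max: "\<phi> c x y \<le> \<phi> c x (G c x)"
proof (cases "y \<le> G c x")
  case True
  then show ?thesis
  proof (rule DERIV_nonneg_imp_nondecreasing)
    fix t assume "y \<le> t" "t \<le> G c x"
    then have "rad x t \<le> \<eta> c x" using less_rad_iff[of "\<eta> c x" x t] by (simp add: G_def not_less[symmetric])
    then have "R x t \<le> \<eta> c t"
      using below_leaf[of "rad x t" c x] leaf_invariant[of x c] F_rad[of x t] unfolding R_def
      by (metis less_eq_real_def)
    then show "\<exists>w. ((\<lambda>y. \<phi> c x y) has_real_derivative w) (at t) \<and> 0 \<le> w"
      using \<phi>_deriv_y by (intro exI conjI) auto
  qed
next
  case False
  then have "G c x \<le> y" by simp
  then show ?thesis
  proof (rule DERIV_nonpos_imp_nonincreasing)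
    fix t assume "G c x \<le> t" "t \<le> y"
    then have "\<eta> c x \<le> rad x t" using rad_less_iff[of x t "\<eta> c x"] by (simp add: G_def not_less[symmetric])
    then have "\<eta> c t \<le> R x t"
      using above_leaf[of c x "rad x t"] leaf_invariant[of x c] F_rad[of x t] unfolding R_def
      by (metis less_eq_real_def)
    then show "\<exists>w. ((\<lambda>y. \<phi> c x y) has_real_derivative w) (at t) \<and> w \<le> 0"
      using \<phi>_deriv_y by (intro exI conjI) auto
  qed
qed

definition \<alpha> :: "real \<Rightarrow> real" where "\<alpha> c = \<phi> c 0 (G c 0)"

lemma rad_G: "rad x (G c x) = \<eta> c x"
  by (rule rad_eqI) (simp add: G_def)

text \<open>The maximal value has derivative 0 in \<open>x\<close>. Indeed \<open>G c\<close> is only continuous, but the maximum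
  property permits to compare two points \<open>x\<close>, \<open>y\<close> with the same second argument of \<open>\<phi>\<close>, either
  \<open>G c x\<close> or \<open>G c y\<close>, and the derivative of \<open>\<phi>\<close> in the first argument is small near the leaf.\<close>

lemma action_constant: "\<phi> c x (G c x) = \<alpha> c"
proof -
  define M where "M x = \<phi> c x (G c x)" for x
  have "(M has_real_derivative 0) (at x)" for x
  proof -
    have "continuous_on UNIV (\<lambda>z. rad (fst z) (G c (snd z)) - \<eta> c (fst z))"
      by (intro continuous_intros rad_comp G_comp \<eta>_comp)
    then have cont: "isCont (\<lambda>z. rad (fst z) (G c (snd z)) - \<eta> c (fst z)) (x, x)"
      by (rule continuous_on_interior) simp
    have lim: "((\<lambda>y. (M y - M x) / (y - x)) \<longlongrightarrow> 0) (at x)"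
    proof (rule tendstoI)
      fix e' :: real assume "0 < e'"
      define e where "e = e' / 2"
      have e: "0 < e" "e < e'" using \<open>0 < e'\<close> by (auto simp: e_def)
      then obtain d where d: "0 < d" "\<And>z. dist z (x, x) < d \<Longrightarrow>
          dist (rad (fst z) (G c (snd z)) - \<eta> c (fst z)) (rad x (G c x) - \<eta> c x) < e"
        using cont unfolding continuous_at_eps_delta by fastforce
      have small: "\<bar>rad s (G c t) - \<eta> c s\<bar> < e" if "\<bar>s - x\<bar> < d / 2" "\<bar>t - x\<bar> < d / 2" for s t
      proof -
        have "dist (s, t) (x, x) \<le> \<bar>s - x\<bar> + \<bar>t - x\<bar>"
          unfolding dist_Pair_Pair dist_real_def using sqrt_sum_squares_le_sum_abs[of "\<bar>s - x\<bar>" "\<bar>t - x\<bar>"] by simp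
        then have "dist (s, t) (x, x) < d" using that by linarith
        from d(2)[OF this] show ?thesis by (simp add: rad_G dist_real_def)
      qed
      have var: "\<bar>\<phi> c s (G c t) - \<phi> c s' (G c t)\<bar> \<le> e * \<bar>s - s'\<bar>"
        if "\<bar>s - x\<bar> < d / 2" "\<bar>s' - x\<bar> < d / 2" "\<bar>t - x\<bar> < d / 2" for s s' t
      proof -
        have "norm (\<phi> c s (G c t) - \<phi> c s' (G c t)) \<le> e * norm (s - s')"
        proof (rule field_differentiable_bound[where S = "ball x (d / 2)"])
          show "((\<lambda>s. \<phi> c s (G c t)) has_field_derivative rad z (G c t) - \<eta> c z) (at z within ball x (d / 2))" for z
            by (rule has_field_derivative_at_within[OF \<phi>_deriv_x])
          show "norm (rad z (G c t) - \<eta> c z) \<le> e" if "z \<in> ball x (d / 2)" for z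
            using small[of z t] \<open>\<bar>t - x\<bar> < d / 2\<close> that by (simp add: dist_real_def abs_minus_commute)
        qed (use that in \<open>auto simp: dist_real_def abs_minus_commute\<close>)
        then show ?thesis by simp
      qed
      have bound: "\<bar>(M y - M x) / (y - x)\<bar> \<le> e" if "y \<noteq> x" "\<bar>y - x\<bar> < d / 2" for y
      proof -
        have d0: "\<bar>x - x\<bar> < d / 2" using d(1) by simp
        have "M y - M x \<le> \<phi> c y (G c y) - \<phi> c x (G c y)" using \<phi>_max[of c x "G c y"] by (simp add: M_def)
        moreover have "M x - M y \<le> \<phi> c x (G c x) - \<phi> c y (G c x)" using \<phi>_max[of c y "G c x"] by (simp add: M_def)
        ultimately have "\<bar>M y - M x\<bar> \<le> e * \<bar>y - x\<bar>"
          using var[OF that(2) d0 that(2)] var[OF d0 that(2) d0] by (simp add: abs_le_iff abs_minus_commute)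
        then show ?thesis using that(1) by (simp add: abs_divide field_simps)
      qed
      have "\<bar>(M y - M x) / (y - x)\<bar> \<le> e" if "y \<noteq> x" "dist y x < d / 2" for y
        using bound that by (simp add: dist_real_def)
      then have "dist ((M y - M x) / (y - x)) 0 < e'" if "y \<noteq> x" "dist y x < d / 2" for y
        using that e(2) by (simp add: dist_real_def) (meson le_less_trans)
      then show "\<forall>\<^sub>F y in at x. dist ((M y - M x) / (y - x)) 0 < e'"
        unfolding eventually_at using d(1) half_gt_zero by blast
    qed
    then show ?thesis by (simp add: has_field_derivative_iff)
  qed
  then have "M x = M 0" using DERIV_isconst_all[of M] by blast
  then show ?thesis by (simp add: M_def \<alpha>_def)
qed

lemma \<phi>_le: "\<phi> c x y \<le> \<alpha> c"
  using \<phi>_max[of c x y] by (simp add: action_constant)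

lemma G_inj: "inj (G c)"
proof (rule injI)
  fix x y assume "G c x = G c y"
  then have "F (x, \<eta> c x) = F (y, \<eta> c y)" by (simp add: F_leaf)
  then show "x = y" using F_inj by (auto dest: injD)
qed

text \<open>If \<open>G c\<close> were decreasing, the derivative of \<open>\<phi>\<close> in \<open>x\<close> would have the opposite sign, and
  \<open>(x, G c x)\<close> would minimize \<open>\<phi>\<close> strictly in the first argument, while \<open>\<alpha> c\<close> is an upper bound.\<close>

lemma degree_eq_1: "k = 1"
proof (rule ccontr)
  assume "k \<noteq> 1"
  then have k: "k = - 1" using degree by simp
  have "continuous_on UNIV (G 0)" using G_comp[of UNIV "\<lambda>_. 0" "\<lambda>x. x"] by (simp add: continuous_on_id)
  then have "strict_mono (G 0) \<or> strict_antimono_on UNIV (G 0)"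
    using injective_eq_monotone_map[of UNIV "G 0"] G_inj by simp
  moreover have "G 0 1 < G 0 0" using G_shift[of 0 0] k by simp
  ultimately have anti: "G 0 y < G 0 x" if "x < y" for x y
    using that by (auto simp: strict_mono_def monotone_on_def) (meson less_asym zero_less_one)
  have "\<phi> 0 0 (G 0 0) < \<phi> 0 1 (G 0 0)"
  proof (rule DERIV_pos_imp_increasing_open[of 0 1])
    fix x :: real assume "0 < x" "x < 1"
    then have "\<eta> 0 x < rad x (G 0 0)" using anti[of 0 x] by (simp add: less_rad_iff G_def)
    then show "\<exists>w. ((\<lambda>x. \<phi> 0 x (G 0 0)) has_real_derivative w) (at x) \<and> 0 < w"
      using \<phi>_deriv_x by (intro exI conjI) auto
  qed (auto intro!: continuous_at_imp_continuous_on DERIV_isCont[OF \<phi>_deriv_x])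
  then show False using \<phi>_le[of 0 1 "G 0 0"] by (simp add: action_constant)
qed

lemma G_strict_mono: "strict_mono (G c)"
proof -
  have "continuous_on UNIV (G c)" using G_comp[of UNIV "\<lambda>_. c" "\<lambda>x. x"] by (simp add: continuous_on_id)
  then have "strict_mono (G c) \<or> strict_antimono_on UNIV (G c)"
    using injective_eq_monotone_map[of UNIV "G c"] G_inj by simp
  moreover have "G c 0 < G c 1" using G_shift[of c 0] degree_eq_1 by simp
  ultimately show ?thesis by (auto simp: monotone_on_def) (meson less_asym zero_less_one)
qed

sublocale monotone_leaves U \<eta> G \<alpha>
proof (rule monotone_leaves.intro)
  show "degree_one (G c)" for c
    using G_strict_mono[of c] G_shift degree_eq_1 by (simp add: degree_one_def strict_mono_mono)
  show "U d (G c x) - U c (G c x) - (U d x - U c x) \<le> \<alpha> d - \<alpha> c" for c d x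
    using \<phi>_le[of d x "G c x"] action_constant[of c x] by (simp add: \<phi>_def)
  show "\<alpha> d - \<alpha> c \<le> U d (G d x) - U c (G d x) - (U d x - U c x)" for c d x
    using \<phi>_le[of c x "G d x"] action_constant[of d x] by (simp add: \<phi>_def)
qed (fact \<eta>_cont \<eta>_periodic \<eta>_less U_deriv U_0 U_1 G_cont G_less)+

end

section \<open>Shear along a leaf of periodic points\<close>

text \<open>An area-preserving linear map of the plane with a fixed vector \<open>e\<close> is unipotent: all vectors
  \<open>L v - v\<close> are parallel to \<open>e\<close>.\<close>

lemma wedge_preserving_funpow:
  fixes L :: "real \<times> real \<Rightarrow> real \<times> real"
  assumes lin: "linear L" and wedge: "\<And>v w. wedge (L v) (L w) = wedge v w"
    and e: "L e = e" "e \<noteq> 0"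
  shows "(L ^^ N) v = v + real N *\<^sub>R (L v - v)"
proof -
  have inv: "L (L v - v) = L v - v" for v
  proof -
    have w: "wedge e (L v - v) = 0" using wedge[of e v] e(1) by (simp add: wedge_def algebra_simps)
    have "\<exists>t. L v - v = t *\<^sub>R e"
    proof (cases "fst e = 0")
      case True
      then have "snd e \<noteq> 0" using e(2) by (simp add: prod_eq_iff)
      then have "L v - v = (snd (L v - v) / snd e) *\<^sub>R e" using w True by (simp add: wedge_def prod_eq_iff)
      then show ?thesis by blast
    next
      case False
      then have "L v - v = (fst (L v - v) / fst e) *\<^sub>R e" using w by (simp add: wedge_def prod_eq_iff field_simps)
      then show ?thesis by blast
    qed
    then obtain t where "L v - v = t *\<^sub>R e" by blast
    then show ?thesis using e(1) linear_scale[OF lin] by metis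
  qed
  show ?thesis
  proof (induction N)
    case (Suc N)
    have "(L ^^ Suc N) v = L (v + real N *\<^sub>R (L v - v))" using Suc by simp
    also have "\<dots> = L v + real N *\<^sub>R (L v - v)"
      by (simp only: linear_add[OF lin] linear_scale[OF lin] inv)
    also have "\<dots> = v + real (Suc N) *\<^sub>R (L v - v)" by (simp add: algebra_simps)
    finally show ?case .
  qed simp
qed

lemma fst_partial_deriv:
  fixes F :: "real \<times> real \<Rightarrow> real \<times> real"
  assumes "(F has_derivative A) (at (x, r))"
  shows "((\<lambda>r. fst (F (x, r))) has_real_derivative fst (A (0, 1))) (at r)"
proof -
  have "((\<lambda>r. (x, r)) has_derivative (\<lambda>h. (0, h))) (at r)"
    by (auto intro!: derivative_eq_intros)
  from has_derivative_fst[OF has_derivative_compose[OF this assms]]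
  have 1: "((\<lambda>r. fst (F (x, r))) has_derivative (\<lambda>h. fst (A (0, h)))) (at r)" .
  have "(\<lambda>h. fst (A (0, h))) = (*) (fst (A (0, 1)))"
  proof
    fix h
    show "fst (A (0, h)) = fst (A (0, 1)) * h"
      using linear_scale[OF has_derivative_linear[OF assms], of h "(0, 1)"] by simp
  qed
  with 1 show ?thesis
    unfolding has_field_derivative_def by (rule has_derivative_eq_rhs)
qed

context lifted_twist
begin

text \<open>The differential of the \<open>n\<close>-th iterate.\<close>

primrec tangent :: "nat \<Rightarrow> real \<times> real \<Rightarrow> (real \<times> real) \<Rightarrow>\<^sub>L (real \<times> real)" where
  "tangent 0 z = id_blinfun"
| "tangent (Suc n) z = F' ((F ^^ n) z) o\<^sub>L tangent n z"

lemma iterate_deriv: "((F ^^ n) has_derivative blinfun_apply (tangent n z)) (at z)"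
proof (induction n)
  case 0
  show ?case by (simp add: id_def[symmetric])
next
  case (Suc n)
  have "((\<lambda>z. F ((F ^^ n) z)) has_derivative (\<lambda>v. F' ((F ^^ n) z) (tangent n z v))) (at z)"
    by (rule has_derivative_compose[OF Suc F_deriv])
  then show ?case by (simp add: o_def)
qed

lemma iterate_cont: "continuous_on UNIV (F ^^ n)"
  by (intro continuous_at_imp_continuous_on ballI has_derivative_continuous[OF iterate_deriv])

lemma tangent_cont: "continuous_on UNIV (tangent n)"
proof (induction n)
  case 0
  then show ?case by (simp add: continuous_on_const)
next
  case (Suc n)
  have "continuous_on UNIV (\<lambda>z. F' ((F ^^ n) z))"
    using continuous_on_compose2[OF F'_cont iterate_cont] by simp
  then show ?case using Suc by (auto intro!: continuous_intros)
qed

lemma wedge_tangent: "wedge (tangent n z v) (tangent n z w) = wedge v w"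
  by (induction n) (simp_all add: wedge_F')

lemma tangent_add: "tangent (m + n) z = tangent m ((F ^^ n) z) o\<^sub>L tangent n z"
  by (induction m) (auto simp: funpow_add intro!: blinfun_eqI)

lemma F_shift_int: "F (x + of_int j, r) = F (x, r) + (of_int j, 0)"
proof -
  have "fst (F (x + of_int j, r)) = fst (F (x, r)) + of_int j * 1"
    by (rule shift_int[of "\<lambda>x. fst (F (x, r))"]) (simp add: F_shift degree_eq_1)
  moreover have "snd (F (x + of_int j, r)) = snd (F (x, r)) + of_int j * 0"
    by (rule shift_int[of "\<lambda>x. snd (F (x, r))"]) (simp add: F_shift)
  ultimately show ?thesis by (simp add: prod_eq_iff)
qed

lemma iterate_shift: "(F ^^ n) (z + (of_int j, 0)) = (F ^^ n) z + (of_int j, 0)"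
proof (induction n)
  case (Suc n)
  have "F (w + (of_int j, 0)) = F w + (of_int j, 0)" for w
    using F_shift_int[of "fst w" j "snd w"] by (cases w) simp
  then show ?case using Suc by simp
qed simp

lemma tangent_shift: "tangent n (z + (of_int j, 0)) = tangent n z"
proof (rule blinfun_eqI)
  fix v
  have "((\<lambda>w. (F ^^ n) (w + (of_int j, 0))) has_derivative tangent n (z + (of_int j, 0))) (at z)"
    by (rule has_derivative_compose[OF _ iterate_deriv, of "\<lambda>w. w + (of_int j, 0)" "\<lambda>v. v", simplified])
      (auto intro!: derivative_eq_intros)
  moreover have "((\<lambda>w. (F ^^ n) (w + (of_int j, 0))) has_derivative tangent n z) (at z)"
    unfolding iterate_shift by (auto intro!: derivative_eq_intros iterate_deriv)
  ultimately show "tangent n (z + (of_int j, 0)) v = tangent n z v"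
    using has_derivative_unique by metis
qed

lemma iterate_leaf: "(F ^^ n) (x, \<eta> c x) = ((G c ^^ n) x, \<eta> c ((G c ^^ n) x))"
  by (induction n) (simp_all add: F_leaf)

definition shear_coeff :: "nat \<Rightarrow> real \<times> real \<Rightarrow> real" where
  "shear_coeff n z = fst (tangent n z (0, 1))"

lemma shear_coeff_cont: "continuous_on UNIV (shear_coeff n)"
  unfolding shear_coeff_def
  by (intro continuous_on_fst blinfun.continuous_on tangent_cont continuous_on_const)

lemma shear_coeff_shift: "shear_coeff n (x + 1, r) = shear_coeff n (x, r)"
  using tangent_shift[of n "(x, r)" 1] by (simp add: shear_coeff_def)

lemma iterate_deriv_r: "((\<lambda>r. fst ((F ^^ n) (x, r))) has_real_derivative shear_coeff n (x, r)) (at r)"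
  unfolding shear_coeff_def by (rule fst_partial_deriv[OF iterate_deriv])

text \<open>The plane is filled by leaves that are ordered by their parameter, and the iterates are increasing in
  the parameter.\<close>

lemma shear_coeff_nonneg: "0 \<le> shear_coeff n (x, r)"
proof -
  have "mono (\<lambda>r. fst ((F ^^ n) (x, r)))"
  proof (rule monoI)
    fix r s :: real assume "r \<le> s"
    obtain c d where cd: "\<eta> c x = r" "\<eta> d x = s" using \<eta>_surj by meson
    then have "c \<le> d" using \<open>r \<le> s\<close> \<eta>_less[of d c x] by (meson not_le)
    then show "fst ((F ^^ n) (x, r)) \<le> fst ((F ^^ n) (x, s))"
      using iter_le[of c d n x] unfolding cd[symmetric] iterate_leaf by simp
  qed
  then show ?thesis
    by (rule mono_on_imp_deriv_nonneg[OF _ iterate_deriv_r]) simp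
qed

text \<open>The vertical direction turns under the differentials without coming back to the vertical. If it
  were vertical after \<open>n\<close> steps, it could only point upwards there, by the twist and because the
  next shear coefficient is not negative; but then, again by the twist, it pointed to the left one step
  before, which is excluded too.\<close>

lemma shear_coeff_pos:
  assumes "0 < n" shows "0 < shear_coeff n z"
proof -
  obtain m where n: "n = Suc m" using assms not0_implies_Suc by auto
  define v w where "v = tangent m z (0, 1)" and "w = tangent n z (0, 1)"
  define A where "A = F' ((F ^^ m) z)"
  have w: "w = A v" by (simp add: w_def v_def n A_def)
  have nonneg: "0 \<le> fst v" "0 \<le> fst w" "0 \<le> fst (tangent (Suc n) z (0, 1))"
    using shear_coeff_nonneg[of m "fst z" "snd z"] shear_coeff_nonneg[of n "fst z" "snd z"]
      shear_coeff_nonneg[of "Suc n" "fst z" "snd z"]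
    by (simp_all add: shear_coeff_def v_def w_def del: tangent.simps)
  have "fst w \<noteq> 0"
  proof
    assume w0: "fst w = 0"
    have "wedge (tangent n z (1, 0)) w = 1" unfolding w_def wedge_tangent by (simp add: wedge_def)
    then have "snd w \<noteq> 0" using w0 by (auto simp: wedge_def)
    have "tangent (Suc n) z (0, 1) = F' ((F ^^ n) z) w" by (simp add: w_def)
    also have "w = snd w *\<^sub>R (0, 1)" using w0 by (simp add: prod_eq_iff)
    finally have "fst (tangent (Suc n) z (0, 1)) = snd w * fst (F' ((F ^^ n) z) (0, 1))"
      by (simp only: blinfun.scaleR_right fst_scaleR real_scaleR_def)
    then have "0 < snd w" using nonneg(3) twist_deriv[of "(F ^^ n) z"] \<open>snd w \<noteq> 0\<close>
      by (metis linorder_not_less mult_neg_pos order_le_less)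
    moreover have "wedge (A (0, 1)) w = - fst v" unfolding w A_def wedge_F' by (simp add: wedge_def)
    then have "fst (A (0, 1)) * snd w = - fst v" using w0 by (simp add: wedge_def)
    moreover have "0 < fst (A (0, 1))" unfolding A_def by (rule twist_deriv)
    ultimately have "fst v < 0" by (metis mult_pos_pos neg_0_less_iff_less)
    then show False using nonneg(1) by simp
  qed
  then show ?thesis using nonneg(2) by (simp add: shear_coeff_def w_def)
qed

lemma leaf_comp:
  assumes "continuous_on T f"
  shows "continuous_on T (\<lambda>z. (f z, \<eta> c (f z)))"
  by (intro continuous_on_Pair \<eta>_comp assms continuous_on_const)

text \<open>The return map minus the identity is constant along the leaf. If its differential were injective, it
  would separate a point of the leaf from nearby points.\<close>

lemma periodic_leaf_fixed_direction:
  assumes per: "\<And>x. (G c ^^ q) x = x + of_int p"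
  obtains e where "tangent q (x, \<eta> c x) e = e" "e \<noteq> 0"
proof (rule ccontr)
  note direction = that
  assume no_direction: "\<not> thesis"
  define z L where "z = (x, \<eta> c x)" and "L = tangent q z"
  have triv: "e = 0" if "L e = e" for e
    using direction[of e] no_direction that unfolding L_def z_def by blast
  have lin: "linear (\<lambda>v. L v - v)"
    by (intro linear_compose_sub linear_id[unfolded id_def]) (simp_all add: bounded_linear.linear[OF blinfun.bounded_linear_right])
  have "inj (\<lambda>v. L v - v)"
    unfolding linear_injective_0[OF lin] using triv by auto
  then obtain B where B: "0 < B" "\<And>v. B * norm v \<le> norm (L v - v)"
    using linear_inj_bounded_below_pos[OF lin] by blast
  have "((\<lambda>w. (F ^^ q) w - w) has_derivative (\<lambda>v. L v - v)) (at z)"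
    unfolding L_def by (intro has_derivative_diff iterate_deriv has_derivative_ident)
  then obtain d where d: "0 < d" "\<And>y. norm (y - z) < d \<Longrightarrow>
      norm ((F ^^ q) y - y - ((F ^^ q) z - z) - (L (y - z) - (y - z))) \<le> B / 2 * norm (y - z)"
    unfolding has_derivative_at_alt using B(1) half_gt_zero by blast
  have "continuous_on UNIV (\<lambda>t. (t, \<eta> c t))" by (intro leaf_comp continuous_on_id)
  then have "isCont (\<lambda>t. (t, \<eta> c t)) x" by (rule continuous_on_interior) simp
  then obtain s where s: "0 < s" "\<And>t. dist t x < s \<Longrightarrow> dist (t, \<eta> c t) (x, \<eta> c x) < d"
    unfolding continuous_at_eps_delta using d(1) by blast
  define y where "y = (x + s / 2, \<eta> c (x + s / 2))"
  have yz: "norm (y - z) < d" using s(2)[of "x + s / 2"] s(1) by (simp add: y_def z_def dist_norm)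
  have leaf: "(F ^^ q) (t, \<eta> c t) - (t, \<eta> c t) = (of_int p, 0)" for t
  proof -
    have "\<eta> c (t + of_int p) = \<eta> c t + of_int p * 0"
      by (rule shift_int) (simp add: \<eta>_periodic)
    then show ?thesis by (simp add: iterate_leaf per)
  qed
  have "B * norm (y - z) \<le> norm (L (y - z) - (y - z))" by (rule B(2))
  also have "\<dots> = norm ((F ^^ q) y - y - ((F ^^ q) z - z) - (L (y - z) - (y - z)))"
    unfolding y_def z_def leaf by (simp add: norm_minus_commute)
  also have "\<dots> \<le> B / 2 * norm (y - z)" by (rule d(2)[OF yz])
  finally have "y = z" using B(1) by simp
  then show False using s(1) by (simp add: y_def z_def)
qed

lemma periodic_leaf_shear_coeff:
  assumes "\<And>x. (G c ^^ q) x = x + of_int p"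
  shows "shear_coeff (N * q) (x, \<eta> c x) = N * shear_coeff q (x, \<eta> c x)"
proof -
  define z L where "z = (x, \<eta> c x)" and "L = tangent q z"
  obtain e where e: "L e = e" "e \<noteq> 0"
    using periodic_leaf_fixed_direction[OF assms, of x] by (metis L_def z_def)
  have iter: "(F ^^ (N * q)) z = z + (of_int (int N * p), 0)" for N
  proof (induction N)
    case (Suc N)
    have "\<eta> c (x + of_int p) = \<eta> c x + of_int p * 0"
      by (rule shift_int) (simp add: \<eta>_periodic)
    then have q: "(F ^^ q) z = z + (of_int p, 0)" by (simp add: z_def iterate_leaf assms)
    have "(F ^^ (Suc N * q)) z = (F ^^ q) ((F ^^ (N * q)) z)" by (simp add: funpow_add)
    also have "\<dots> = z + (of_int p, 0) + (of_int (int N * p), 0)" unfolding Suc iterate_shift q ..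
    finally show ?case by (simp add: algebra_simps)
  qed (simp add: zero_prod_def[symmetric])
  have tan: "tangent (N * q) z v = (blinfun_apply L ^^ N) v" for N v
  proof (induction N)
    case (Suc N)
    have "tangent (Suc N * q) z v = tangent q ((F ^^ (N * q)) z) (tangent (N * q) z v)"
      by (simp add: tangent_add)
    then show ?case unfolding iter tangent_shift Suc by (simp add: L_def)
  qed simp
  have "(blinfun_apply L ^^ N) (0, 1) = (0, 1) + real N *\<^sub>R (L (0, 1) - (0, 1))"
    by (rule wedge_preserving_funpow[where L = "blinfun_apply L", OF _ _ e]) (simp_all add: L_def wedge_tangent bounded_linear.linear[OF blinfun.bounded_linear_right])
  then show ?thesis
    unfolding shear_coeff_def z_def[symmetric] tan L_def[symmetric] by simp
qed

text \<open>By the mean value theorem in the direction of the fibre, the displacement of an orbit that starts over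
  the leaf is its height times a shear coefficient taken between the two leaves.\<close>

lemma periodic_leaf_shear_rate:
  assumes q: "0 < q" and per: "\<And>x. (G c ^^ q) x = x + of_int p"
  shows "shear_rate c q p (\<lambda>x. shear_coeff q (x, \<eta> c x))"
  unfolding shear_rate_def
proof (intro conjI allI impI)
  show "continuous_on UNIV (\<lambda>x. shear_coeff q (x, \<eta> c x))"
    by (rule continuous_on_compose2[OF shear_coeff_cont leaf_comp]) (auto intro: continuous_on_id)
  show "0 < shear_coeff q (x, \<eta> c x)" for x by (rule shear_coeff_pos[OF q])
  show "shear_coeff q (x + 1, \<eta> c (x + 1)) = shear_coeff q (x, \<eta> c x)" for x
    by (simp add: \<eta>_periodic shear_coeff_shift)
  fix N :: nat and e :: real assume e: "0 < e"
  define g where "g s x = shear_coeff (N * q) (x, \<eta> c x + s)" for s x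
  have "continuous_on UNIV (\<lambda>z. shear_coeff (N * q) (snd z, \<eta> c (snd z) + fst z))"
    by (rule continuous_on_compose2[OF shear_coeff_cont]) (auto intro!: continuous_intros \<eta>_comp)
  then have "continuous_on UNIV (\<lambda>(s, x). g s x)" by (simp add: g_def case_prod_unfold)
  moreover have "g s (x + 1) = g s x" for s x by (simp add: g_def \<eta>_periodic shear_coeff_shift)
  ultimately obtain d where d: "0 < d" "\<And>s x y. \<bar>s - 0\<bar> < d \<Longrightarrow> \<bar>x - y\<bar> < d \<Longrightarrow> \<bar>g s x - g 0 y\<bar> < e"
    using periodic_family_uniform[of g e 0] e by metis
  obtain d' where d': "0 < d'" "\<And>b x y. \<bar>b - c\<bar> < d' \<Longrightarrow> \<bar>x - y\<bar> < d' \<Longrightarrow> \<bar>\<eta> b x - \<eta> c y\<bar> < d"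
    using periodic_family_uniform[OF \<eta>_cont \<eta>_periodic d(1), of c] by metis
  have "\<bar>(G b ^^ (N * q)) x - x - of_int (int N * p) - real N * shear_coeff q (x, \<eta> c x) * (\<eta> b x - \<eta> c x)\<bar>
      \<le> e * \<bar>\<eta> b x - \<eta> c x\<bar>" if b: "\<bar>b - c\<bar> < d'" for b x
  proof -
    define f where "f r = fst ((F ^^ (N * q)) (x, r)) - g 0 x * r" for r
    have small: "\<bar>\<eta> b x - \<eta> c x\<bar> < d" using d'(2)[OF b, of x x] d'(1) by simp
    have "norm (f (\<eta> b x) - f (\<eta> c x)) \<le> e * norm (\<eta> b x - \<eta> c x)"
    proof (rule field_differentiable_bound[where S = "ball (\<eta> c x) d"])
      show "(f has_field_derivative shear_coeff (N * q) (x, r) - g 0 x) (at r within ball (\<eta> c x) d)" for r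
        unfolding f_def
        by (rule has_field_derivative_at_within, rule DERIV_diff[OF iterate_deriv_r])
          (auto intro!: derivative_eq_intros)
      show "norm (shear_coeff (N * q) (x, r) - g 0 x) \<le> e" if "r \<in> ball (\<eta> c x) d" for r
        using d(2)[of "r - \<eta> c x" x x] d(1) that by (simp add: g_def dist_real_def abs_minus_commute)
    qed (use small d(1) in \<open>auto simp: dist_real_def abs_minus_commute\<close>)
    moreover have "fst ((F ^^ (N * q)) (x, \<eta> c x)) = x + of_int (int N * p)"
    proof -
      have "(G c ^^ (N * q)) x = x + of_int (int N * p)"
      proof (induction N)
        case (Suc N)
        have "(G c ^^ (Suc N * q)) x = (G c ^^ q) ((G c ^^ (N * q)) x)" by (simp add: funpow_add)
        then show ?case unfolding per Suc by (simp add: algebra_simps)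
      qed simp
      then show ?thesis by (simp add: iterate_leaf)
    qed
    moreover have "fst ((F ^^ (N * q)) (x, \<eta> b x)) = (G b ^^ (N * q)) x" by (simp add: iterate_leaf)
    moreover have "g 0 x = N * shear_coeff q (x, \<eta> c x)"
      unfolding g_def using periodic_leaf_shear_coeff[OF per] by simp
    ultimately show ?thesis by (simp add: f_def algebra_simps)
  qed
  then show "\<forall>\<^sub>F b in at c. \<forall>x.
      \<bar>(G b ^^ (N * q)) x - x - of_int (int N * p) - real N * shear_coeff q (x, \<eta> c x) * (\<eta> b x - \<eta> c x)\<bar>
        \<le> e * \<bar>\<eta> b x - \<eta> c x\<bar>"
    unfolding eventually_at dist_real_def using d'(1) by blast
qed

lemma leaf_parameter_derivative:
  obtains D where "\<And>c x. ((\<lambda>c. U c x) has_real_derivative D c x) (at c)"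
    and "continuous_on UNIV (\<lambda>(c, x). D c x)"
    and "\<And>c. degree_one (D c)" and "\<And>c x. D c (G c x) = D c x + rho c"
  using leaf_conjugacies periodic_leaf_shear_rate by blast

end

section \<open>Lifting to the universal cover\<close>

lemma to_circle_add: "to_circle (x + y) = to_circle x + to_circle y"
  by (simp add: plus_circle.abs_eq)

lemma to_circle_diff: "to_circle (x - y) = to_circle x - to_circle y"
  by (simp add: minus_circle.abs_eq)

lemma to_circle_of_int: "to_circle (of_int k) = 0"
  by (simp add: zero_circle_def to_circle_eq_iff)

lemma to_circle_shift: "to_circle (x + 1) = to_circle x"
  by (simp add: to_circle_eq_iff)

lemma to_circle_surj: obtains t where "\<theta> = to_circle t"
  using circle.abs_eq_iff Quotient3_abs_rep[OF Quotient3_circle] by metis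

lemma cover_eq_iff: "cover z = cover w \<longleftrightarrow> (\<exists>k :: int. z = w + (of_int k, 0))"
proof
  assume "cover z = cover w"
  then have "fst z - fst w \<in> \<int>" "snd z = snd w" by (auto simp: cover_def to_circle_eq_iff)
  then obtain k :: int where "fst z = fst w + of_int k" by (metis Ints_cases add_diff_cancel_left' diff_add_cancel add.commute)
  then show "\<exists>k :: int. z = w + (of_int k, 0)" using \<open>snd z = snd w\<close> by (auto simp: prod_eq_iff)
qed (auto simp: cover_def to_circle_eq_iff)

lemma continuous_on_cover: "continuous_on UNIV cover"
  unfolding cover_def
  by (intro continuous_intros continuous_on_compose2[OF continuous_on_to_circle]) auto

lemma continuous_on_circleI:
  assumes "continuous_on UNIV (\<lambda>t. h (to_circle t))"
  shows "continuous_on UNIV h"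
  using assms unfolding continuous_on_open_vimage[OF open_UNIV]
  by (simp add: open_circle_def vimage_def)

text \<open>The difference is continuous with values in a discrete set.\<close>

lemma lifts_differ_by_translation:
  fixes A B :: "real \<times> real \<Rightarrow> real \<times> real"
  assumes "continuous_on UNIV A" "continuous_on UNIV B" "\<And>z. cover (A z) = cover (B z)"
  obtains k :: int where "\<And>z. A z = B z + (of_int k, 0)"
proof -
  have ints: "\<exists>k :: int. A z = B z + (of_int k, 0)" for z
    using assms(3)[of z] by (simp add: cover_eq_iff)
  have "(\<lambda>z. fst (A z) - fst (B z)) constant_on UNIV"
  proof (rule continuous_discrete_range_constant)
    show "continuous_on UNIV (\<lambda>z. fst (A z) - fst (B z))" by (intro continuous_intros assms)
    fix z
    have "1 \<le> norm ((fst (A w) - fst (B w)) - (fst (A z) - fst (B z)))"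
      if "fst (A w) - fst (B w) \<noteq> fst (A z) - fst (B z)" for w
    proof -
      obtain k l :: int where "A z = B z + (of_int k, 0)" "A w = B w + (of_int l, 0)" using ints by blast
      then have *: "fst (A w) - fst (B w) = of_int l" "fst (A z) - fst (B z) = of_int k" by auto
      then have "l \<noteq> k" using that by auto
      then have "1 \<le> \<bar>l - k\<bar>" by linarith
      then show ?thesis unfolding * by (metis (mono_tags) of_int_1_le_iff of_int_abs of_int_diff real_norm_def)
    qed
    then show "\<exists>e>0. \<forall>w. w \<in> UNIV \<and> fst (A w) - fst (B w) \<noteq> fst (A z) - fst (B z) \<longrightarrow>
        e \<le> norm ((fst (A w) - fst (B w)) - (fst (A z) - fst (B z)))"
      by (intro exI[of _ 1]) auto
  qed (simp add: convex_connected)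
  then obtain a where a: "\<And>z. fst (A z) - fst (B z) = a" by (auto simp: constant_on_def)
  obtain k :: int where k: "A (0, 0) = B (0, 0) + (of_int k, 0)" using ints by blast
  then have ak: "a = of_int k" using a[of "(0, 0)"] by simp
  have "A z = B z + (of_int k, 0)" for z
  proof -
    obtain l :: int where "A z = B z + (of_int l, 0)" using ints by blast
    then show ?thesis using a[of z] ak by (simp add: prod_eq_iff)
  qed
  then show ?thesis by (rule that)
qed

lemma increasing_C1_diffeo_deriv_pos:
  assumes "increasing_C1_diffeo g" "(g has_real_derivative m) (at r)"
  shows "0 < m"
proof -
  have g: "strict_mono g" "bij g" "C1_map (inv g)" using assms(1) by (auto simp: increasing_C1_diffeo_def)
  have "0 \<le> m"
    by (rule mono_on_imp_deriv_nonneg[OF _ assms(2), of UNIV]) (use strict_mono_mono[OF g(1)] in simp_all)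
  moreover have "m \<noteq> 0"
  proof
    assume "m = 0"
    then have "(g has_derivative (\<lambda>_. 0)) (at r)" using assms(2) by (simp add: has_field_derivative_def lambda_zero)
    moreover obtain h where "(inv g has_derivative blinfun_apply h) (at (g r))"
      using g(3) unfolding C1_map_def by blast
    ultimately have "((\<lambda>r. inv g (g r)) has_derivative (\<lambda>v. h 0)) (at r)" by (rule has_derivative_compose)
    moreover have "(\<lambda>r. inv g (g r)) = (\<lambda>r. r)" using g(2) by (simp add: bij_is_inj)
    ultimately have "((\<lambda>r :: real. r) has_derivative (\<lambda>v. 0)) (at r)" by simp
    then have "(\<lambda>v :: real. 0 :: real) = (\<lambda>v. v)" using has_derivative_unique has_derivative_ident by blast
    then show False by (metis zero_neq_one)
  qed
  ultimately show ?thesis by simp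
qed

text \<open>The degree \<open>k\<close> is invertible because the degree of a lift of the inverse is an inverse of it.\<close>

lemma symplectic_twist_diffeo_lift:
  assumes "symplectic_twist_diffeo f"
  obtains F F' and k :: int where "is_lift F f"
    "\<And>z. (F has_derivative blinfun_apply (F' z)) (at z)" "continuous_on UNIV F'"
    "\<And>z v w. wedge (F' z v) (F' z w) = wedge v w"
    "\<And>x. increasing_C1_diffeo (\<lambda>r. fst (F (x, r)))" "\<And>z. 0 < fst (F' z (0, 1))"
    "\<And>z. F (z + (1, 0)) = F z + (of_int k, 0)" "real_of_int k = 1 \<or> real_of_int k = - 1"
    "inj F"
proof -
  have f: "bij f" "C1_annulus_map f" "C1_annulus_map (inv f)" "symplectic f" "twist f"
    using assms(1) by (auto simp: symplectic_twist_diffeo_def C1_annulus_diffeo_def)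
  obtain F F' where F: "is_lift F f" "\<And>z. (F has_derivative blinfun_apply (F' z)) (at z)" "continuous_on UNIV F'"
    using f(2) unfolding C1_annulus_map_def C1_map_def by blast
  obtain H where H: "is_lift H (inv f)"
    using f(3) unfolding C1_annulus_map_def by blast
  have cF: "continuous_on UNIV F" "\<And>z. cover (F z) = f (cover z)"
    and cH: "continuous_on UNIV H" "\<And>z. cover (H z) = inv f (cover z)"
    using F(1) H by (auto simp: is_lift_def)
  have cover_shift: "cover (z + (1, 0)) = cover z" for z
    by (simp add: cover_def to_circle_shift)
  have cont_shift: "continuous_on UNIV (\<lambda>z. A (z + (1, 0)))"
    if "continuous_on UNIV A" for A :: "real \<times> real \<Rightarrow> real \<times> real"
    by (rule continuous_on_compose2[OF that]) (auto intro!: continuous_intros)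
  obtain k :: int where k: "\<And>z. F (z + (1, 0)) = F z + (of_int k, 0)"
    by (rule lifts_differ_by_translation[OF cont_shift[OF cF(1)] cF(1)]) (auto simp: cF cover_shift)
  obtain k' :: int where k': "\<And>z. H (z + (1, 0)) = H z + (of_int k', 0)"
    by (rule lifts_differ_by_translation[OF cont_shift[OF cH(1)] cH(1)]) (auto simp: cH cover_shift)
  obtain i :: int where i: "\<And>z. F (H z) = z + (of_int i, 0)"
  proof (rule lifts_differ_by_translation)
    show "continuous_on UNIV (\<lambda>z. F (H z))" using continuous_on_compose2[OF cF(1) cH(1)] by simp
    show "cover (F (H z)) = cover z" for z using f(1) by (simp add: cF cH bij_is_surj surj_f_inv_f)
  qed (auto intro: continuous_on_id)
  obtain j :: int where j: "\<And>z. H (F z) = z + (of_int j, 0)"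
  proof (rule lifts_differ_by_translation)
    show "continuous_on UNIV (\<lambda>z. H (F z))" using continuous_on_compose2[OF cH(1) cF(1)] by simp
    show "cover (H (F z)) = cover z" for z using f(1) by (simp add: cF cH bij_is_inj inv_f_f)
  qed (auto intro: continuous_on_id)
  have F_inj: "inj F" by (rule injI) (metis j add_right_cancel)
  \<comment> \<open>both sides compute the lift F after H at the points 0 and 1\<close>
  have "k * k' = 1"
  proof -
    have "F (x + of_int m, r) = F (x, r) + (of_int m * of_int k, 0)" for x r and m :: int
    proof -
      have "fst (F (x + of_int m, r)) = fst (F (x, r)) + of_int m * of_int k"
        by (rule shift_int[of "\<lambda>x. fst (F (x, r))"]) (use k[of "(_, r)"] in simp)
      moreover have "snd (F (x + of_int m, r)) = snd (F (x, r)) + of_int m * 0"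
        by (rule shift_int[of "\<lambda>x. snd (F (x, r))"]) (use k[of "(_, r)"] in simp)
      ultimately show ?thesis by (simp add: prod_eq_iff)
    qed
    then have shift: "F (w + (of_int k', 0)) = F w + (of_int k' * of_int k, 0)" for w
      by (cases w) simp
    have "(0, 0) + (1, 0) + (of_int i, 0) = F (H ((0, 0) + (1, 0)))" by (simp only: i)
    also have "\<dots> = (0, 0) + (of_int i, 0) + (of_int k' * of_int k, 0)" by (simp only: k' shift i)
    finally have "real_of_int (k' * k) = 1" by simp
    then show ?thesis by (simp only: of_int_eq_1_iff mult.commute)
  qed
  then have degree: "real_of_int k = 1 \<or> real_of_int k = - 1"
    using zmult_eq_1_iff by auto
  have wedge: "wedge (F' z v) (F' z w) = wedge v w" for z v w
  proof -
    have "frechet_derivative F (at z) = blinfun_apply (F' z)" using frechet_derivative_at[OF F(2)] by simp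
    then show ?thesis
      using f(4)[unfolded symplectic_def, rule_format, OF F(1), of z v w]
      by (simp add: symplectic_form_eq wedge_def)
  qed
  have tw: "increasing_C1_diffeo (\<lambda>r. fst (F (x, r)))" for x
    using f(5) F(1) unfolding twist_def by blast
  have slant: "0 < fst (F' z (0, 1))" for z
  proof -
    obtain x r where z: "z = (x, r)" by (cases z)
    show ?thesis
      unfolding z by (rule increasing_C1_diffeo_deriv_pos[OF tw[of x] fst_partial_deriv[OF F(2)[of "(x, r)"]]])
  qed
  show ?thesis by (rule that) (fact F wedge tw slant k degree F_inj)+
qed

lemma generating_function_deriv:
  assumes "generating_function L u"
  shows "((\<lambda>t. u (to_circle t, c)) has_real_derivative partial_theta u (to_circle t) c) (at t)"
proof -
  have "(\<lambda>t. u (to_circle t, c)) differentiable (at t)"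
    using assms unfolding generating_function_def C1_map_def differentiable_def by blast
  then obtain m where m: "((\<lambda>t. u (to_circle t, c)) has_real_derivative m) (at t)"
    by (rule real_differentiableE)
  then have "((\<lambda>s. u (to_circle (t + s), c)) has_real_derivative m) (at 0)"
    using DERIV_shift[of "\<lambda>t. u (to_circle t, c)" m 0 t] by (simp add: add.commute)
  then have "partial_theta u (to_circle t) c = m"
    unfolding partial_theta_def to_circle_add[symmetric] by (rule DERIV_imp_deriv)
  then show ?thesis using m by simp
qed

text \<open>A leaf is determined by the integral of its graph function, and the leaf given by the generating
  function has integral \<open>c\<close>, since \<open>u\<close> is periodic. So both parametrizations of the leaves agree.\<close>

lemma foliation_leaves:
  assumes "C0_foliation L" and gen: "generating_function L u"
  defines "e \<equiv> \<lambda>c \<theta>. c + partial_theta u \<theta> c"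
  obtains \<Psi> where "homeomorphism UNIV UNIV (\<lambda>(\<theta>, c). (\<theta>, e c \<theta>)) \<Psi>"
proof -
  have ex: "\<exists>\<epsilon>. L = range (\<lambda>c. graph_of (\<epsilon> c)) \<and>
      (\<forall>c. continuous_on UNIV (\<epsilon> c) \<and> circle_integral (\<epsilon> c) = c) \<and>
      (\<exists>\<Psi>. homeomorphism UNIV UNIV (\<lambda>(\<theta>, c). (\<theta>, \<epsilon> c \<theta>)) \<Psi>)"
    using assms(1) unfolding C0_foliation_def by (rule conjunct2)
  then obtain \<epsilon> \<Psi> where leaves: "L = range (\<lambda>c. graph_of (\<epsilon> c))"
    and int_\<epsilon>: "\<forall>c. continuous_on UNIV (\<epsilon> c) \<and> circle_integral (\<epsilon> c) = c"
    and homeo: "homeomorphism UNIV UNIV (\<lambda>(\<theta>, c). (\<theta>, \<epsilon> c \<theta>)) \<Psi>"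
    by (elim exE conjE)
  have u0: "u (0, c) = 0" for c using gen by (simp add: generating_function_def)
  have leaf: "c + partial_theta u \<theta> c = \<epsilon> c \<theta>" for c \<theta>
  proof -
    obtain d where graph: "graph_of (\<lambda>\<theta>. c + partial_theta u \<theta> c) = graph_of (\<epsilon> d)"
      using gen leaves unfolding generating_function_def by blast
    have d: "c + partial_theta u \<theta> c = \<epsilon> d \<theta>" for \<theta>
    proof -
      have "(\<theta>, c + partial_theta u \<theta> c) \<in> graph_of (\<epsilon> d)"
        unfolding graph[symmetric] by (simp add: graph_of_def)
      then show ?thesis by (simp add: graph_of_def)
    qed
    have deriv: "((\<lambda>t. c * t + u (to_circle t, c)) has_real_derivative c + partial_theta u (to_circle t) c) (at t)" for t
      by (auto intro!: derivative_eq_intros generating_function_deriv[OF gen])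
    have "((\<lambda>t. c + partial_theta u (to_circle t) c) has_integral
        (c * 1 + u (to_circle 1, c)) - (c * 0 + u (to_circle 0, c))) {0..1}"
      by (intro fundamental_theorem_of_calculus zero_le_one
          has_field_derivative_at_within[OF deriv, unfolded has_real_derivative_iff_has_vector_derivative])
    moreover have "to_circle 1 = 0" "to_circle 0 = 0"
      using to_circle_of_int[of 1] to_circle_of_int[of 0] by simp_all
    ultimately have "circle_integral (\<lambda>\<theta>. c + partial_theta u \<theta> c) = c"
      unfolding circle_integral_def by (simp add: integral_unique u0)
    then have "d = c" using int_\<epsilon> by (simp add: d)
    then show ?thesis using d by simp
  qed
  show ?thesis by (rule that[of \<Psi>]) (use homeo in \<open>simp add: e_def leaf\<close>)
qed

lemma C1_map_partials:
  fixes g a b :: "real \<Rightarrow> real \<Rightarrow> real"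
  assumes t: "\<And>t c. ((\<lambda>t. g t c) has_real_derivative a t c) (at t)"
    and c: "\<And>t c. ((\<lambda>c. g t c) has_real_derivative b t c) (at c)"
    and a: "continuous_on UNIV (\<lambda>z. a (fst z) (snd z))" and b: "continuous_on UNIV (\<lambda>z. b (fst z) (snd z))"
  shows "C1_map (\<lambda>(t, c). g t c)"
  unfolding C1_map_def
proof (intro exI conjI allI)
  let ?g' = "\<lambda>z. a (fst z) (snd z) *\<^sub>R fst_blinfun + b (fst z) (snd z) *\<^sub>R snd_blinfun :: (real \<times> real) \<Rightarrow>\<^sub>L real"
  show "continuous_on UNIV ?g'"
    by (intro continuous_intros a b)
  fix z :: "real \<times> real"
  obtain t0 c0 where z: "z = (t0, c0)" by (cases z)
  have "((\<lambda>(t, c). g t c) has_derivative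
      (\<lambda>(h, h'). h * a t0 c0 + blinfun_apply (b t0 c0 *\<^sub>R id_blinfun) h')) (at (t0, c0) within UNIV \<times> UNIV)"
  proof (rule has_derivative_partialsI[where fy = "\<lambda>t c. b t c *\<^sub>R id_blinfun"])
    show "((\<lambda>t. g t c0) has_derivative (\<lambda>h. h * a t0 c0)) (at t0 within UNIV)"
      using t[of c0 t0] by (simp add: has_field_derivative_def mult.commute[of _ "a t0 c0"])
    show "((\<lambda>c. g t c) has_derivative blinfun_apply (b t c *\<^sub>R id_blinfun)) (at c within UNIV)" for t c
    proof -
      have "blinfun_apply (b t c *\<^sub>R id_blinfun) = (*) (b t c)"
        by (simp add: fun_eq_iff blinfun.scaleR_left)
      then show ?thesis using c[of t c] by (simp add: has_field_derivative_def)
    qed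
    have "continuous_on UNIV (\<lambda>z. b (fst z) (snd z) *\<^sub>R id_blinfun :: real \<Rightarrow>\<^sub>L real)"
      by (intro continuous_intros b)
    then show "continuous (at (t0, c0) within UNIV \<times> UNIV) (\<lambda>(x, y). b x y *\<^sub>R id_blinfun :: real \<Rightarrow>\<^sub>L real)"
      by (simp add: case_prod_unfold continuous_on_eq_continuous_within)
  qed auto
  moreover have "(\<lambda>(h, h'). h * a t0 c0 + blinfun_apply (b t0 c0 *\<^sub>R id_blinfun) h') = blinfun_apply (?g' z)"
    by (simp add: z fun_eq_iff blinfun.add_left blinfun.scaleR_left)
  ultimately show "((\<lambda>(t, c). g t c) has_derivative blinfun_apply (?g' z)) (at z)"
    by (simp only: z UNIV_Times_UNIV)
qed

lemma degree_one_continuous_surj: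
  assumes "degree_one h" "continuous_on UNIV h"
  obtains t where "h t = y"
proof -
  define a b where "a = y - h 0 - 1" and "b = y - h 0 + 1"
  have "h a \<le> y" "y \<le> h b"
    using degree_one_bound[OF assms(1), of a 0] degree_one_bound[OF assms(1), of b 0]
    by (simp_all add: a_def b_def abs_le_iff)
  moreover have "continuous_on {a..b} h" using assms(2) continuous_on_subset by blast
  ultimately show ?thesis using IVT'[of h a y b] that by (auto simp: a_def b_def)
qed

lemma less_if_never_equal:
  fixes a b V W :: "real \<Rightarrow> real"
  assumes cont: "continuous_on UNIV a" "continuous_on UNIV b" and ne: "\<And>s. a s \<noteq> b s"
    and V: "\<And>s. (V has_real_derivative a s) (at s)" and W: "\<And>s. (W has_real_derivative b s) (at s)"
    and less: "V 1 - V 0 < W 1 - W 0"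
  shows "a t < b t"
proof (rule ccontr)
  assume "\<not> a t < b t"
  then have t: "b t - a t < 0" using ne[of t] by linarith
  have conn: "connected (range (\<lambda>s. b s - a s))"
    by (intro connected_continuous_image continuous_on_diff cont connected_UNIV)
  have neg: "b s - a s < 0" for s
  proof (rule ccontr)
    assume "\<not> b s - a s < 0"
    then have "0 \<le> b s - a s" by simp
    then have "0 \<in> range (\<lambda>s. b s - a s)"
      by (rule connectedD_interval[OF conn rangeI[of _ t] rangeI[of _ s] less_imp_le[OF t]])
    then obtain s' where "0 = b s' - a s'" by (rule rangeE)
    then show False using ne[of s'] by simp
  qed
  have "W 1 - V 1 < W 0 - V 0"
  proof (rule DERIV_neg_imp_decreasing[of 0 1 "\<lambda>s. W s - V s"])
    show "\<exists>y. ((\<lambda>s. W s - V s) has_real_derivative y) (at s) \<and> y < 0" for s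
      by (rule exI[of _ "b s - a s"]) (rule conjI[OF DERIV_diff[OF W V] neg])
  qed simp
  then show False using less by simp
qed

theorem theorem1p1:
  fixes f :: "annulus \<Rightarrow> annulus" and L :: "annulus set set" and u :: "annulus \<Rightarrow> real"
  assumes "symplectic_twist_diffeo f"
    and "C0_integrable f"
    and "C0_foliation L" and "invariant_foliation f L"
    and "generating_function L u"
  shows "C1_annulus_fun u \<and>
    (\<forall>c. graph_of (\<lambda>\<theta>. c + partial_theta u \<theta> c) \<in> L \<and>
         (\<exists>\<alpha>. semiconjugacy (conj_map u c) (projected_dynamics f u c) (rotation \<alpha>)))"
proof -
  obtain F F' and k :: int where F: "is_lift F f"
      "\<And>z. (F has_derivative blinfun_apply (F' z)) (at z)" "continuous_on UNIV F'"
    and wedge: "\<And>z v w. wedge (F' z v) (F' z w) = wedge v w"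
    and tw: "\<And>x. increasing_C1_diffeo (\<lambda>r. fst (F (x, r)))" and slant: "\<And>z. 0 < fst (F' z (0, 1))"
    and k: "\<And>z. F (z + (1, 0)) = F z + (of_int k, 0)" and degree: "real_of_int k = 1 \<or> real_of_int k = - 1"
    and F_inj: "inj F"
    by (rule symplectic_twist_diffeo_lift[OF assms(1)]) (rule that)
  have cF: "cover (F z) = f (cover z)" for z
    using F(1) unfolding is_lift_def by blast
  define e where "e c \<theta> = c + partial_theta u \<theta> c" for c \<theta>
  obtain \<Psi> where homeo: "homeomorphism UNIV UNIV (\<lambda>(\<theta>, c). (\<theta>, e c \<theta>)) \<Psi>"
    unfolding e_def by (rule foliation_leaves[OF assms(3,5)])
  have u0: "u (0, c) = 0" and e_leaf: "graph_of (e c) \<in> L" for c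
    using assms(5) by (simp_all add: generating_function_def e_def[abs_def])
  note u_deriv = generating_function_deriv[OF assms(5)]
  \<comment> \<open>u is the periodic part of the primitive of a leaf; c is the mean slope of the primitive\<close>
  define \<eta> U where "\<eta> c t = e c (to_circle t)" and "U c t = c * t + u (to_circle t, c)" for c t
  have \<eta>_cont: "continuous_on UNIV (\<lambda>(c, t). \<eta> c t)"
  proof -
    have 1: "continuous_on UNIV (\<lambda>(\<theta>, c). (\<theta>, e c \<theta>))"
      by (rule homeomorphism_cont1[OF homeo])
    have 2: "continuous_on UNIV (\<lambda>z :: real \<times> real. cover (snd z, fst z))"
      by (rule continuous_on_compose2[OF continuous_on_cover]) (auto intro!: continuous_intros)
    from continuous_on_snd[OF continuous_on_compose2[OF 1 2 subset_UNIV]] show ?thesis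
      by (simp add: \<eta>_def cover_def case_prod_unfold)
  qed
  have e_inj: "c = d" if "e c \<theta> = e d \<theta>" for c d \<theta>
  proof -
    have "\<Psi> (\<theta>, e c \<theta>) = (\<theta>, c)" "\<Psi> (\<theta>, e d \<theta>) = (\<theta>, d)"
      using homeomorphism_apply1[OF homeo, of "(\<theta>, c)"] homeomorphism_apply1[OF homeo, of "(\<theta>, d)"] by simp_all
    then have "(\<theta>, c) = (\<theta>, d)" using that by metis
    then show ?thesis by simp
  qed
  have e_surj: "\<exists>c. e c \<theta> = r" for \<theta> r
  proof -
    have "(\<lambda>(\<theta>, c). (\<theta>, e c \<theta>)) (\<Psi> (\<theta>, r)) = (\<theta>, r)"
      by (rule homeomorphism_apply2[OF homeo UNIV_I])
    then show ?thesis by (cases "\<Psi> (\<theta>, r)") auto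
  qed
  have U_deriv: "(U c has_real_derivative \<eta> c t) (at t)" for c t
    unfolding U_def \<eta>_def by (rule DERIV_cong[OF DERIV_add[OF DERIV_cmult_Id u_deriv]]) (simp add: e_def)
  have to_circle_01: "to_circle 0 = 0" "to_circle 1 = 0"
    using to_circle_of_int[of 0] to_circle_of_int[of 1] by simp_all
  have U01: "U c 0 = 0" "U c 1 = c" for c
    by (simp_all add: U_def to_circle_01 u0)
  have \<eta>_cont1: "continuous_on UNIV (\<eta> c)" for c
  proof -
    have "continuous_on UNIV (\<lambda>t. (c, t))" by (intro continuous_intros)
    from continuous_on_compose2[OF \<eta>_cont this] show ?thesis by simp
  qed
  have \<eta>_less: "\<eta> c t < \<eta> d t" if cd: "c < d" for c d t
  proof (rule less_if_never_equal[where a = "\<eta> c" and b = "\<eta> d" and V = "U c" and W = "U d"])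
    show "\<eta> c s \<noteq> \<eta> d s" for s using e_inj[of c "to_circle s" d] cd by (auto simp: \<eta>_def)
    show "U c 1 - U c 0 < U d 1 - U d 0" using cd by (simp add: U01)
  qed (fact \<eta>_cont1 U_deriv)+
  have invariant: "snd (F (t, \<eta> c t)) = \<eta> c (fst (F (t, \<eta> c t)))" for c t
  proof -
    have "f ` graph_of (e c) = graph_of (e c)"
      using assms(4) e_leaf unfolding invariant_foliation_def by blast
    moreover have "cover (t, \<eta> c t) \<in> graph_of (e c)" by (simp add: cover_def graph_of_def \<eta>_def)
    ultimately have "cover (F (t, \<eta> c t)) \<in> graph_of (e c)" unfolding cF by blast
    then show ?thesis by (simp add: cover_def graph_of_def \<eta>_def)
  qed
  interpret lifted_twist F F' \<eta> U "of_int k"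
  proof
    show "strict_mono (\<lambda>r. fst (F (x, r)))" for x using tw[of x] by (simp add: increasing_C1_diffeo_def)
    show "\<exists>r. fst (F (x, r)) = y" for x y
    proof -
      have "surj (\<lambda>r. fst (F (x, r)))" using tw[of x] by (simp add: increasing_C1_diffeo_def bij_is_surj)
      then obtain r where "y = fst (F (x, r))" by (rule surjE)
      then show ?thesis by blast
    qed
    show "F (x + 1, r) = F (x, r) + (of_int k, 0)" for x r using k[of "(x, r)"] by simp
    show "\<eta> c (x + 1) = \<eta> c x" for c x by (simp add: \<eta>_def to_circle_shift)
    show "\<exists>c. \<eta> c x = r" for x r unfolding \<eta>_def by (rule e_surj)
  qed (fact F wedge slant degree F_inj \<eta>_cont \<eta>_less U_deriv U01 invariant)+
  obtain D where D: "\<And>c t. ((\<lambda>c. U c t) has_real_derivative D c t) (at c)"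
    and D_cont: "continuous_on UNIV (\<lambda>(c, t). D c t)"
    and D_degree: "\<And>c. degree_one (D c)" and D_conj: "\<And>c t. D c (G c t) = D c t + rho c"
    by (rule leaf_parameter_derivative) (rule that)
  have u_c: "((\<lambda>c. u (to_circle t, c)) has_real_derivative D c t - t) (at c)" for c t
  proof -
    have "((\<lambda>c. U c t - c * t) has_real_derivative D c t - t) (at c)"
      by (auto intro!: derivative_eq_intros D)
    then show ?thesis by (simp add: U_def)
  qed
  have D_comp: "continuous_on T (\<lambda>z. D (g z) (h z))" if "continuous_on T g" "continuous_on T h"
    for g h :: "real \<times> real \<Rightarrow> real" and T
    using continuous_on_compose2[OF D_cont continuous_on_Pair[OF that]] by simp
  have "C1_map (\<lambda>(t, c). u (to_circle t, c))"
  proof (rule C1_map_partials)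
    show "((\<lambda>t. u (to_circle t, c)) has_real_derivative \<eta> c t - c) (at t)" for t c
      using u_deriv[of c t] by (simp add: \<eta>_def e_def)
    show "continuous_on UNIV (\<lambda>z. \<eta> (snd z) (fst z) - snd z)" by (intro continuous_intros \<eta>_comp)
    show "continuous_on UNIV (\<lambda>z. D (snd z) (fst z) - fst z)" by (intro continuous_intros D_comp)
  qed (fact u_c)
  then have "C1_map (\<lambda>z. u (cover z))" by (simp add: cover_def case_prod_unfold)
  moreover have "semiconjugacy (conj_map u c) (projected_dynamics f u c) (rotation (to_circle (rho c)))" for c
  proof -
    have h: "conj_map u c (to_circle t) = to_circle (D c t)" for t
    proof -
      have "partial_c u (to_circle t) c = D c t - t"
        unfolding partial_c_def by (rule DERIV_imp_deriv[OF u_c])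
      then show ?thesis by (simp add: conj_map_def to_circle_diff)
    qed
    have g: "projected_dynamics f u c (to_circle t) = to_circle (G c t)" for t
    proof -
      have "f (to_circle t, \<eta> c t) = cover (F (t, \<eta> c t))" by (simp add: cF) (simp add: cover_def)
      then show ?thesis by (simp add: projected_dynamics_def e_def[symmetric] G_def \<eta>_def[symmetric] cover_def)
    qed
    have Dc: "continuous_on UNIV (D c)"
    proof -
      have "continuous_on UNIV (\<lambda>t. (c, t))" by (intro continuous_intros)
      from continuous_on_compose2[OF D_cont this] show ?thesis by simp
    qed
    have "continuous_on UNIV (conj_map u c)"
    proof (rule continuous_on_circleI)
      show "continuous_on UNIV (\<lambda>t. conj_map u c (to_circle t))"
        unfolding h by (rule continuous_on_compose2[OF continuous_on_to_circle Dc]) simp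
    qed
    moreover have "surj (conj_map u c)"
      unfolding surj_def
    proof
      fix \<theta>
      obtain y where y: "\<theta> = to_circle y" by (rule to_circle_surj)
      obtain t where "D c t = y" by (rule degree_one_continuous_surj[OF D_degree Dc])
      then show "\<exists>\<theta>'. \<theta> = conj_map u c \<theta>'" using h[of t] y by metis
    qed
    moreover have "conj_map u c \<circ> projected_dynamics f u c = rotation (to_circle (rho c)) \<circ> conj_map u c"
    proof
      fix \<theta>
      obtain t where t: "\<theta> = to_circle t" by (rule to_circle_surj)
      show "(conj_map u c \<circ> projected_dynamics f u c) \<theta> = (rotation (to_circle (rho c)) \<circ> conj_map u c) \<theta>"
        by (simp add: t g h D_conj rotation_def to_circle_add)
    qed
    ultimately show ?thesis by (simp add: semiconjugacy_def)
  qed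
  ultimately show ?thesis using e_leaf unfolding C1_annulus_fun_def e_def[abs_def] by blast
qed

end
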